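(* Let $\varepsilon_0(p)$ be the John--Nirenberg constant of $\mathrm{BMO}^p((0,1))$ and let $C(\varepsilon,p)$ be the best constant in the integral John--Nirenberg inequality on $(0,1)$ (both defined in the context). For every $p\in[1,2]$, $$\varepsilon_0(p)=\left[\frac pe\Big(\Gamma(p)-\int_0^1t^{p-1}e^t\,dt\Big)+1\right]^{1/p}.$$ Furthermore, if $1<p\le2$, then for all $\varepsilon$ with $(2-p)\varepsilon_0(p)\le\varepsilon<\varepsilon_0(p)$, $$C(\varepsilon,p)=\frac{e^{-\varepsilon/\varepsilon_0(p)}}{1-\varepsilon/\varepsilon_0(p)};$$ and for all $0\le\varepsilon<\frac2e$, $$\frac{e^{-\frac e2\varepsilon}}{1-\frac e2\varepsilon}\le C(\varepsilon,1)\le k^{-1}(\varepsilon),$$ where $k^{-1}:[0,\frac2e)\to[1,\infty)$ is the inverse of the function $k$ defined in the context.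
   Context: For an interval $J$, $\langle\varphi\rangle_J=\frac1{|J|}\int_J\varphi$. For an interval $Q$ and $p>0$, $\|\varphi\|_{\mathrm{BMO}^p(Q)}=\sup_{J\subset Q}\langle|\varphi-\langle\varphi\rangle_J|^p\rangle_J^{1/p}$, the supremum being over all subintervals $J$ of $Q$; $\mathrm{BMO}(Q)$ is the set of locally integrable $\varphi$ for which this is finite (the set is the same for all $p>0$). For $p>0$ and $\varepsilon\ge0$ let $C(\varepsilon,p)\in[1,\infty]$ be the smallest constant such that $\langle e^\varphi\rangle_J\le C(\varepsilon,p)\,e^{\langle\varphi\rangle_J}$ for every $\varphi\in\mathrm{BMO}((0,1))$ with $\|\varphi\|_{\mathrm{BMO}^p((0,1))}\le\varepsilon$ and every subinterval $J\subset(0,1)$. The John--Nirenberg constant $\varepsilon_0(p)$ is the largest number such that $C(\varepsilon,p)<\infty$ for all $0\le\varepsilon<\varepsilon_0(p)$. For $C\ge1$, $\xi^\pm=\xi^\pm(C)$ are the two solutions of $e^{-\xi}=C(1-\xi)$ with $-\infty<\xi^-\le0\le\xi^+<1$ (both are $0$ when $C=1$). For $C>1$, $$k(C)=2\,\frac{(1-\xi^-)(1-\xi^+)}{\xi^+-\xi^-}\,(C-1),$$ and $k(1)=0$. The function $k$ is a continuous strictly increasing bijection of $[1,\infty)$ onto $[0,\frac2e)$. *)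

theory Defs
  imports "HOL-Analysis.Analysis"
begin

definition subintervals :: "real set \<Rightarrow> real set set" where
  "subintervals Q = {J. is_interval J \<and> bounded J \<and> interior J \<noteq> {} \<and> J \<subseteq> Q}"

definition locally_integrable :: "real set \<Rightarrow> (real \<Rightarrow> real) \<Rightarrow> bool" where
  "locally_integrable Q \<phi> \<longleftrightarrow> (\<forall>K. compact K \<and> K \<subseteq> Q \<longrightarrow> \<phi> absolutely_integrable_on K)"

definition avg :: "real set \<Rightarrow> (real \<Rightarrow> real) \<Rightarrow> real" where
  "avg J \<phi> = (LINT x:J|lebesgue. \<phi> x) / measure lebesgue J"

text \<open>Average of a nonnegative function, with value \<open>\<infinity>\<close> if the function is not integrable.\<close>

definition nnavg :: "real set \<Rightarrow> (real \<Rightarrow> real) \<Rightarrow> ennreal" where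
  "nnavg J f = (\<integral>\<^sup>+x\<in>J. ennreal (f x) \<partial>lebesgue) / emeasure lebesgue J"

definition epowr :: "ennreal \<Rightarrow> real \<Rightarrow> ennreal" where
  "epowr x a = (if x = \<infinity> then \<infinity> else ennreal (enn2real x powr a))"

text \<open>
  A subinterval may share an endpoint with an open \<open>Q\<close>, and there a locally integrable \<open>\<phi>\<close> could
  fail to be integrable, in which case \<open>avg J \<phi>\<close> has the junk value \<open>0\<close>. This does not affect
  \<open>bmo\<close>: finiteness of the supremum over the compact subintervals alone forces \<open>\<phi>\<close> to be
  integrable on every bounded subinterval of \<open>Q\<close>.
\<close>

definition bmo_norm :: "real \<Rightarrow> real set \<Rightarrow> (real \<Rightarrow> real) \<Rightarrow> ennreal" where
  "bmo_norm p Q \<phi> =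
     (SUP J \<in> subintervals Q. epowr (nnavg J (\<lambda>x. \<bar>\<phi> x - avg J \<phi>\<bar> powr p)) (1 / p))"

definition bmo :: "real \<Rightarrow> real set \<Rightarrow> (real \<Rightarrow> real) set" where
  "bmo p Q = {\<phi>. locally_integrable Q \<phi> \<and> bmo_norm p Q \<phi> < \<infinity>}"

definition jn_admissible :: "real \<Rightarrow> real \<Rightarrow> ennreal \<Rightarrow> bool" where
  "jn_admissible \<epsilon> p C \<longleftrightarrow>
     (\<forall>\<phi> \<in> bmo p {0<..<1}. bmo_norm p {0<..<1} \<phi> \<le> ennreal \<epsilon> \<longrightarrow>
        (\<forall>J \<in> subintervals {0<..<1}.
           nnavg J (\<lambda>x. exp (\<phi> x)) \<le> C * ennreal (exp (avg J \<phi>))))"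

definition jn_C :: "real \<Rightarrow> real \<Rightarrow> ennreal" where
  "jn_C \<epsilon> p = Inf {C. 1 \<le> C \<and> jn_admissible \<epsilon> p C}"

text \<open>The infimum is attained, so \<open>jn_C\<close> is the smallest constant.\<close>

lemma jn_admissible_jn_C: "1 \<le> jn_C \<epsilon> p" "jn_admissible \<epsilon> p (jn_C \<epsilon> p)"
proof -
  show "1 \<le> jn_C \<epsilon> p"
    unfolding jn_C_def by (rule Inf_greatest) auto
  have *: "x \<le> C * ennreal (exp a) \<longleftrightarrow> x * ennreal (exp (- a)) \<le> C" for x C a
  proof -
    have 1: "ennreal (exp a) * ennreal (exp (- a)) = 1"
      by (simp flip: ennreal_mult exp_add)
    have "x * ennreal (exp (- a)) \<le> C" if "x \<le> C * ennreal (exp a)"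
      using mult_right_mono[OF that, of "ennreal (exp (- a))"] by (simp add: mult.assoc 1)
    moreover have "x \<le> C * ennreal (exp a)" if "x * ennreal (exp (- a)) \<le> C"
      using mult_right_mono[OF that, of "ennreal (exp a)"]
      by (simp add: mult.assoc mult.commute[of "ennreal (exp (- a))"] 1)
    ultimately show ?thesis by blast
  qed
  show "jn_admissible \<epsilon> p (jn_C \<epsilon> p)"
    unfolding jn_C_def jn_admissible_def *
    by (intro ballI impI Inf_greatest) auto
qed

definition jn_eps0 :: "real \<Rightarrow> ereal" where
  "jn_eps0 p = Sup {d. \<forall>\<epsilon>\<ge>0. ereal \<epsilon> < d \<longrightarrow> jn_C \<epsilon> p < \<infinity>}"

definition xi_plus :: "real \<Rightarrow> real" where
  "xi_plus C = (THE \<xi>. 0 \<le> \<xi> \<and> \<xi> < 1 \<and> exp (- \<xi>) = C * (1 - \<xi>))"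

definition xi_minus :: "real \<Rightarrow> real" where
  "xi_minus C = (THE \<xi>. \<xi> \<le> 0 \<and> exp (- \<xi>) = C * (1 - \<xi>))"

definition jn_k :: "real \<Rightarrow> real" where
  "jn_k C =
     (if C = 1 then 0
      else 2 * ((1 - xi_minus C) * (1 - xi_plus C) / (xi_plus C - xi_minus C)) * (C - 1))"

end

theory Submission
  imports Defs "HOL-Probability.Probability" "HOL-Real_Asymp.Real_Asymp"
begin

text \<open>
  The lower bounds come from \<open>\<phi> = - \<xi> ln\<close>, whose oscillation is largest on intervals touching \<open>0\<close>:
  any two centered functions whose difference changes sign once, in the right direction, are ordered by
  every convex mean. The same comparison shows that truncation does not increase the \<open>BMO\<^sup>p\<close> norm, so
  the upper bounds only have to be proved for bounded \<open>\<phi>\<close>, for which the best constant \<open>C\<close> with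
  \<open>\<langle>exp \<phi>\<rangle> \<le> C exp \<langle>\<phi>\<rangle>\<close> on all subintervals is finite. It is almost attained on some \<open>J\<close>, and there
  \<open>\<langle>|\<phi> - \<langle>\<phi>\<rangle>|\<^sup>p\<rangle>\<close> is bounded below by a quantity that increases with \<open>C\<close>.

  That lower bound only concerns the monotone rearrangement of \<open>\<phi>\<close>, whose averages over initial and final
  intervals inherit the constant \<open>C\<close> by the rising sun lemma. For \<open>p > 1\<close> let \<open>u(s)\<close> be the average over
  \<open>(s, 1)\<close>: the planes supporting the Bellman candidate along the tangents to the upper boundary of
  \<open>{(x, y). exp x \<le> y \<le> C exp x}\<close>, evaluated at the point of tangency over \<open>u(s)\<close>, integrate to the
  claimed bound, because \<open>u\<close> is monotone and the candidate is locally convex when \<open>\<xi> \<ge> 2 - p\<close>. For \<open>p = 1\<close>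
  a single plane through the bottom point \<open>(0, 1)\<close> and the two tangents from it suffices.
\<close>

section \<open>Supporting planes of the Bellman candidate\<close>

text \<open>The domain between \<open>exp x\<close> and \<open>C * exp x\<close> is not convex, so a
  plane cannot simply be averaged over it. The way out is that each plane is only compared with
  lower boundary points to the left of its tangency, and a monotone profile before \<open>s\<close>
  stays below its average after \<open>s\<close>. Along a tangent the candidate is affine with slope
  \<open>p * m\<close>, and planes over neighbouring tangents fit together if
  \<open>m' = m - sgn r * |r| powr (p - 1)\<close>. The solution without exponential growth at
  infinity brings in \<open>Gamma p\<close>; the tangent touching over the mean 0 starts at
  \<open>r = -1\<close>, whence the integral over \<open>{0..1}\<close> in the constant. Local
  convexity means that the slope of the planes in \<open>y\<close> decreases with \<open>r\<close>.
  For \<open>p < 2\<close> the critical parameter is \<open>r = - (2 - p) / \<xi>\<close>; the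
  condition \<open>\<xi> \<ge> 2 - p\<close> keeps it in \<open>{-1..0}\<close>, where the
  inequality reduces to \<open>Gamma p \<le> powg 1 p 1\<close>. For \<open>p = 1\<close> no
  \<open>\<xi> < 1\<close> meets this condition. Since \<open>C\<close> is only almost attained, the
  lower bounds carry a term linear in the defect.\<close>

lemma nondecreasing_if_DERIV_nonneg_off_zero:
  fixes f :: "real \<Rightarrow> real"
  assumes "a \<le> b" and cont: "continuous_on {a..b} f"
    and D: "\<And>x. a < x \<Longrightarrow> x < b \<Longrightarrow> x \<noteq> 0 \<Longrightarrow> \<exists>y. DERIV f x :> y \<and> y \<ge> 0"
  shows "f a \<le> f b"
proof (cases "a < 0 \<and> 0 < b")
  case True
  have "f a \<le> f 0" 
    by (rule DERIV_nonneg_imp_increasing_open) (use True D cont in \<open>auto intro: continuous_on_subset\<close>)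
  also have "f 0 \<le> f b" 
    by (rule DERIV_nonneg_imp_increasing_open) (use True D cont in \<open>auto intro: continuous_on_subset\<close>)
  finally show ?thesis .
next
  case False
  show ?thesis
    by (rule DERIV_nonneg_imp_increasing_open) (use assms False D cont in \<open>auto intro: continuous_on_subset\<close>)
qed

text \<open>The point 0 is exempt here and in the preceding lemma because \<open>spow p\<close> has
  no finite derivative there when \<open>1 < p < 2\<close>; continuity bridges the gap.\<close>

lemma nonincreasing_if_DERIV_nonpos_off_zero:
  fixes f :: "real \<Rightarrow> real"
  assumes "a \<le> b" and cont: "continuous_on {a..b} f"
    and D: "\<And>x. a < x \<Longrightarrow> x < b \<Longrightarrow> x \<noteq> 0 \<Longrightarrow> \<exists>y. DERIV f x :> y \<and> y \<le> 0"
  shows "f b \<le> f a"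
proof -
  have "- f a \<le> - f b"
    by (rule nondecreasing_if_DERIV_nonneg_off_zero[where f="\<lambda>x. - f x"])
       (use assms in \<open>auto intro!: continuous_intros, metis D DERIV_minus neg_0_le_iff_le\<close>)
  then show ?thesis by simp
qed

section \<open>Incomplete Gamma functions and the slope of the candidate along tangents\<close>

definition powg :: "real \<Rightarrow> real \<Rightarrow> real \<Rightarrow> real" where
  "powg c p r = integral {0..r} (\<lambda>s. s powr (p - 1) * exp (c * s))"

definition spow :: "real \<Rightarrow> real \<Rightarrow> real" where
  "spow p r = max r 0 powr (p - 1) - max (- r) 0 powr (p - 1)"

text \<open>This is the integral of \<open>spow p (r + t) exp (- t)\<close> over \<open>t \<ge> 0\<close>; at most one of the two
  \<open>powg\<close> terms is nonzero, because the integral over \<open>{0..r}\<close> is \<open>0\<close> for negative \<open>r\<close>.\<close>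

definition tangent_slope :: "real \<Rightarrow> real \<Rightarrow> real" where
  "tangent_slope p r = exp r * (Gamma p - powg (-1) p r - powg 1 p (- r))"

lemma continuous_on_max_powr:
  fixes f :: "real \<Rightarrow> real"
  assumes "p > 1" "continuous_on S f" shows "continuous_on S (\<lambda>s. max (f s) 0 powr (p - 1))"
  by (rule continuous_on_powr') (use assms in \<open>auto intro!: continuous_intros\<close>)

lemma continuous_on_powg_integrand:
  fixes b c p :: real
  assumes "p > 1" shows "continuous_on {0..b} (\<lambda>s. s powr (p - 1) * exp (c * s))"
proof -
  have "continuous_on {0..b} (\<lambda>s. max s 0 powr (p - 1) * exp (c * s))"
    by (intro continuous_on_mult continuous_on_max_powr continuous_intros assms)
  then show ?thesis by (rule continuous_on_eq) (auto simp: max_def)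
qed

lemma powg_neg: "r \<le> 0 \<Longrightarrow> powg c p r = 0"
  by (cases "r = 0") (auto simp: powg_def)

lemma DERIV_powg:
  assumes "p > 1" "r > 0"
  shows "(powg c p has_real_derivative r powr (p - 1) * exp (c * r)) (at r)"
proof -
  have "((\<lambda>u. integral {0..u} (\<lambda>s. s powr (p - 1) * exp (c * s))) has_real_derivative r powr (p - 1) * exp (c * r)) (at r within {0..r+1})"
    by (rule integral_has_real_derivative[OF continuous_on_powg_integrand]) (use assms in auto)
  moreover have "at r within {0..r+1} = at r"
    by (rule at_within_interior) (use assms in auto)
  ultimately show ?thesis unfolding powg_def[abs_def] by simp
qed

lemma continuous_on_powg:
  assumes "p > 1" shows "continuous_on S (powg c p)"
proof -
  have "isCont (powg c p) r" for r
  proof -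
    have 1: "continuous_on {0..\<bar>r\<bar>+1} (powg c p)"
      unfolding powg_def[abs_def]
      by (intro indefinite_integral_continuous_1 integrable_continuous_real continuous_on_powg_integrand assms)
    have "continuous_on {..<\<bar>r\<bar>+1} (\<lambda>r. powg c p (max r 0))"
      by (rule continuous_on_compose2[OF 1]) (auto intro!: continuous_intros)
    moreover have "(\<lambda>r. powg c p (max r 0)) = powg c p"
      by (rule ext) (metis linorder_linear max.absorb2 max.absorb1 powg_neg order_refl)
    ultimately have "continuous_on {..<\<bar>r\<bar>+1} (powg c p)" by (simp only:)
    then show ?thesis
      by (subst (asm) continuous_on_eq_continuous_at) auto
  qed
  then show ?thesis by (simp add: continuous_at_imp_continuous_on)
qed

lemma continuous_on_tangent_slope:
  assumes "p > 1" shows "continuous_on S (tangent_slope p)"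
  unfolding tangent_slope_def[abs_def]
  by (intro continuous_intros continuous_on_powg[OF assms] continuous_on_compose2[OF continuous_on_powg[OF assms, of UNIV]]) auto

lemma continuous_on_spow:
  assumes "p > 1" shows "continuous_on S (spow p)"
  unfolding spow_def[abs_def] using assms
  by (intro continuous_on_diff continuous_on_max_powr continuous_intros) auto

lemma spow_pos: "r \<ge> 0 \<Longrightarrow> spow p r = r powr (p - 1)"
  and spow_neg: "r \<le> 0 \<Longrightarrow> spow p r = - ((-r) powr (p - 1))"
  by (auto simp: spow_def max_def)

lemma DERIV_spow:
  assumes "r \<noteq> 0"
  shows "(spow p has_real_derivative (p - 1) * \<bar>r\<bar> powr (p - 2)) (at r)"
proof (cases "r > 0")
  case True
  have "((\<lambda>r. r powr (p - 1)) has_real_derivative (p - 1) * \<bar>r\<bar> powr (p - 2)) (at r)"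
    using True by (auto intro!: derivative_eq_intros simp: algebra_simps)
  then show ?thesis
    by (rule has_field_derivative_transform_within_open[where S="{0<..}"]) (use True in \<open>auto simp: spow_pos\<close>)
next
  case False
  then have "r < 0" using assms by simp
  have "((\<lambda>r. - ((-r) powr (p - 1))) has_real_derivative (p - 1) * \<bar>r\<bar> powr (p - 2)) (at r)"
    using \<open>r < 0\<close> by (auto intro!: derivative_eq_intros simp: algebra_simps)
  then show ?thesis
    by (rule has_field_derivative_transform_within_open[where S="{..<0}"]) (use \<open>r < 0\<close> in \<open>auto simp: spow_neg\<close>)
qed

lemma DERIV_abs_powr:
  assumes "r \<noteq> 0"
  shows "((\<lambda>r. \<bar>r\<bar> powr p) has_real_derivative p * spow p r) (at r)"
proof (cases "r > 0")
  case True
  have "((\<lambda>r. r powr p) has_real_derivative p * spow p r) (at r)"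
    using True by (auto intro!: derivative_eq_intros simp: spow_pos)
  then show ?thesis
    by (rule has_field_derivative_transform_within_open[where S="{0<..}"]) (use True in auto)
next
  case False
  then have "r < 0" using assms by simp
  have "((\<lambda>r. (-r) powr p) has_real_derivative p * spow p r) (at r)"
    using \<open>r < 0\<close> by (auto intro!: derivative_eq_intros simp: spow_neg)
  then show ?thesis
    by (rule has_field_derivative_transform_within_open[where S="{..<0}"]) (use \<open>r < 0\<close> in auto)
qed

text \<open>This linear equation is the compatibility condition between neighbouring tangents. Its
  solutions differ by multiples of \<open>exp r\<close>, and the constant \<open>Gamma p\<close>
  selects the one without exponential growth at infinity.\<close>

lemma DERIV_tangent_slope:
  assumes "p > 1" "r \<noteq> 0"
  shows "(tangent_slope p has_real_derivative tangent_slope p r - spow p r) (at r)"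
proof (cases "r > 0")
  case True
  have "((\<lambda>r. exp r * (Gamma p - powg (-1) p r)) has_real_derivative tangent_slope p r - spow p r) (at r)"
    using True assms
    by (auto intro!: derivative_eq_intros DERIV_powg simp: tangent_slope_def spow_pos powg_neg algebra_simps exp_minus field_simps)
  then show ?thesis
    by (rule has_field_derivative_transform_within_open[where S="{0<..}"])
       (use True in \<open>auto simp: tangent_slope_def powg_neg\<close>)
next
  case False
  then have r: "r < 0" using assms by simp
  have "((\<lambda>r. powg 1 p (- r)) has_real_derivative (- r) powr (p - 1) * exp (1 * (- r)) * (- 1)) (at r)"
    by (rule DERIV_chain2[OF DERIV_powg]) (use r assms in \<open>auto intro!: derivative_eq_intros\<close>)
  then have "((\<lambda>r. exp r * (Gamma p - powg 1 p (- r))) has_real_derivative tangent_slope p r - spow p r) (at r)"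
    using r by (auto intro!: derivative_eq_intros simp: tangent_slope_def spow_neg powg_neg exp_minus field_simps)
  then show ?thesis
    by (rule has_field_derivative_transform_within_open[where S="{..<0}"])
       (use r in \<open>auto simp: tangent_slope_def powg_neg\<close>)
qed

section \<open>Gamma estimates behind the convexity of the candidate\<close>

lemma powg_tendsto_Gamma:
  assumes "p > 1"
  shows "(powg (-1) p \<longlongrightarrow> Gamma p) at_top"
proof -
  have "((\<lambda>t. t powr (p - 1) / exp t) has_integral Gamma p) {0..}"
    using Gamma_integral_real[of p] assms by simp
  moreover have "(\<lambda>t. t powr (p - 1) / exp t) = (\<lambda>s. s powr (p - 1) * exp ((-1) * s))"
    by (simp add: exp_minus field_simps)
  ultimately have h: "((\<lambda>s. s powr (p - 1) * exp ((-1) * s)) has_integral Gamma p) {0..}" by simp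
  then have "((\<lambda>s. s powr (p - 1) * exp ((-1) * s)) absolutely_integrable_on {0..})"
    by (intro nonnegative_absolutely_integrable_1) auto
  note 1 = this
  have "((\<lambda>b. LINT x:{0..b}|lebesgue. x powr (p - 1) * exp ((-1) * x)) \<longlongrightarrow> (LINT x:{0..}|lebesgue. x powr (p - 1) * exp ((-1) * x))) at_top"
    by (rule tendsto_set_lebesgue_integral_at_top) (use 1 in auto)
  moreover have "(LINT x:{0..}|lebesgue. x powr (p - 1) * exp ((-1) * x)) = Gamma p"
    using 1 h by (simp add: set_lebesgue_integral_eq_integral integral_unique)
  moreover have "(LINT x:{0..b}|lebesgue. x powr (p - 1) * exp ((-1) * x)) = powg (-1) p b" for b
    unfolding powg_def
    by (rule set_lebesgue_integral_eq_integral(2)[OF set_integrable_subset[OF 1]]) auto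
  ultimately show ?thesis by simp
qed

text \<open>Log-convexity between the equal values \<open>Gamma 1 = Gamma 2 = 1\<close>.\<close>

lemma Gamma_le_1:
  fixes p :: real
  assumes "1 \<le> p" "p \<le> 2" shows "Gamma p \<le> 1"
proof -
  have "ln (Gamma ((1 - (p - 1)) *\<^sub>R 1 + (p - 1) *\<^sub>R 2)) \<le> (1 - (p - 1)) * ln (Gamma 1) + (p - 1) * ln (Gamma (2::real))"
    using convex_onD[OF log_convex_Gamma_real, of "p - 1" 1 2] assms by simp
  moreover have "Gamma (2::real) = 1" using Gamma_fact[of 1, where 'a=real] by simp
  ultimately have "ln (Gamma p) \<le> 0" by simp
  then show ?thesis using Gamma_real_pos[of p] assms by simp
qed

text \<open>On \<open>{0..1}\<close> the factor \<open>s powr (p - 1)\<close> is at least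
  \<open>s\<close>, and \<open>s * exp s\<close> has integral 1. Together with
  \<open>Gamma_le_1\<close> this is the endpoint case \<open>w = 1\<close> of
  \<open>Gamma_excess_le\<close>.\<close>

lemma powg_1_ge_1:
  assumes "1 < p" "p \<le> 2" shows "powg 1 p 1 \<ge> 1"
proof -
  have "((\<lambda>x::real. x * exp x) has_integral ((1 - 1) * exp 1 - (0 - 1) * exp 0)) {0..1}"
    by (rule fundamental_theorem_of_calculus)
       (auto intro!: derivative_eq_intros simp: algebra_simps simp flip: has_real_derivative_iff_has_vector_derivative)
  then have h: "((\<lambda>x::real. x * exp x) has_integral 1) {0..1}" by simp
  have "1 = integral {0..1} (\<lambda>x::real. x * exp x)" using h by (simp add: integral_unique)
  also have "\<dots> \<le> powg 1 p 1"
    unfolding powg_def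
  proof (rule integral_le)
    show "(\<lambda>x::real. x * exp x) integrable_on {0..1}" using h by blast
    show "(\<lambda>s. s powr (p - 1) * exp (1 * s)) integrable_on {0..1}"
      by (intro integrable_continuous_real continuous_on_powg_integrand assms)
    fix x :: real assume x: "x \<in> {0..1}"
    have "x powr 1 \<le> x powr (p - 1)" using x assms by (intro powr_mono') auto
    then show "x * exp x \<le> x powr (p - 1) * exp (1 * x)" using x by simp
  qed
  finally show ?thesis .
qed

text \<open>The right side consists of the first two terms of the expansion of the tail integral by
  parts. The next coefficient \<open>(p - 1) * (p - 2)\<close> is not positive, so the bound minus
  the tail decreases to its limit 0 at infinity and is therefore nonnegative.\<close>

lemma Gamma_tail_le:
  assumes "1 < p" "p \<le> 2" "r > 0"
  shows "Gamma p - powg (-1) p r \<le> exp (- r) * (r powr (p - 1) + (p - 1) * r powr (p - 2))"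
proof -
  define h where "h = (\<lambda>x. exp (- x) * (x powr (p - 1) + (p - 1) * x powr (p - 2)) + powg (-1) p x)"
  have D: "(h has_real_derivative exp (- x) * ((p - 1) * (p - 2) * x powr (p - 3))) (at x)" if "x > 0" for x
    unfolding h_def using that assms
    by (auto intro!: derivative_eq_intros DERIV_powg simp: algebra_simps)
  have "h y \<le> h r" if "r \<le> y" for y
  proof (rule DERIV_nonpos_imp_nonincreasing[OF that])
    fix x assume "r \<le> x" "x \<le> y"
    then show "\<exists>y. (h has_real_derivative y) (at x) \<and> y \<le> 0"
      using D[of x] assms by (intro exI[of _ "exp (- x) * ((p - 1) * (p - 2) * x powr (p - 3))"] conjI) (auto simp: mult_le_0_iff zero_le_mult_iff)
  qed
  moreover have "(h \<longlongrightarrow> 0 + Gamma p) at_top"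
    unfolding h_def
  proof (intro tendsto_add powg_tendsto_Gamma assms)
    show "((\<lambda>x. exp (- x) * (x powr (p - 1) + (p - 1) * x powr (p - 2))) \<longlongrightarrow> 0) at_top"
      using assms by real_asymp
  qed
  ultimately have "0 + Gamma p \<le> h r"
    by (intro tendsto_upperbound[where f=h and F=at_top]) (auto simp: eventually_at_top_linorder)
  then show ?thesis by (simp add: h_def)
qed

text \<open>The right side is exactly what the slope inequality at \<open>r = - w\<close> demands
  when \<open>\<xi> = (2 - p) / w\<close>. After adding \<open>powg 1 p w\<close> it decreases in
  \<open>w\<close>, so everything reduces to \<open>w = 1\<close>, where the factor
  \<open>1 - w\<close> vanishes.\<close>

lemma Gamma_excess_le:
  assumes "1 < p" "p < 2" "2 - p < w" "w \<le> 1"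
  shows "Gamma p - powg 1 p w \<le> exp w * w powr (p - 1) * (1 - w) / (w - (2 - p))"
proof -
  define a where "a = 2 - p"
  have a: "0 < a" "a < 1" "p - 1 = 1 - a" "a < w" "w > 0" using assms by (auto simp: a_def)
  define h where "h = (\<lambda>x. exp x * x powr (1 - a) * (1 - x) / (x - a) + powg 1 p x)"
  have D: "(h has_real_derivative - (exp x * x powr (1 - a) * (a * (1 - a)) / (x * (x - a)\<^sup>2))) (at x)" if "x > a" for x
  proof -
    have x: "x > 0" "x - a \<noteq> 0" using that a by auto
    define E where "E = exp x * x powr (1 - a)"
    have pw: "x powr (- a) = x powr (1 - a) / x" using x powr_diff[of x "1 - a" 1] by simp
    have dN: "((\<lambda>x. exp x * x powr (1 - a) * (1 - x)) has_real_derivative (E + (1 - a) * (E / x)) * (1 - x) - E) (at x)"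
      using x by (auto intro!: derivative_eq_intros simp: pw E_def) (auto simp: field_simps)?
    have "(h has_real_derivative (((E + (1 - a) * (E / x)) * (1 - x) - E) * (x - a) - exp x * x powr (1 - a) * (1 - x) * (1 - 0)) / ((x - a) * (x - a))
       + x powr (p - 1) * exp (1 * x)) (at x)"
      unfolding h_def using x assms
      by (intro DERIV_add DERIV_divide dN DERIV_powg DERIV_diff DERIV_ident DERIV_const) auto
    moreover have "(((E + (1 - a) * (E / x)) * (1 - x) - E) * (x - a) - E * (1 - x) * (1 - 0)) / ((x - a) * (x - a)) + E
        = - (E * (a * (1 - a)) / (x * (x - a)\<^sup>2))"
      using x by (simp add: divide_simps power2_eq_square) (simp add: algebra_simps)
    moreover have "x powr (p - 1) * exp (1 * x) = E" by (simp add: E_def a)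
    ultimately show ?thesis unfolding E_def[symmetric] by (simp only:)
  qed
  have "h 1 \<le> h w"
  proof (rule DERIV_nonpos_imp_nonincreasing[where f=h])
    fix x assume "w \<le> x" "x \<le> 1"
    then have "a < x" "0 < x" using a by auto
    then have "- (exp x * x powr (1 - a) * (a * (1 - a)) / (x * (x - a)\<^sup>2)) \<le> 0" using a by simp
    with D[OF \<open>a < x\<close>] show "\<exists>y. (h has_real_derivative y) (at x) \<and> y \<le> 0" by blast
  qed (use assms in auto)
  moreover have "h 1 = powg 1 p 1" by (simp add: h_def)
  moreover have "Gamma p \<le> powg 1 p 1" using Gamma_le_1[of p] powg_1_ge_1[of p] assms by linarith
  ultimately have "Gamma p \<le> h w" by simp
  then show ?thesis by (simp add: h_def a_def)
qed


text \<open>This is where the threshold enters: with \<open>w = - r\<close>, the condition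
  \<open>2 - p \<le> \<xi>\<close> becomes \<open>w \<le> 1\<close> and \<open>\<xi> < 1\<close>
  becomes \<open>w > 2 - p\<close>, the range of \<open>Gamma_excess_le\<close>.\<close>

lemma slope_gap_le_neg:
  assumes p: "1 < p" "p < 2" and xi: "2 - p \<le> \<xi>" "\<xi> < 1" and r: "r = - ((2 - p) / \<xi>)"
  shows "(1 - \<xi>) * (tangent_slope p r - spow p r) \<le> (p - 1) * \<bar>r\<bar> powr (p - 2)"
proof -
  define a where "a = 2 - p"
  define w where "w = a / \<xi>"
  have pos: "\<xi> > 0" "a > 0" using p xi by (auto simp: a_def)
  have w: "a < w" "w \<le> 1" "w > 0" "r = - w" "\<xi> = a / w"
  proof -
    have "a * \<xi> < a * 1" using pos xi by (intro mult_strict_left_mono) auto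
    then show "a < w" using pos by (simp add: w_def field_simps)
  qed (use pos xi r in \<open>auto simp: w_def a_def\<close>)
  have "Gamma p - powg 1 p w \<le> exp w * w powr (p - 1) * (1 - w) / (w - a)"
    using Gamma_excess_le[of p w] w p by (auto simp: a_def)
  then have "exp (- w) * (Gamma p - powg 1 p w) \<le> exp (- w) * (exp w * w powr (p - 1) * (1 - w) / (w - a))"
    by (rule mult_left_mono) simp
  also have "\<dots> = w powr (p - 1) * (1 - w) / (w - a)"
    by (simp add: exp_minus)
  finally have 1: "tangent_slope p r - spow p r \<le> w powr (p - 1) * (1 - w) / (w - a) + w powr (p - 1)"
    using w by (simp add: tangent_slope_def powg_neg spow_neg)
  have "w powr (p - 1) * (1 - w) / (w - a) + w powr (p - 1) = w powr (p - 1) * (1 - a) / (w - a)"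
    using w by (simp add: field_simps)
  with 1 have 1: "tangent_slope p r - spow p r \<le> w powr (p - 1) * (1 - a) / (w - a)" by simp
  have 2: "1 - \<xi> = (w - a) / w" using w by (simp add: field_simps)
  have "(1 - \<xi>) * (tangent_slope p r - spow p r) \<le> (w - a) / w * (w powr (p - 1) * (1 - a) / (w - a))"
    unfolding 2 using w by (intro mult_left_mono 1) auto
  also have "\<dots> = (1 - a) * (w powr (p - 1) / w)" using w by (simp add: field_simps)
  also have "w powr (p - 1) / w = w powr (p - 2)"
    using w powr_diff[of w "p - 1" 1] by simp
  finally show ?thesis using w by (simp add: a_def)
qed

text \<open>Left of the origin the inequality propagates, by comparison of solutions of a linear differential
  equation, from the single point of \<open>slope_gap_le_neg\<close>, the minimum of \<open>exp (- \<xi> r) |r|\<^bsup>p - 2\<^esup>\<close> there.\<close>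

lemma slope_gap_le:
  assumes p: "1 < p" "p \<le> 2" and xi: "2 - p \<le> \<xi>" "0 < \<xi>" "\<xi> < 1" and r: "r \<noteq> 0"
  shows "(1 - \<xi>) * (tangent_slope p r - spow p r) \<le> (p - 1) * \<bar>r\<bar> powr (p - 2)"
proof (cases "r > 0")
  case True
  have "exp r * (Gamma p - powg (-1) p r) \<le> exp r * (exp (- r) * (r powr (p - 1) + (p - 1) * r powr (p - 2)))"
    by (intro mult_left_mono Gamma_tail_le p True) simp
  also have "\<dots> = r powr (p - 1) + (p - 1) * r powr (p - 2)" by (simp add: exp_minus)
  finally have "tangent_slope p r - spow p r \<le> (p - 1) * \<bar>r\<bar> powr (p - 2)"
    using True by (simp add: tangent_slope_def powg_neg spow_pos)
  moreover have "(1 - \<xi>) * (tangent_slope p r - spow p r) \<le> (1 - \<xi>) * ((p - 1) * \<bar>r\<bar> powr (p - 2))"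
    using calculation xi by (intro mult_left_mono) auto
  moreover have "(1 - \<xi>) * ((p - 1) * \<bar>r\<bar> powr (p - 2)) \<le> 1 * ((p - 1) * \<bar>r\<bar> powr (p - 2))"
    using xi p by (intro mult_right_mono) auto
  ultimately show ?thesis by simp
next
  case False
  then have neg: "r < 0" using r by simp
  show ?thesis
  proof (cases "p = 2")
    case True
    \<comment> \<open>For \<open>p = 2\<close> the critical point degenerates to 0, so the slope is
      computed: \<open>tangent_slope 2 r = 1 + r\<close>, and the gap to \<open>spow\<close> is the
      constant 1.\<close>
    have "powg 1 2 w = (w - 1) * exp w + 1" if "w > 0" for w
    proof -
      have "((\<lambda>x::real. x powr (2 - 1) * exp (1 * x)) has_integral ((w - 1) * exp w - (0 - 1) * exp 0)) {0..w}"
      by (rule fundamental_theorem_of_calculus)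
        (use that in \<open>auto intro!: derivative_eq_intros simp: algebra_simps simp flip: has_real_derivative_iff_has_vector_derivative\<close>)
      then show ?thesis unfolding powg_def by (simp add: integral_unique)
    qed
    then have "powg 1 2 (- r) = (- r - 1) * exp (- r) + 1" using neg by simp
    moreover have "Gamma (2::real) = 1" using Gamma_fact[of 1, where 'a=real] by simp
    ultimately have "tangent_slope p r = 1 + r"
      using True neg by (simp add: tangent_slope_def powg_neg exp_minus field_simps)
    then show ?thesis using True neg xi by (simp add: spow_neg)
  next
    case False
    then have p2: "p < 2" using p by simp
    define a where "a = 2 - p"
    define r0 where "r0 = - (a / \<xi>)"
    have a: "a > 0" "r0 < 0" using p2 xi by (auto simp: a_def r0_def)
    define q where "q = (\<lambda>x. (p - 1) * (exp (- (\<xi> * x)) * (- x) powr (- a)))"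
    define T where "T = (\<lambda>x. exp (- (\<xi> * x)) * (tangent_slope p x - spow p x))"
    have dT: "(T has_real_derivative (1 - \<xi>) * T x - q x) (at x)" if "x < 0" for x
      unfolding T_def q_def using that p
      by (auto intro!: derivative_eq_intros DERIV_tangent_slope DERIV_spow simp: a_def) (simp add: algebra_simps)
    have dq: "(q has_real_derivative (p - 1) * (exp (- (\<xi> * x)) * (- x) powr (- a)) * (a / (- x) - \<xi>)) (at x)" if "x < 0" for x
      unfolding q_def using that
      by (auto intro!: derivative_eq_intros) (simp add: algebra_simps powr_diff)
    have q_mono: "q x \<le> q y" if "r0 \<le> x" "x \<le> y" "y < 0" for x y
    proof (rule DERIV_nonneg_imp_nondecreasing[OF that(2)])
      fix z assume z: "x \<le> z" "z \<le> y"
      then have "r0 \<le> z" "z < 0" using that by auto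
      then have "a / (- z) - \<xi> \<ge> 0" using xi a by (simp add: r0_def field_simps)
      then show "\<exists>D. DERIV q z :> D \<and> D \<ge> 0"
        using dq[of z] z that p by (intro exI conjI, force) auto
    qed
    have q_anti: "q y \<le> q x" if "x \<le> y" "y \<le> r0" for x y
    proof (rule DERIV_nonpos_imp_nonincreasing[OF that(1)])
      fix z assume z: "x \<le> z" "z \<le> y"
      then have "z \<le> r0" "z < 0" using that a by auto
      then have "a / (- z) - \<xi> \<le> 0" using xi a by (simp add: r0_def field_simps)
      then show "\<exists>D. DERIV q z :> D \<and> D \<le> 0"
        using dq[of z] z that p a by (intro exI conjI, force) (auto simp: mult_le_0_iff)
    qed
    have base: "(1 - \<xi>) * T r0 \<le> q r0"
    proof -
      have "(1 - \<xi>) * (tangent_slope p r0 - spow p r0) \<le> (p - 1) * \<bar>r0\<bar> powr (p - 2)"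
        by (rule slope_gap_le_neg) (use p2 p xi in \<open>auto simp: r0_def a_def\<close>)
      then have "exp (- (\<xi> * r0)) * ((1 - \<xi>) * (tangent_slope p r0 - spow p r0)) \<le> exp (- (\<xi> * r0)) * ((p - 1) * \<bar>r0\<bar> powr (p - 2))"
        by (rule mult_left_mono) simp
      then show ?thesis using a by (simp add: T_def q_def a_def mult_ac)
    qed
    have main: "(1 - \<xi>) * T r \<le> q r"
    proof -
      \<comment> \<open>Between \<open>r\<close> and \<open>r0\<close> the value \<open>q0\<close>
        is the minimum of \<open>q\<close> if \<open>r0 \<le> r\<close> and the maximum otherwise.
        Freezing the inhomogeneity at \<open>q0\<close> gives \<open>U\<close> the monotonicity that
        yields \<open>U r \<le> U r0 \<le> 0\<close>, and in both cases
        \<open>q0 \<le> q r\<close>.\<close>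
      define q0 where "q0 = (if r0 \<le> r then q r0 else q r)"
      define U where "U = (\<lambda>x. ((1 - \<xi>) * T x - q0) * exp (- ((1 - \<xi>) * x)))"
      have dU: "(U has_real_derivative (1 - \<xi>) * (q0 - q x) * exp (- ((1 - \<xi>) * x))) (at x)" if "x < 0" for x
        unfolding U_def using that
        by (auto intro!: derivative_eq_intros dT) (simp add: algebra_simps)
      have base0: "(1 - \<xi>) * T r0 \<le> q0" using base q_anti[of r r0] by (auto simp: q0_def)
      have "U r \<le> 0"
      proof (cases "r0 \<le> r")
        case True
        have "U r \<le> U r0"
        proof (rule DERIV_nonpos_imp_nonincreasing[where f=U, OF True])
          fix z assume z: "r0 \<le> z" "z \<le> r"
          then have "q0 \<le> q z" using True neg q_mono[of r0 z] by (auto simp: q0_def)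
          then show "\<exists>D. DERIV U z :> D \<and> D \<le> 0"
            using dU[of z] z neg xi by (intro exI conjI, force) (auto simp: mult_le_0_iff)
        qed
        also have "U r0 \<le> 0" using base0 by (simp add: U_def mult_le_0_iff)
        finally show ?thesis .
      next
        case False
        have "U r \<le> U r0"
        proof (rule DERIV_nonneg_imp_nondecreasing[where f=U and a=r and b=r0])
          show "r \<le> r0" using False by simp
          fix z assume z: "r \<le> z" "z \<le> r0"
          then have "q z \<le> q0" using False q_anti[of r z] by (auto simp: q0_def)
          then show "\<exists>D. DERIV U z :> D \<and> D \<ge> 0"
            using dU[of z] z a xi by (intro exI conjI, force) auto
        qed
        also have "U r0 \<le> 0" using base0 by (simp add: U_def mult_le_0_iff)
        finally show ?thesis .
      qed
      then have "(1 - \<xi>) * T r \<le> q0" by (simp add: U_def mult_le_0_iff)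
      also have "q0 \<le> q r" using q_mono[of r0 r] neg by (auto simp: q0_def)
      finally show ?thesis .
    qed
    have "exp (- (\<xi> * r)) * ((1 - \<xi>) * (tangent_slope p r - spow p r)) \<le> exp (- (\<xi> * r)) * ((p - 1) * \<bar>r\<bar> powr (p - 2))"
      using main neg by (simp add: T_def q_def a_def mult_ac)
    then show ?thesis by (simp add: mult_le_cancel_left_pos)
  qed
qed


text \<open>The first coordinate is scaled by \<open>\<xi>\<close>: \<open>(z, y)\<close> stands for \<open>z = \<langle>\<phi>\<rangle> / \<xi>\<close> and \<open>y = \<langle>exp \<phi>\<rangle>\<close>. The tangent with
  parameter \<open>r\<close> meets the lower boundary at \<open>z = r\<close> and touches the upper boundary at \<open>z = r + 1\<close>.\<close>

definition upper_dual :: "real \<Rightarrow> real \<Rightarrow> real \<Rightarrow> real" where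
  "upper_dual p \<xi> r = (1 - \<xi>) / \<xi>\<^sup>2 * (exp (- (\<xi> * r)) * (tangent_slope p r - spow p r))"

definition tangent_line :: "real \<Rightarrow> real \<Rightarrow> real \<Rightarrow> real" where
  "tangent_line \<xi> r z = exp (\<xi> * r) * (1 + \<xi> * (z - r) / (1 - \<xi>))"

definition support_plane :: "real \<Rightarrow> real \<Rightarrow> real \<Rightarrow> real \<Rightarrow> real \<Rightarrow> real" where
  "support_plane p \<xi> r z y =
     \<bar>r\<bar> powr p + p * tangent_slope p r * (z - r) + p * upper_dual p \<xi> r * (y - tangent_line \<xi> r z)"

context
  fixes p \<xi> :: real
  assumes p: "1 < p" "p \<le> 2" and xi: "2 - p \<le> \<xi>" "0 < \<xi>" "\<xi> < 1"
begin

lemma continuous_on_upper_dual: "continuous_on S (upper_dual p \<xi>)"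
  unfolding upper_dual_def[abs_def]
  by (intro continuous_intros continuous_on_tangent_slope continuous_on_spow p)

lemma continuous_on_tangent_line: "continuous_on S (\<lambda>r. tangent_line \<xi> r z)"
  unfolding tangent_line_def[abs_def] using xi by (intro continuous_intros) auto

lemma continuous_on_support_plane: "continuous_on S (\<lambda>r. support_plane p \<xi> r z y)"
  unfolding support_plane_def[abs_def] using p
  by (intro continuous_intros continuous_on_upper_dual continuous_on_tangent_line continuous_on_tangent_slope continuous_on_powr') auto

lemma DERIV_upper_dual:
  assumes "r \<noteq> 0"
  obtains D where "(upper_dual p \<xi> has_real_derivative D) (at r)" "D \<le> 0"
proof
  show "(upper_dual p \<xi> has_real_derivative
      (1 - \<xi>) / \<xi>\<^sup>2 * (exp (- (\<xi> * r)) * ((1 - \<xi>) * (tangent_slope p r - spow p r) - (p - 1) * \<bar>r\<bar> powr (p - 2)))) (at r)"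
    unfolding upper_dual_def[abs_def] using assms p
    by (intro DERIV_cmult) (auto intro!: derivative_eq_intros DERIV_tangent_slope DERIV_spow simp: algebra_simps)
  show "(1 - \<xi>) / \<xi>\<^sup>2 * (exp (- (\<xi> * r)) * ((1 - \<xi>) * (tangent_slope p r - spow p r) - (p - 1) * \<bar>r\<bar> powr (p - 2))) \<le> 0"
    using slope_gap_le[OF p xi assms] xi by (intro mult_nonneg_nonpos) auto
qed

lemma upper_dual_antimono: "r \<le> s \<Longrightarrow> upper_dual p \<xi> s \<le> upper_dual p \<xi> r"
  by (rule nonincreasing_if_DERIV_nonpos_off_zero[OF _ continuous_on_upper_dual])
     (use DERIV_upper_dual in blast)+

lemma DERIV_tangent_line:
  "((\<lambda>r. tangent_line \<xi> r z) has_real_derivative exp (\<xi> * r) * (\<xi>\<^sup>2 / (1 - \<xi>)) * (z - r - 1)) (at r)"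
proof -
  have "((\<lambda>r. tangent_line \<xi> r z) has_real_derivative
      exp (\<xi> * r) * \<xi> * (1 + \<xi> * (z - r) / (1 - \<xi>)) + exp (\<xi> * r) * (- (\<xi> / (1 - \<xi>)))) (at r)"
    unfolding tangent_line_def using xi by (auto intro!: derivative_eq_intros)
  moreover have "\<xi> * (1 + \<xi> * (z - r) / (1 - \<xi>)) + - (\<xi> / (1 - \<xi>)) = \<xi>\<^sup>2 / (1 - \<xi>) * (z - r - 1)"
    using xi by (simp add: divide_simps power2_eq_square) (simp add: algebra_simps)
  then have "exp (\<xi> * r) * \<xi> * (1 + \<xi> * (z - r) / (1 - \<xi>)) + exp (\<xi> * r) * (- (\<xi> / (1 - \<xi>)))
      = exp (\<xi> * r) * (\<xi>\<^sup>2 / (1 - \<xi>)) * (z - r - 1)"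
    by (simp only: mult.assoc flip: distrib_left)
  ultimately show ?thesis by (simp only:)
qed

text \<open>The envelope property: moving the point of tangency changes the plane only through \<open>upper_dual\<close>.\<close>

lemma DERIV_support_plane:
  assumes "r \<noteq> 0" and D: "(upper_dual p \<xi> has_real_derivative D) (at r)"
  shows "((\<lambda>r. support_plane p \<xi> r z y) has_real_derivative p * D * (y - tangent_line \<xi> r z)) (at r)"
proof -
  let ?m = "tangent_slope p r" and ?s = "spow p r"
  have "((\<lambda>r. support_plane p \<xi> r z y) has_real_derivative
      p * ?s + (p * (?m - ?s) * (z - r) - p * ?m)
      + (p * D * (y - tangent_line \<xi> r z) - p * upper_dual p \<xi> r * (exp (\<xi> * r) * (\<xi>\<^sup>2 / (1 - \<xi>)) * (z - r - 1)))) (at r)"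
    unfolding support_plane_def using assms p
    by (intro DERIV_add DERIV_abs_powr) (auto intro!: derivative_eq_intros DERIV_tangent_slope DERIV_tangent_line D simp: algebra_simps)
  \<comment> \<open>The factor \<open>(1 - \<xi>) / \<xi>\<^sup>2 * exp (- (\<xi> * r))\<close> in
    \<open>upper_dual\<close> is the reciprocal of the one in the derivative of
    \<open>tangent_line\<close>. With this normalization all terms without \<open>D\<close>
    cancel.\<close>
  moreover have "upper_dual p \<xi> r * (exp (\<xi> * r) * (\<xi>\<^sup>2 / (1 - \<xi>)) * (z - r - 1)) = (?m - ?s) * (z - r - 1)"
    using xi by (simp add: upper_dual_def exp_minus field_simps)
  then have A: "p * upper_dual p \<xi> r * (exp (\<xi> * r) * (\<xi>\<^sup>2 / (1 - \<xi>)) * (z - r - 1)) = p * ((?m - ?s) * (z - r - 1))"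
    by (simp only: mult.assoc)
  have "p * ?s + (p * (?m - ?s) * (z - r) - p * ?m)
      + (p * D * (y - tangent_line \<xi> r z) - p * upper_dual p \<xi> r * (exp (\<xi> * r) * (\<xi>\<^sup>2 / (1 - \<xi>)) * (z - r - 1)))
      = p * D * (y - tangent_line \<xi> r z)"
    unfolding A by (simp add: algebra_simps)
  ultimately show ?thesis by (simp only:)
qed

text \<open>The lines are tangents of a convex curve, so their height at a fixed \<open>z\<close>
  falls as the point of tangency moves away from \<open>z\<close>; \<open>z - 1 \<le> r\<close> puts
  that point, \<open>r + 1\<close>, to the right of \<open>z\<close>.\<close>

lemma tangent_line_antimono:
  assumes "z - 1 \<le> r" "r \<le> s" shows "tangent_line \<xi> s z \<le> tangent_line \<xi> r z"
  using assms(2)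
proof (rule DERIV_nonpos_imp_nonincreasing)
  fix x assume "r \<le> x" "x \<le> s"
  then show "\<exists>D. ((\<lambda>r. tangent_line \<xi> r z) has_real_derivative D) (at x) \<and> D \<le> 0"
    using assms xi by (intro exI[where x="exp (\<xi> * x) * (\<xi>\<^sup>2 / (1 - \<xi>)) * (z - x - 1)"] conjI DERIV_tangent_line mult_nonneg_nonpos) auto
qed

text \<open>At \<open>r = z\<close> the plane takes the value \<open>\<bar>z\<bar> powr p\<close> at
  the lower boundary point. By the envelope property, moving \<open>r\<close> away from
  \<open>z\<close> to either side lowers the plane there, as long as \<open>r \<ge> z - 1\<close>
  keeps the tangents ordered.\<close>

lemma support_plane_le_diagonal:
  assumes "z \<le> r + 1"
  shows "support_plane p \<xi> r z (exp (\<xi> * z)) \<le> \<bar>z\<bar> powr p"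
proof -
  have l: "tangent_line \<xi> z z = exp (\<xi> * z)" by (simp add: tangent_line_def)
  have "support_plane p \<xi> r z (exp (\<xi> * z)) \<le> support_plane p \<xi> z z (exp (\<xi> * z))"
  proof (cases "r \<le> z")
    case True
    show ?thesis
    proof (rule nondecreasing_if_DERIV_nonneg_off_zero[OF True continuous_on_support_plane])
      fix x assume x: "r < x" "x < z" "x \<noteq> 0"
      obtain D where D: "(upper_dual p \<xi> has_real_derivative D) (at x)" "D \<le> 0"
        using DERIV_upper_dual[OF x(3)] .
      have "tangent_line \<xi> z z \<le> tangent_line \<xi> x z"
        by (rule tangent_line_antimono) (use x assms in auto)
      then have "0 \<le> p * D * (exp (\<xi> * z) - tangent_line \<xi> x z)"
        using D p by (intro mult_nonpos_nonpos) (auto simp: l mult_le_0_iff)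
      then show "\<exists>D. ((\<lambda>r. support_plane p \<xi> r z (exp (\<xi> * z))) has_real_derivative D) (at x) \<and> 0 \<le> D"
        using DERIV_support_plane[OF x(3) D(1)] by blast
    qed
  next
    case False
    show ?thesis
    proof (rule nonincreasing_if_DERIV_nonpos_off_zero[OF _ continuous_on_support_plane])
      show "z \<le> r" using False by simp
      fix x assume x: "z < x" "x < r" "x \<noteq> 0"
      obtain D where D: "(upper_dual p \<xi> has_real_derivative D) (at x)" "D \<le> 0"
        using DERIV_upper_dual[OF x(3)] .
      have "tangent_line \<xi> x z \<le> tangent_line \<xi> z z"
        by (rule tangent_line_antimono) (use x assms in auto)
      then have "p * D * (exp (\<xi> * z) - tangent_line \<xi> x z) \<le> 0"
        using mult_nonneg_nonpos[of p D] D p by (intro mult_nonpos_nonneg[of "p * D"]) (auto simp: l)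
      then show "\<exists>D. ((\<lambda>r. support_plane p \<xi> r z (exp (\<xi> * z))) has_real_derivative D) (at x) \<and> D \<le> 0"
        using DERIV_support_plane[OF x(3) D(1)] by blast
    qed
  qed
  also have "\<dots> = \<bar>z\<bar> powr p" by (simp add: support_plane_def l)
  finally show ?thesis .
qed

text \<open>Below the tangent with parameter \<open>s\<close> the envelope property makes the planes
  increase in \<open>r\<close> up to \<open>s\<close>. A point that exceeds this tangent by at most
  \<open>\<kappa>\<close> is handled by subtracting
  \<open>p * \<kappa> * upper_dual p \<xi> r\<close>, which restores the sign of the
  derivative.\<close>

lemma support_plane_shift_le:
  assumes rs: "z - 1 \<le> r" "r \<le> s" and y: "y \<le> tangent_line \<xi> s z + \<kappa>"
  shows "support_plane p \<xi> r z y \<le> support_plane p \<xi> s z y + p * \<kappa> * (upper_dual p \<xi> r - upper_dual p \<xi> s)"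
proof -
  have "support_plane p \<xi> r z y - p * \<kappa> * upper_dual p \<xi> r \<le> support_plane p \<xi> s z y - p * \<kappa> * upper_dual p \<xi> s"
  proof (rule nondecreasing_if_DERIV_nonneg_off_zero[OF rs(2)])
    show "continuous_on {r..s} (\<lambda>r. support_plane p \<xi> r z y - p * \<kappa> * upper_dual p \<xi> r)"
      by (intro continuous_intros continuous_on_support_plane continuous_on_upper_dual)
    fix x assume x: "r < x" "x < s" "x \<noteq> 0"
    obtain D where D: "(upper_dual p \<xi> has_real_derivative D) (at x)" "D \<le> 0"
      using DERIV_upper_dual[OF x(3)] .
    have "tangent_line \<xi> s z \<le> tangent_line \<xi> x z"
      by (rule tangent_line_antimono) (use x rs in auto)
    then have "0 \<le> p * D * (y - tangent_line \<xi> x z - \<kappa>)"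
      using D p y by (intro mult_nonpos_nonpos) (auto simp: mult_le_0_iff)
    moreover have "((\<lambda>r. support_plane p \<xi> r z y - p * \<kappa> * upper_dual p \<xi> r) has_real_derivative p * D * (y - tangent_line \<xi> x z) - p * \<kappa> * D) (at x)"
      by (intro DERIV_diff DERIV_support_plane x D DERIV_cmult)
    ultimately show "\<exists>D. ((\<lambda>r. support_plane p \<xi> r z y - p * \<kappa> * upper_dual p \<xi> r) has_real_derivative D) (at x) \<and> 0 \<le> D"
      by (auto simp: algebra_simps intro!: exI)
  qed
  then show ?thesis by (simp add: algebra_simps)
qed

text \<open>Here \<open>z = r + 1\<close> is the point of tangency of the first line, so the
  derivative of the height in the parameter vanishes at \<open>r\<close> and the loss is of second
  order.\<close>

lemma tangent_line_gap_le:
  assumes "r = z - 1" "r \<le> s" "s \<le> R"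
  shows "tangent_line \<xi> r z \<le> tangent_line \<xi> s z + exp (\<xi> * R) * (\<xi>\<^sup>2 / (1 - \<xi>)) * (s - r)\<^sup>2"
proof -
  let ?c = "exp (\<xi> * R) * (\<xi>\<^sup>2 / (1 - \<xi>))"
  have "tangent_line \<xi> r z + ?c * (r - r)\<^sup>2 \<le> tangent_line \<xi> s z + ?c * (s - r)\<^sup>2"
    using assms(2)
  proof (rule DERIV_nonneg_imp_nondecreasing)
    fix x assume x: "r \<le> x" "x \<le> s"
    have aux: "A \<le> B \<Longrightarrow> 0 \<le> B \<Longrightarrow> X = - A \<Longrightarrow> Y = 2 * B \<Longrightarrow> 0 \<le> X + Y" for A B X Y :: real
      by linarith
    have der: "((\<lambda>x. tangent_line \<xi> x z + ?c * (x - r)\<^sup>2) has_real_derivative exp (\<xi> * x) * (\<xi>\<^sup>2 / (1 - \<xi>)) * (z - x - 1) + ?c * (2 * (x - r))) (at x)"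
      by (rule derivative_eq_intros DERIV_tangent_line refl | simp)+
    have "exp (\<xi> * x) * (\<xi>\<^sup>2 / (1 - \<xi>)) * (x - r) \<le> ?c * (x - r)"
      using x xi assms by (intro mult_right_mono) auto
    moreover have "?c * (x - r) \<ge> 0" using x xi by auto
    moreover have "exp (\<xi> * x) * (\<xi>\<^sup>2 / (1 - \<xi>)) * (z - x - 1) = - (exp (\<xi> * x) * (\<xi>\<^sup>2 / (1 - \<xi>)) * (x - r))"
      unfolding assms(1) mult_minus_right[symmetric] by simp
    moreover have "?c * (2 * (x - r)) = 2 * (?c * (x - r))" by simp
    ultimately have "0 \<le> exp (\<xi> * x) * (\<xi>\<^sup>2 / (1 - \<xi>)) * (z - x - 1) + ?c * (2 * (x - r))"
      by (rule aux)
    with der show "\<exists>D. ((\<lambda>x. tangent_line \<xi> x z + ?c * (x - r)\<^sup>2) has_real_derivative D) (at x) \<and> 0 \<le> D"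
      by blast
  qed
  then show ?thesis by simp
qed

end


text \<open>A drop of at most \<open>M * (s - r)\<^sup>2\<close> on every subinterval is no drop at
  all: cutting \<open>{a..b}\<close> into \<open>Suc n\<close> equal pieces leaves a total drop of
  order \<open>1 / Suc n\<close>.\<close>

lemma nonincreasing_if_quadratic_increments:
  fixes K :: "real \<Rightarrow> real"
  assumes ab: "a \<le> b" and K: "\<And>r s. a \<le> r \<Longrightarrow> r \<le> s \<Longrightarrow> s \<le> b \<Longrightarrow> K r - K s \<le> M * (s - r)\<^sup>2"
  shows "K a \<le> K b"
proof -
  have "K a - K b \<le> \<bar>M\<bar> * (b - a)\<^sup>2 * inverse (real (Suc n))" for n
  proof -
    define N where "N = real (Suc n)"
    have N: "N > 0" by (simp add: N_def)
    define t where "t = (\<lambda>i::nat. a + (b - a) * i / N)"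
    have "K (t i) - K (t (Suc i)) \<le> \<bar>M\<bar> * ((b - a) / N)\<^sup>2" if "i \<le> n" for i
    proof -
      have "real i \<le> N" "real (Suc i) \<le> N" using that by (auto simp: N_def)
      then have "(b - a) * i \<le> (b - a) * N" "(b - a) * Suc i \<le> (b - a) * N" using ab by (auto intro!: mult_left_mono simp del: of_nat_Suc)
      then have "t (Suc i) \<le> a + (b - a) * N / N"
        using N unfolding t_def by (intro add_left_mono divide_right_mono) auto
      then have "t (Suc i) \<le> b" using N by simp
      moreover have "a \<le> t i" using ab N by (simp add: t_def)
      moreover have d: "t (Suc i) - t i = (b - a) / N" by (simp add: t_def algebra_simps diff_divide_distrib add_divide_distrib)
      moreover have "(b - a) / N \<ge> 0" using ab N by simp
      ultimately have "K (t i) - K (t (Suc i)) \<le> M * ((b - a) / N)\<^sup>2"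
        using K[of "t i" "t (Suc i)"] by simp
      also have "\<dots> \<le> \<bar>M\<bar> * ((b - a) / N)\<^sup>2" by (intro mult_right_mono) auto
      finally show ?thesis .
    qed
    then have "(\<Sum>i\<le>n. K (t i) - K (t (Suc i))) \<le> (\<Sum>i\<le>n. \<bar>M\<bar> * ((b - a) / N)\<^sup>2)"
      by (intro sum_mono) auto
    moreover have "(\<Sum>i\<le>n. K (t i) - K (t (Suc i))) = K (t 0) - K (t (Suc n))"
      by (rule sum_telescope)
    moreover have "t 0 = a" "t (Suc n) = b" using N by (auto simp: t_def N_def)
    moreover have "(\<Sum>i\<le>n. \<bar>M\<bar> * ((b - a) / N)\<^sup>2) = \<bar>M\<bar> * (b - a)\<^sup>2 * inverse N"
    proof -
      have "(\<Sum>i\<le>n. \<bar>M\<bar> * ((b - a) / N)\<^sup>2) = N * (\<bar>M\<bar> * ((b - a) / N)\<^sup>2)" by (simp add: N_def)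
      also have "\<dots> = \<bar>M\<bar> * (b - a)\<^sup>2 * inverse N"
        using N by (simp add: power_divide power2_eq_square divide_inverse)
      finally show ?thesis .
    qed
    ultimately have "K a - K b \<le> \<bar>M\<bar> * (b - a)\<^sup>2 * inverse N" by (simp only:)
    then show ?thesis unfolding N_def .
  qed
  moreover have "(\<lambda>n. \<bar>M\<bar> * (b - a)\<^sup>2 * inverse (real (Suc n))) \<longlonglongrightarrow> \<bar>M\<bar> * (b - a)\<^sup>2 * 0"
    by (intro tendsto_intros LIMSEQ_inverse_real_of_nat)
  ultimately have "K a - K b \<le> \<bar>M\<bar> * (b - a)\<^sup>2 * 0"
    by (intro LIMSEQ_le_const) auto
  then show ?thesis by simp
qed

section \<open>Lower bounds for monotone functions\<close>

lemma integrable_comp_mono: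
  fixes I h :: "real \<Rightarrow> real"
  assumes "mono I" and bd: "\<And>x. \<bar>I x\<bar> \<le> M" and h: "continuous_on UNIV h"
  shows "(\<lambda>x. h (I x)) integrable_on {a..b}"
proof -
  have "compact (h ` {-M..M})"
    by (intro compact_continuous_image continuous_on_subset[OF h]) auto
  then obtain B where B: "\<And>y. y \<in> {-M..M} \<Longrightarrow> \<bar>h y\<bar> \<le> B"
    by (metis bounded_iff compact_imp_bounded image_eqI real_norm_def)
  have [measurable]: "I \<in> borel_measurable borel" "h \<in> borel_measurable borel"
    using assms by (auto intro: borel_measurable_mono borel_measurable_continuous_onI)
  have "(\<lambda>x. h (I x)) absolutely_integrable_on {a..b}"
  proof (rule measurable_bounded_by_integrable_imp_absolutely_integrable[where g="\<lambda>_. B"])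
    have "(\<lambda>x. h (I x)) \<in> borel_measurable lebesgue" 
      by (intro measurable_completion) simp
    then show "(\<lambda>x. h (I x)) \<in> borel_measurable (lebesgue_on {a..b})"
      by (simp add: measurable_restrict_space1)
    show "norm (h (I x)) \<le> B" for x
      using B[of "I x"] bd[of x] by (auto simp: abs_le_iff)
  qed auto
  then show ?thesis by (rule set_lebesgue_integral_eq_integral(1))
qed

section \<open>Bounds for a monotone profile with controlled end averages\<close>

context
  fixes I :: "real \<Rightarrow> real" and M :: real
  assumes mono: "mono I" and bd: "\<And>x. \<bar>I x\<bar> \<le> M"
begin

lemma bound_nonneg: "M \<ge> 0" using bd[of 0] by linarith

lemma comp_profile_integrable: "continuous_on UNIV h \<Longrightarrow> (\<lambda>x. h (I x)) integrable_on {a..b::real}" for h :: "real \<Rightarrow> real"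
  by (rule integrable_comp_mono[OF mono bd])

lemma profile_integrable: "I integrable_on {a..b}"
  using comp_profile_integrable[of "\<lambda>x. x"] by simp

definition top_avg :: "real \<Rightarrow> real" where "top_avg s = integral {s..1} I / (1 - s)"

lemma top_avg_ge: "s < 1 \<Longrightarrow> x \<le> s \<Longrightarrow> I x \<le> top_avg s"
proof -
  assume s: "s < 1" "x \<le> s"
  have "integral {s..1} (\<lambda>_. I x) \<le> integral {s..1} I"
    by (intro integral_le profile_integrable) (use s monoD[OF mono] in auto)
  then show ?thesis using s by (simp add: top_avg_def field_simps)
qed

lemma top_avg_le: "s < 1 \<Longrightarrow> top_avg s \<le> M"
proof -
  assume s: "s < 1"
  have "integral {s..1} I \<le> integral {s..1} (\<lambda>_. M)"
    by (intro integral_le profile_integrable) (use bd in \<open>auto simp: abs_le_iff\<close>)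
  then show ?thesis using s by (simp add: top_avg_def field_simps)
qed

lemma top_avg_ge_M: "s < 1 \<Longrightarrow> - M \<le> top_avg s"
  using top_avg_ge[of s s] bd[of s] by auto

lemma top_avg_increment:
  assumes "r \<le> s" "s < 1"
  shows "(1 - s) * (top_avg s - top_avg r) = (s - r) * top_avg r - integral {r..s} I"
proof -
  have "integral {r..s} I + integral {s..1} I = integral {r..1} I"
    using assms by (intro Henstock_Kurzweil_Integration.integral_combine profile_integrable) auto
  moreover have "(1 - s) * top_avg s = integral {s..1} I" "(1 - r) * top_avg r = integral {r..1} I"
    using assms by (auto simp: top_avg_def)
  moreover have "(1 - s) * (top_avg s - top_avg r) = (1 - s) * top_avg s - (1 - r) * top_avg r + (s - r) * top_avg r"
    by (simp add: algebra_simps)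
  ultimately show ?thesis by simp
qed

lemma top_avg_mono:
  assumes "r \<le> s" "s < 1" shows "top_avg r \<le> top_avg s"
proof -
  have "integral {r..s} I \<le> integral {r..s} (\<lambda>_. I s)"
    by (intro integral_le profile_integrable) (use assms monoD[OF mono] in auto)
  then have 1: "integral {r..s} I \<le> (s - r) * I s" using assms by simp
  have "(s - r) * I s \<le> (s - r) * top_avg s" using top_avg_ge[of s s] assms by (intro mult_left_mono) auto
  then have "integral {r..s} I \<le> (s - r) * top_avg s" using 1 by simp
  then have "(1 - r) * top_avg r \<le> (1 - r) * top_avg s"
    using top_avg_increment[OF assms] by (simp add: algebra_simps)
  then show ?thesis using assms by (simp add: mult_le_cancel_left)
qed

lemma top_avg_lipschitz:
  assumes "r \<le> s" "s \<le> 1 - \<delta>" "\<delta> > 0" shows "top_avg s - top_avg r \<le> 2 * M / \<delta> * (s - r)"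
proof -
  have "integral {r..s} (\<lambda>_. - M) \<le> integral {r..s} I"
    by (intro integral_le profile_integrable) (use bd in \<open>auto simp: abs_le_iff minus_le_iff\<close>)
  then have "- integral {r..s} I \<le> (s - r) * M" using assms by simp
  moreover have "(s - r) * top_avg r \<le> (s - r) * M" using top_avg_le[of r] assms by (intro mult_left_mono) auto
  ultimately have "(1 - s) * (top_avg s - top_avg r) \<le> 2 * M * (s - r)"
    using top_avg_increment[of r s] assms by (simp add: algebra_simps)
  moreover have "\<delta> * (top_avg s - top_avg r) \<le> (1 - s) * (top_avg s - top_avg r)"
    using assms top_avg_mono[of r s] by (intro mult_right_mono) auto
  ultimately show ?thesis using assms by (simp add: field_simps)
qed

text \<open>\<open>K s\<close> compares the plane tangent over the average on \<open>{s..1}\<close>,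
  integrated over that interval, with the moment of order \<open>p\<close> there. It increases up to
  second-order errors and is at most a small multiple of \<open>1 - s\<close> near 1, so
  \<open>K 0 \<le> 0\<close>; as the total mean is 0, \<open>v 0 = -1\<close> and this is the claim.
  Finite increments replace derivatives because a monotone \<open>I\<close> may jump.\<close>

lemma power_mean_bound:
  assumes p: "1 < p" "p \<le> 2" and xi: "2 - p \<le> \<xi>" "0 < \<xi>" "\<xi> < 1"
    and top: "\<And>s. 0 \<le> s \<Longrightarrow> s < 1 \<Longrightarrow>
      integral {s..1} (\<lambda>x. exp (\<xi> * I x)) / (1 - s) \<le> exp (- \<xi>) / (1 - \<xi>) * exp (\<xi> * top_avg s)"
    and zero: "integral {0..1} I = 0"
  shows "support_plane p \<xi> (-1) 0 (integral {0..1} (\<lambda>x. exp (\<xi> * I x))) \<le> integral {0..1} (\<lambda>x. \<bar>I x\<bar> powr p)"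
proof -
  let ?P = "support_plane p \<xi>"
  let ?d = "upper_dual p \<xi>"
  let ?l = "tangent_line \<xi>"
  define E where "E s = integral {s..1} (\<lambda>x. exp (\<xi> * I x)) / (1 - s)" for s
  define F where "F s = integral {s..1} (\<lambda>x. \<bar>I x\<bar> powr p)" for s
  define v where "v s = top_avg s - 1" for s
  define K where "K s = (1 - s) * ?P (v s) (top_avg s) (E s) - F s" for s
  have int_f: "(\<lambda>x. \<bar>I x\<bar> powr p) integrable_on {a..b}" for a b
    by (rule comp_profile_integrable[of "\<lambda>x. \<bar>x\<bar> powr p"]) (use p in \<open>auto intro!: continuous_intros continuous_on_powr'\<close>)
  have int_e: "(\<lambda>x. exp (\<xi> * I x)) integrable_on {a..b}" for a b
    by (rule comp_profile_integrable[of "\<lambda>x. exp (\<xi> * x)"]) (auto intro!: continuous_intros)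
  \<comment> \<open>For a fixed tangent the plane is affine in the point, so it commutes with
    averaging over \<open>{s..1}\<close>.\<close>
  have aff: "?P r z y = ?P r 0 0 + (?P r 1 0 - ?P r 0 0) * z
      + p * ?d r * y" for r z y
  proof -
    define d where "d = \<xi> / (1 - \<xi>)"
    have c: "\<xi> * x / (1 - \<xi>) = d * x" for x by (simp add: d_def)
    show ?thesis unfolding support_plane_def tangent_line_def c by (simp add: algebra_simps)
  qed
  have int_sp: "(\<lambda>x. ?P r (I x) (exp (\<xi> * I x))) integrable_on {a..b}" for r a b
    by (subst aff) (intro integrable_add integrable_on_mult_right integrable_const_ivl profile_integrable int_e)
  have sp_avg: "(1 - s) * ?P r (top_avg s) (E s) = integral {s..1} (\<lambda>x. ?P r (I x) (exp (\<xi> * I x)))"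
    if "s < 1" for r s
  proof -
    have "integral {s..1} (\<lambda>x. ?P r (I x) (exp (\<xi> * I x)))
      = integral {s..1} (\<lambda>x. ?P r 0 0) + integral {s..1} (\<lambda>x. (?P r 1 0 - ?P r 0 0) * I x)
         + integral {s..1} (\<lambda>x. p * ?d r * exp (\<xi> * I x))"
      by (subst aff) (simp add: integral_add integrable_add integrable_on_mult_right integrable_const_ivl profile_integrable int_e)
    also have "\<dots> = (1 - s) * ?P r 0 0 + (?P r 1 0 - ?P r 0 0) * ((1 - s) * top_avg s)
       + p * ?d r * ((1 - s) * E s)"
      using that by (simp add: integral_mult_right top_avg_def E_def)
    also have "\<dots> = (1 - s) * ?P r (top_avg s) (E s)"
      by (subst (3) aff) (simp add: algebra_simps)
    finally show ?thesis by simp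
  qed
  have tl: "?l (v s) (top_avg s) = exp (- \<xi>) / (1 - \<xi>) * exp (\<xi> * top_avg s)" for s
    using xi by (simp add: tangent_line_def v_def algebra_simps exp_diff exp_minus field_simps)
  define Os where "Os = ?d (- M - 1) - ?d (M - 1)"
  have K_step: "K r - K s \<le> p * (exp (\<xi> * M) * (\<xi>\<^sup>2 / (1 - \<xi>)) * (2 * M / \<delta>)\<^sup>2) * Os * (s - r)\<^sup>2"
    if rs: "0 \<le> r" "r \<le> s" "s \<le> 1 - \<delta>" and \<delta>: "\<delta> > 0" for r s \<delta>
  proof -
    let ?c = "exp (\<xi> * M) * (\<xi>\<^sup>2 / (1 - \<xi>))"
    have s1: "s < 1" "r < 1" using rs \<delta> by auto
    have vm: "v r \<le> v s" using top_avg_mono[of r s] s1 rs by (simp add: v_def)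
    have vM: "v s \<le> M - 1" "- M - 1 \<le> v r" using top_avg_le[of s] top_avg_ge_M[of r] s1 by (auto simp: v_def)
    define \<kappa> where "\<kappa> = ?c * (v s - v r)\<^sup>2"
    have "E r \<le> ?l (v r) (top_avg r)" using top[of r] rs s1 by (simp add: tl E_def)
    also have "\<dots> \<le> ?l (v s) (top_avg r) + \<kappa>"
      unfolding \<kappa>_def by (rule tangent_line_gap_le[OF p xi]) (use vm vM in \<open>auto simp: v_def\<close>)
    finally have "?P (v r) (top_avg r) (E r) \<le> ?P (v s) (top_avg r) (E r) + p * \<kappa> * (?d (v r) - ?d (v s))"
      by (intro support_plane_shift_le[OF p xi]) (use vm in \<open>auto simp: v_def\<close>)
    also have "p * \<kappa> * (?d (v r) - ?d (v s)) \<le> p * (?c * (2 * M / \<delta>)\<^sup>2 * (s - r)\<^sup>2) * Os"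
    proof (intro mult_mono)
      have "(v s - v r)\<^sup>2 \<le> (2 * M / \<delta> * (s - r))\<^sup>2"
        using top_avg_lipschitz[of r s \<delta>] vm rs \<delta> by (intro power_mono) (auto simp: v_def)
      then show "\<kappa> \<le> ?c * (2 * M / \<delta>)\<^sup>2 * (s - r)\<^sup>2"
        unfolding \<kappa>_def mult.assoc power_mult_distrib[symmetric] using xi by (intro mult_left_mono) auto
      show "?d (v r) - ?d (v s) \<le> Os"
        unfolding Os_def using upper_dual_antimono[OF p xi] vM by (intro diff_mono) auto
      show "0 \<le> ?d (v r) - ?d (v s)"
        using upper_dual_antimono[OF p xi vm] by simp
      show "0 \<le> \<kappa>" using xi by (auto simp: \<kappa>_def)
    qed (use p xi in auto)
    finally have 1: "?P (v r) (top_avg r) (E r) \<le> ?P (v s) (top_avg r) (E r) + p * (?c * (2 * M / \<delta>)\<^sup>2 * (s - r)\<^sup>2) * Os"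
      by simp
    let ?e = "p * (?c * (2 * M / \<delta>)\<^sup>2 * (s - r)\<^sup>2) * Os"
    have Os: "Os \<ge> 0" unfolding Os_def using upper_dual_antimono[OF p xi, of "-M-1" "M-1"] bound_nonneg by simp
    have e0: "?e \<ge> 0" using p xi Os by (intro mult_nonneg_nonneg) auto
    have "(1 - r) * ?P (v r) (top_avg r) (E r) \<le> (1 - r) * (?P (v s) (top_avg r) (E r) + ?e)"
      using 1 s1 by (intro mult_left_mono) auto
    also have "\<dots> \<le> (1 - r) * ?P (v s) (top_avg r) (E r) + ?e"
      using e0 rs mult_left_le_one_le[of ?e "1 - r"] s1 by (simp add: distrib_left)
    also have "(1 - r) * ?P (v s) (top_avg r) (E r) = integral {r..1} (\<lambda>x. ?P (v s) (I x) (exp (\<xi> * I x)))"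
      using sp_avg s1 by simp
    also have "\<dots> = integral {r..s} (\<lambda>x. ?P (v s) (I x) (exp (\<xi> * I x))) + integral {s..1} (\<lambda>x. ?P (v s) (I x) (exp (\<xi> * I x)))"
      using s1 rs by (intro Henstock_Kurzweil_Integration.integral_combine[symmetric] int_sp) auto
    \<comment> \<open>On \<open>{r..s}\<close> the profile is at most
      \<open>top_avg s = v s + 1\<close>, precisely the range in which the plane lies below the
      lower boundary values. Here the monotonicity of \<open>I\<close> is decisive.\<close>
    also have "integral {r..s} (\<lambda>x. ?P (v s) (I x) (exp (\<xi> * I x))) \<le> integral {r..s} (\<lambda>x. \<bar>I x\<bar> powr p)"
      by (intro integral_le int_sp int_f support_plane_le_diagonal[OF p xi])
         (use top_avg_ge[of s] s1 in \<open>auto simp: v_def\<close>)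
    also have "integral {s..1} (\<lambda>x. ?P (v s) (I x) (exp (\<xi> * I x))) = (1 - s) * ?P (v s) (top_avg s) (E s)"
      using sp_avg s1 by simp
    finally have "(1 - r) * ?P (v r) (top_avg r) (E r) \<le> integral {r..s} (\<lambda>x. \<bar>I x\<bar> powr p) + (1 - s) * ?P (v s) (top_avg s) (E s) + ?e"
      by simp
    moreover have "F r = integral {r..s} (\<lambda>x. \<bar>I x\<bar> powr p) + F s"
      unfolding F_def using s1 rs by (intro Henstock_Kurzweil_Integration.integral_combine[symmetric] int_f) auto
    ultimately have "K r - K s \<le> ?e" unfolding K_def by linarith
    also have "?e = p * (?c * (2 * M / \<delta>)\<^sup>2) * Os * (s - r)\<^sup>2" by (simp add: mult_ac)
    finally show ?thesis .
  qed
  \<comment> \<open>A bound independent of \<open>s\<close>: the Lipschitz constant of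
    \<open>top_avg\<close> blows up at 1, so \<open>K\<close> is followed only up to
    \<open>1 - \<delta>\<close>, and there the remaining weight \<open>\<delta>\<close> must make
    the plane term small.\<close>
  obtain B where B: "\<And>s. 0 \<le> s \<Longrightarrow> s < 1 \<Longrightarrow> ?P (v s) (top_avg s) (E s) \<le> B" "B > 0"
  proof -
    define g where "g r = \<bar>r\<bar> powr p + p * tangent_slope p r" for r
    have "compact (g ` {-M-1..M-1})" unfolding g_def
      using p by (intro compact_continuous_image continuous_intros continuous_on_tangent_slope continuous_on_powr') auto
    then obtain B1 where B1: "\<And>y. y \<in> {-M-1..M-1} \<Longrightarrow> \<bar>g y\<bar> \<le> B1"
      by (metis bounded_iff compact_imp_bounded image_eqI real_norm_def)
    have "compact (?d ` {-M-1..M-1})"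
      by (intro compact_continuous_image continuous_on_upper_dual[OF p xi]) auto
    then obtain B2 where B2: "\<And>y. y \<in> {-M-1..M-1} \<Longrightarrow> \<bar>?d y\<bar> \<le> B2"
      by (metis bounded_iff compact_imp_bounded image_eqI real_norm_def)
    let ?C = "exp (- \<xi>) / (1 - \<xi>) * exp (\<xi> * M)"
    have "?P (v s) (top_avg s) (E s) \<le> B1 + p * B2 * ?C" if s: "0 \<le> s" "s < 1" for s
    proof -
      have vin: "v s \<in> {-M-1..M-1}" using top_avg_le[of s] top_avg_ge_M[of s] s by (auto simp: v_def)
      have E0: "E s \<ge> 0" unfolding E_def using s by (intro divide_nonneg_nonneg integral_nonneg int_e) auto
      have "?l (v s) (top_avg s) \<le> ?C" 
        unfolding tl using xi top_avg_le[of s] s by (intro mult_left_mono) auto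
      moreover have "E s \<le> ?l (v s) (top_avg s)" using top[of s] s by (simp add: tl E_def)
      ultimately have d: "\<bar>E s - ?l (v s) (top_avg s)\<bar> \<le> ?C" using E0 by linarith
      have "p * ?d (v s) * (E s - ?l (v s) (top_avg s)) \<le> \<bar>p * ?d (v s)\<bar> * \<bar>E s - ?l (v s) (top_avg s)\<bar>"
        by (metis abs_ge_self abs_mult)
      also have "\<dots> \<le> (p * B2) * ?C"
        using d B2[OF vin] p by (intro mult_mono) (auto simp: abs_mult)
      finally show ?thesis using B1[OF vin] by (simp add: support_plane_def g_def v_def)
    qed
    then show ?thesis by (intro that[of "max 1 (B1 + p * B2 * ?C)"]) (auto intro: max.coboundedI2)
  qed
  have "K 0 \<le> \<delta> * B" if \<delta>: "0 < \<delta>" "\<delta> < 1" for \<delta>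
  proof -
    have "K 0 \<le> K (1 - \<delta>)"
      by (rule nonincreasing_if_quadratic_increments[OF _ K_step[of _ _ \<delta>]]) (use \<delta> in auto)
    also have "\<dots> \<le> \<delta> * B"
    proof -
      have "F (1 - \<delta>) \<ge> 0" unfolding F_def by (intro integral_nonneg int_f) auto
      moreover have "\<delta> * ?P (v (1 - \<delta>)) (top_avg (1 - \<delta>)) (E (1 - \<delta>)) \<le> \<delta> * B"
        using \<delta> B(1)[of "1 - \<delta>"] by (intro mult_left_mono) auto
      ultimately show ?thesis by (simp add: K_def)
    qed
    finally show ?thesis .
  qed
  then have "K 0 \<le> 0"
  proof -
    assume h: "\<And>\<delta>. 0 < \<delta> \<Longrightarrow> \<delta> < 1 \<Longrightarrow> K 0 \<le> \<delta> * B"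
    have "K 0 \<le> e" if "e > 0" for e
      using h[of "min (1/2) (e / B)"] that B(2)
      by (smt (verit) divide_pos_pos min_less_iff_conj mult_right_mono nonzero_eq_divide_eq half_gt_zero_iff min_def field_sum_of_halves)
    then show ?thesis by (meson dense_ge)
  qed
  then show ?thesis by (simp add: K_def top_avg_def zero E_def v_def F_def)
qed


text \<open>The lines \<open>1 + z / (1 - x)\<close> and \<open>1 + z / (1 - y)\<close> are the
  tangents from the bottom point \<open>(0, 1)\<close> to \<open>C * exp z\<close>, touching it over
  \<open>x\<close> and \<open>y\<close>; \<open>R\<close> and \<open>L\<close> are the heights of
  \<open>exp z\<close> above them. The factor \<open>\<beta>\<close> is the one for which
  \<open>z + \<beta> * R z\<close> and \<open>- z + \<beta> * L z\<close> are the same function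
  \<open>P\<close>, so one plane serves both signs of \<open>z\<close>.\<close>

lemma mean_abs_bound:
  assumes C: "C > 1" and xp: "0 < x" "x < 1" "exp (- x) = C * (1 - x)"
    and yn: "y < 0" "exp (- y) = C * (1 - y)"
    and top: "\<And>s. 0 \<le> s \<Longrightarrow> s < 1 \<Longrightarrow>
      integral {s..1} (\<lambda>t. exp (I t)) / (1 - s) \<le> C * exp (integral {s..1} I / (1 - s))"
    and bot: "\<And>s. 0 < s \<Longrightarrow> s \<le> 1 \<Longrightarrow>
      integral {0..s} (\<lambda>t. exp (I t)) / s \<le> C * exp (integral {0..s} I / s)"
    and zero: "integral {0..1} I = 0"
  shows "2 * ((1 - y) * (1 - x) / (x - y)) * (integral {0..1} (\<lambda>t. exp (I t)) - 1) \<le> integral {0..1} (\<lambda>t. \<bar>I t\<bar>)"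
proof -
  define \<beta> where "\<beta> = 2 * ((1 - y) * (1 - x) / (x - y))"
  have \<beta>: "\<beta> > 0" using xp yn by (simp add: \<beta>_def)
  define W where "W = integral {0..1} (\<lambda>t. exp (I t))"
  define R where "R z = exp z - 1 - z / (1 - x)" for z
  define L where "L z = exp z - 1 - z / (1 - y)" for z
  define P where "P z = z + \<beta> * R z" for z
  have PL: "P z = - z + \<beta> * L z" for z
  proof -
    have "\<beta> * (1 / (1 - x) - 1 / (1 - y)) = 2"
    proof -
      have "1 / (1 - x) - 1 / (1 - y) = (x - y) / ((1 - y) * (1 - x))"
        using xp yn by (simp add: field_simps)
      then show ?thesis using xp yn by (simp add: \<beta>_def)
    qed
    then have "\<beta> * (1 / (1 - x) - 1 / (1 - y)) * z = 2 * z" by simp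
    then show ?thesis by (simp add: P_def R_def L_def algebra_simps)
  qed
  have cont: "continuous_on UNIV R" "continuous_on UNIV L" "continuous_on UNIV P" "continuous_on UNIV (\<lambda>t::real. \<bar>t\<bar>)" "continuous_on UNIV (exp :: real \<Rightarrow> real)"
    unfolding R_def[abs_def] L_def[abs_def] P_def[abs_def] using xp yn by (auto intro!: continuous_intros)
  note ci = comp_profile_integrable[OF cont(1)] comp_profile_integrable[OF cont(2)] comp_profile_integrable[OF cont(3)] comp_profile_integrable[OF cont(4)] comp_profile_integrable[OF cont(5)] profile_integrable
  have lin: "integral {a..b} (\<lambda>t. exp (I t) - 1 - I t / c) = integral {a..b} (\<lambda>t. exp (I t)) - (b - a) - integral {a..b} I / c"
    if "a \<le> b" for a b c
  proof (rule integral_unique)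
    show "((\<lambda>t. exp (I t) - 1 - I t / c) has_integral integral {a..b} (\<lambda>t. exp (I t)) - (b - a) - integral {a..b} I / c) {a..b}"
      using has_integral_const_real[of "1::real" a b] that
      by (intro has_integral_diff has_integral_divide integrable_integral ci) simp
  qed
  have tot: "integral {0..1} (\<lambda>t. P (I t)) = \<beta> * (W - 1)"
  proof -
    have "(\<lambda>t. P (I t)) = (\<lambda>t. (1 - \<beta> / (1 - x)) * I t + \<beta> * exp (I t) - \<beta>)"
      by (auto simp: P_def R_def algebra_simps)
    moreover have "((\<lambda>t. (1 - \<beta> / (1 - x)) * I t + \<beta> * exp (I t) - \<beta>) has_integral
        (1 - \<beta> / (1 - x)) * integral {0..1} I + \<beta> * W - \<beta>) {0..1}"
      using has_integral_const_real[of \<beta> 0 1] unfolding W_def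
      by (intro has_integral_diff has_integral_add has_integral_mult_right integrable_integral ci) simp
    ultimately have "integral {0..1} (\<lambda>t. P (I t)) = (1 - \<beta> / (1 - x)) * integral {0..1} I + \<beta> * W - \<beta>"
      by (simp add: integral_unique)
    then show ?thesis by (simp add: zero algebra_simps)
  qed
  \<comment> \<open>On \<open>{0..x}\<close> the exponential lies below its chord, and the chord
    lies below the tangent because \<open>exp x \<le> C * exp x = 1 / (1 - x)\<close>. Hence
    \<open>R z \<le> 0\<close> and \<open>P z \<le> z\<close>; the negative side uses
    \<open>L\<close> in the same way.\<close>
  have P_le: "P z \<le> \<bar>z\<bar>" if z: "y \<le> z" "z \<le> x" for z
  proof -
    have conv: "convex_on UNIV (exp :: real \<Rightarrow> real)" by (rule exp_convex)
    have line: "exp z \<le> 1 + z / w * (exp w - 1)" if "0 < z / w" "z / w \<le> 1" "w \<noteq> 0" for z w :: real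
    proof -
      have "exp ((1 - z / w) *\<^sub>R 0 + (z / w) *\<^sub>R w) \<le> (1 - z / w) * exp 0 + (z / w) * exp w"
        by (rule convex_onD[OF conv]) (use that in auto)
      then show ?thesis using that by (simp add: algebra_simps)
    qed
    consider "z = 0" | "z > 0" | "z < 0" by linarith
    then show ?thesis
    proof cases
      case 1 then show ?thesis by (simp add: P_def R_def)
    next
      case 2
      have "exp x \<le> C * exp x" using C by simp
      also have "\<dots> = 1 / (1 - x)" using xp by (simp add: exp_minus field_simps)
      finally have "exp x \<le> 1 / (1 - x)" .
      then have "exp x - 1 \<le> x / (1 - x)" using xp by (simp add: field_simps)
      then have "z / x * (exp x - 1) \<le> z / x * (x / (1 - x))" using 2 xp by (intro mult_left_mono) auto
      then have "R z \<le> 0" using line[of z x] 2 xp z by (simp add: R_def)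
      then show ?thesis using 2 \<beta> by (simp add: P_def mult_le_0_iff)
    next
      case 3
      have "exp y \<le> C * exp y" using C by simp
      also have "\<dots> = 1 / (1 - y)" using yn by (simp add: exp_minus field_simps)
      finally have "exp y \<le> 1 / (1 - y)" .
      then have "exp y - 1 \<le> y / (1 - y)" using yn by (simp add: field_simps)
      then have "z / y * (exp y - 1) \<le> z / y * (y / (1 - y))" using 3 yn by (intro mult_left_mono) (auto simp: divide_nonpos_nonpos)
      then have "L z \<le> 0" using line[of z y] 3 yn z by (simp add: L_def divide_le_eq_1 zero_less_divide_iff)
      then show ?thesis using 3 \<beta> by (simp add: PL mult_le_0_iff)
    qed
  qed
  \<comment> \<open>Replacing \<open>exp z - 1\<close> by \<open>z\<close> leaves a linear function
    of \<open>z\<close> whose slope lies between -1 and 1.\<close>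
  have P_ge: "- \<bar>z\<bar> \<le> P z" for z
  proof -
    have e: "exp z - 1 \<ge> z" using exp_ge_add_one_self[of z] by linarith
    have "P z \<ge> (1 - \<beta> * x / (1 - x)) * z"
    proof -
      have "\<beta> * (exp z - 1) \<ge> \<beta> * z" using e \<beta> by (intro mult_left_mono) auto
      moreover have "(1 - \<beta> * x / (1 - x)) * z = z + \<beta> * z - \<beta> * (z / (1 - x))"
        using xp by (simp add: divide_simps) (simp add: algebra_simps)
      ultimately show ?thesis by (simp add: P_def R_def right_diff_distrib)
    qed
    moreover have "\<beta> * x / (1 - x) = 2 * ((1 - y) * x / (x - y))" using xp by (simp add: \<beta>_def)
    moreover have "(1 - y) * x / (x - y) \<le> 1" "(1 - y) * x / (x - y) \<ge> 0"
      using xp yn by (auto simp: field_simps mult_le_cancel_left)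
    ultimately have b: "\<bar>1 - \<beta> * x / (1 - x)\<bar> \<le> 1" "P z \<ge> (1 - \<beta> * x / (1 - x)) * z" by auto
    have "\<bar>(1 - \<beta> * x / (1 - x)) * z\<bar> \<le> 1 * \<bar>z\<bar>"
      unfolding abs_mult using b by (intro mult_right_mono) auto
    then show ?thesis using b by linarith
  qed
  show ?thesis
  proof (cases "W \<le> 1")
    case True
    have "0 \<le> integral {0..1} (\<lambda>t. \<bar>I t\<bar>)" by (intro integral_nonneg ci) auto
    moreover have "\<beta> * (W - 1) \<le> 0" using True \<beta> by (simp add: mult_le_0_iff)
    ultimately show ?thesis by (simp add: \<beta>_def W_def)
  next
    \<comment> \<open>With mean 0, the excess \<open>W - 1 > 0\<close> is the value of both
      \<open>lR 0\<close> and \<open>lL 1\<close>, so the first zero of \<open>lR\<close> and the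
      last zero of \<open>lL\<close> are preceded and followed, respectively, by strictly positive
      values.\<close>
    case False
    define lR where "lR s = integral {s..1} (\<lambda>t. R (I t))" for s
    define lL where "lL s = integral {0..s} (\<lambda>t. L (I t))" for s
    have lR0: "lR 0 > 0" and lL1: "lL 1 > 0"
    proof -
      have "lR 0 = W - 1 - integral {0..1} I / (1 - x)"
        unfolding lR_def R_def W_def by (simp add: lin)
      then show "lR 0 > 0" using False zero by simp
      have "lL 1 = W - 1 - integral {0..1} I / (1 - y)"
        unfolding lL_def L_def W_def by (simp add: lin)
      then show "lL 1 > 0" using False zero by simp
    qed
    have cR: "continuous_on {0..1} lR" unfolding lR_def by (intro indefinite_integral_continuous_1' ci)
    have cL: "continuous_on {0..1} lL" unfolding lL_def by (intro indefinite_integral_continuous_1 ci)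
    txt \<open>On \<open>{sR..1}\<close> and \<open>{0..sL}\<close> the plane integrates to \<open>\<integral> I\<close> and \<open>- \<integral> I\<close>; between \<open>sL\<close> and \<open>sR\<close> the
      function \<open>I\<close> stays in \<open>{y..x}\<close>, where \<open>P z \<le> \<bar>z\<bar>\<close>. If the two pieces overlap, \<open>- \<bar>z\<bar> \<le> P z\<close> pays for
      the part counted twice.\<close>
    define sR where "sR = Inf {s \<in> {0..1}. lR s = 0}"
    define sL where "sL = Sup {s \<in> {0..1}. lL s = 0}"
    have clR: "closed {s \<in> {0..1}. lR s = 0}"
      using continuous_closed_preimage_constant[OF cR, of 0] by simp
    have clL: "closed {s \<in> {0..1}. lL s = 0}"
      using continuous_closed_preimage_constant[OF cL, of 0] by simp
    have memR: "sR \<in> {s \<in> {0..1}. lR s = 0}" unfolding sR_def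
      by (rule closed_contains_Inf[OF _ _ clR]) (auto simp: lR_def intro!: exI[of _ 1])
    have memL: "sL \<in> {s \<in> {0..1}. lL s = 0}" unfolding sL_def
      by (rule closed_contains_Sup[OF _ _ clL]) (auto simp: lL_def intro!: exI[of _ 0])
    have posR: "lR s > 0" if s: "0 \<le> s" "s < sR" for s
    proof (rule ccontr)
      assume "\<not> lR s > 0"
      then obtain t where t: "0 \<le> t" "t \<le> s" "lR t = 0"
        using IVT2'[of lR s 0 0] lR0 s memR continuous_on_subset[OF cR, of "{0..s}"] by (auto simp: subset_iff)
      then have "sR \<le> t" unfolding sR_def using s memR by (intro cInf_lower bdd_belowI[of _ 0]) auto
      then show False using t s by simp
    qed
    have posL: "lL s > 0" if s: "sL < s" "s \<le> 1" for s
    proof (rule ccontr)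
      assume "\<not> lL s > 0"
      then obtain t where t: "s \<le> t" "t \<le> 1" "lL t = 0"
        using IVT'[of lL s 0 1] lL1 s memL continuous_on_subset[OF cL, of "{s..1}"] by (auto simp: subset_iff)
      then have "t \<le> sL" unfolding sL_def using s memL by (intro cSup_upper bdd_aboveI[of _ 1]) auto
      then show False using t s by simp
    qed
    \<comment> \<open>A value above \<open>x\<close> would push the average over
      \<open>{s..1}\<close> above \<open>x\<close>, while the total average is 0. At an intermediate
      \<open>t\<close> the average equals \<open>x\<close>, where the bound \<open>C * exp x\<close>
      meets the tangent \<open>1 / (1 - x)\<close>; this forces \<open>lR t \<le> 0\<close> before
      the first zero of \<open>lR\<close>.\<close>
    have I_le: "I s \<le> x" if s: "0 \<le> s" "s < sR" for s
    proof (rule ccontr)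
      assume "\<not> I s \<le> x"
      then have "top_avg s \<ge> x" using top_avg_ge[of s s] s memR by auto
      moreover have "top_avg 0 \<le> x" using zero xp by (simp add: top_avg_def)
      moreover have "continuous_on {0..s} top_avg"
        unfolding top_avg_def[abs_def] using s memR
        by (intro continuous_intros continuous_on_subset[OF indefinite_integral_continuous_1'] ci) auto
      ultimately obtain t where t: "0 \<le> t" "t \<le> s" "top_avg t = x"
        using IVT'[of top_avg 0 x s] s by auto
      have t1: "t < 1" "t < sR" using t s memR by auto
      have "integral {t..1} (\<lambda>u. exp (I u)) / (1 - t) \<le> C * exp x"
        using top[of t] t t1 by (simp add: top_avg_def)
      also have "C * exp x = 1 / (1 - x)" using xp by (simp add: exp_minus field_simps)
      finally have "integral {t..1} (\<lambda>u. exp (I u)) \<le> (1 - t) / (1 - x)" using t1 by (simp add: field_simps)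
      moreover have "lR t = integral {t..1} (\<lambda>u. exp (I u)) - (1 - t) - integral {t..1} I / (1 - x)"
        unfolding lR_def R_def using t1 by (simp add: lin)
      moreover have "integral {t..1} I = (1 - t) * x" using t t1 by (auto simp: top_avg_def field_simps)
      moreover have "(1 - t) / (1 - x) - (1 - t) - (1 - t) * x / (1 - x) = 0" using xp by (simp add: field_simps)
      ultimately have "lR t \<le> 0" by simp
      then show False using posR[of t] t t1 by simp
    qed
    have I_ge: "y \<le> I s" if s: "sL < s" "s \<le> 1" for s
    proof (rule ccontr)
      assume neg: "\<not> y \<le> I s"
      have s0: "0 < s" using s memL by auto
      define b where "b s = integral {0..s} I / s" for s
      have "integral {0..s} I \<le> integral {0..s} (\<lambda>_. I s)"
        by (intro integral_le ci) (use monoD[OF mono] in auto)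
      then have "b s \<le> y" using neg s0 by (simp add: b_def field_simps) (smt (verit) mult_left_mono)
      moreover have "y \<le> b 1" using zero yn by (simp add: b_def)
      moreover have "continuous_on {s..1} b"
        unfolding b_def[abs_def] using s0 s
        by (intro continuous_intros continuous_on_subset[OF indefinite_integral_continuous_1[of I 0 1]] ci) auto
      ultimately obtain t where t: "s \<le> t" "t \<le> 1" "b t = y"
        using IVT'[of b s y 1] s by auto
      have t1: "t > 0" "sL < t" using t s s0 by auto
      have "integral {0..t} (\<lambda>u. exp (I u)) / t \<le> C * exp y"
        using bot[of t] t t1 by (simp add: b_def)
      also have "C * exp y = 1 / (1 - y)" using yn by (simp add: exp_minus field_simps)
      finally have "integral {0..t} (\<lambda>u. exp (I u)) \<le> t / (1 - y)" using t1 by (simp add: field_simps)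
      moreover have "lL t = integral {0..t} (\<lambda>u. exp (I u)) - t - integral {0..t} I / (1 - y)"
        unfolding lL_def L_def using t1 by (simp add: lin)
      moreover have "integral {0..t} I = t * y" using t t1 by (auto simp: b_def field_simps)
      moreover have "t / (1 - y) - t - t * y / (1 - y) = 0" using yn by (simp add: field_simps)
      ultimately have "lL t \<le> 0" by simp
      then show False using posL[of t] t t1 by simp
    qed
    have sbd: "0 \<le> sR" "sR \<le> 1" "0 \<le> sL" "sL \<le> 1" using memR memL by auto
    have PR: "integral {sR..1} (\<lambda>t. P (I t)) = integral {sR..1} I"
      unfolding P_def using memR ci by (simp add: integral_add integrable_on_mult_right integral_mult_right lR_def)
    have PL': "integral {0..sL} (\<lambda>t. P (I t)) = - integral {0..sL} I"
      unfolding PL using memL ci by (simp add: integral_diff integrable_on_mult_right integral_mult_right lL_def)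
    have comb: "integral {a..b} h + integral {b..c} h = integral {a..c} h" if "a \<le> b" "b \<le> c" "h integrable_on {a..c}" for a b c and h :: "real \<Rightarrow> real"
      using that by (rule Henstock_Kurzweil_Integration.integral_combine)
    have abs_le: "integral {a..b} I \<le> integral {a..b} (\<lambda>t. \<bar>I t\<bar>)" "- integral {a..b} I \<le> integral {a..b} (\<lambda>t. \<bar>I t\<bar>)" for a b
    proof -
      show "integral {a..b} I \<le> integral {a..b} (\<lambda>t. \<bar>I t\<bar>)" by (intro integral_le ci) auto
      have "integral {a..b} (\<lambda>t. - I t) \<le> integral {a..b} (\<lambda>t. \<bar>I t\<bar>)" by (intro integral_le integrable_neg ci) auto
      then show "- integral {a..b} I \<le> integral {a..b} (\<lambda>t. \<bar>I t\<bar>)" by simp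
    qed
    have "\<beta> * (W - 1) \<le> integral {0..1} (\<lambda>t. \<bar>I t\<bar>)"
    proof (cases "sL \<le> sR")
      case True
      \<comment> \<open>The bounds on \<open>I\<close> hold only strictly between \<open>sL\<close>
        and \<open>sR\<close>, so the integrand is altered at the two endpoints.\<close>
      have "integral {sL..sR} (\<lambda>t. P (I t)) = integral {sL..sR} (\<lambda>t. if t \<in> {sL, sR} then \<bar>I t\<bar> else P (I t))"
        by (rule integral_spike[of "{sL, sR}"]) auto
      also have "\<dots> \<le> integral {sL..sR} (\<lambda>t. \<bar>I t\<bar>)"
      proof (rule integral_le)
        show "(\<lambda>t. if t \<in> {sL, sR} then \<bar>I t\<bar> else P (I t)) integrable_on {sL..sR}"
          by (rule integrable_spike[OF ci(3), of "{sL, sR}"]) auto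
      qed (use ci P_le I_le I_ge sbd in auto)
      finally have "integral {sL..sR} (\<lambda>t. P (I t)) \<le> integral {sL..sR} (\<lambda>t. \<bar>I t\<bar>)" .
      then show ?thesis
        using comb[OF _ _ ci(3), of 0 sL 1] comb[OF _ _ ci(3), of sL sR 1] comb[OF _ _ ci(4), of 0 sL 1] comb[OF _ _ ci(4), of sL sR 1]
          PR PL' abs_le(1)[of sR 1] abs_le(2)[of 0 sL] sbd True tot by linarith
    next
      case False
      have "integral {sR..sL} (\<lambda>t. - \<bar>I t\<bar>) \<le> integral {sR..sL} (\<lambda>t. P (I t))"
        by (intro integral_le integrable_neg ci P_ge)
      then have "- integral {sR..sL} (\<lambda>t. \<bar>I t\<bar>) \<le> integral {sR..sL} (\<lambda>t. P (I t))" by simp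
      then show ?thesis
        using comb[OF _ _ ci(3), of 0 sR 1] comb[OF _ _ ci(3), of 0 sR sL] comb[OF _ _ ci(4), of 0 sR 1] comb[OF _ _ ci(4), of sR sL 1]
          comb[OF _ _ ci(6), of 0 sR sL] comb[OF _ _ ci(6), of sR sL 1]
          PR PL' abs_le(1)[of sL 1] abs_le(2)[of 0 sR] sbd False tot by linarith
    qed
    then show ?thesis by (simp add: \<beta>_def W_def)
  qed
qed

end

section \<open>The rising sun lemma and monotone rearrangement\<close>

text \<open>The sign condition compares two measures, with the positive and the negative part of
  \<open>h\<close> as densities. Countable additivity of both gives the inequality on the union,
  even though there may be infinitely many sets.\<close>

lemma integral_Union_le_0:
  fixes h :: "real \<Rightarrow> real"
  assumes "countable \<D>" and dis: "disjoint \<D>" and ms: "\<And>D. D \<in> \<D> \<Longrightarrow> D \<in> sets lebesgue"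
    and h: "h absolutely_integrable_on S" and sub: "\<And>D. D \<in> \<D> \<Longrightarrow> D \<subseteq> S"
    and le: "\<And>D. D \<in> \<D> \<Longrightarrow> integral D h \<le> 0"
  shows "integral (\<Union>\<D>) h \<le> 0"
proof -
  define k where "k x = indicator S x * h x" for x
  have k: "integrable lebesgue k"
    using h unfolding set_integrable_def k_def[abs_def] by simp
  have [measurable]: "k \<in> borel_measurable lebesgue" using k by auto
  define \<mu> where "\<mu> = density lebesgue (\<lambda>x. ennreal (k x))"
  define \<nu> where "\<nu> = density lebesgue (\<lambda>x. ennreal (- k x))"
  have sgn: "integral A h \<le> 0 \<longleftrightarrow> emeasure \<mu> A \<le> emeasure \<nu> A" if A: "A \<in> sets lebesgue" "A \<subseteq> S" for A
  proof -
    have hA: "h absolutely_integrable_on A" using h A by (rule set_integrable_subset)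
    have ik: "integrable lebesgue (\<lambda>x. indicator A x * k x)"
      using integrable_real_mult_indicator[OF A(1) k] by (simp add: mult.commute)
    have "integral A h = (LINT x:A|lebesgue. h x)" using hA by (simp add: set_lebesgue_integral_eq_integral)
    also have "\<dots> = integral\<^sup>L lebesgue (\<lambda>x. indicator A x * k x)"
      unfolding set_lebesgue_integral_def k_def using A by (intro Bochner_Integration.integral_cong) (auto simp: indicator_def)
    also have "\<dots> = enn2real (\<integral>\<^sup>+x. ennreal (indicator A x * k x) \<partial>lebesgue) - enn2real (\<integral>\<^sup>+x. ennreal (- (indicator A x * k x)) \<partial>lebesgue)"
      by (rule real_lebesgue_integral_def[OF ik])
    also have mu: "(\<integral>\<^sup>+x. ennreal (indicator A x * k x) \<partial>lebesgue) = emeasure \<mu> A"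
      unfolding \<mu>_def using A by (subst emeasure_density) (auto intro!: nn_integral_cong simp: indicator_def)
    also have nu: "(\<integral>\<^sup>+x. ennreal (- (indicator A x * k x)) \<partial>lebesgue) = emeasure \<nu> A"
      unfolding \<nu>_def using A by (subst emeasure_density) (auto intro!: nn_integral_cong simp: indicator_def)
    finally have eq: "integral A h = enn2real (emeasure \<mu> A) - enn2real (emeasure \<nu> A)" .
    have "emeasure \<mu> A < \<infinity>" "emeasure \<nu> A < \<infinity>"
      using ik unfolding real_integrable_def mu nu by (auto simp: less_top)
    then show ?thesis unfolding eq
      by (cases "emeasure \<mu> A"; cases "emeasure \<nu> A") auto
  qed
  have U: "\<Union>\<D> \<in> sets lebesgue" using assms by (intro sets.countable_Union) auto
  have "emeasure \<mu> (\<Union>\<D>) = (\<integral>\<^sup>+D. emeasure \<mu> D \<partial>count_space \<D>)"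
    using emeasure_UN_countable[of \<D> "\<lambda>D. D" \<mu>] ms dis assms(1)
    by (auto simp: \<mu>_def disjoint_family_on_def disjoint_def)
  also have "\<dots> \<le> (\<integral>\<^sup>+D. emeasure \<nu> D \<partial>count_space \<D>)"
    using le sub ms by (intro nn_integral_mono) (auto simp flip: sgn)
  also have "\<dots> = emeasure \<nu> (\<Union>\<D>)"
    using emeasure_UN_countable[of \<D> "\<lambda>D. D" \<nu>] ms dis assms(1)
    by (auto simp: \<nu>_def disjoint_family_on_def disjoint_def)
  finally show ?thesis using sgn[OF U] sub by blast
qed

lemma open_real_component:
  fixes U :: "real set"
  assumes U: "open U" "U \<subseteq> {a<..<b}" and x: "x \<in> U"
  obtains c d where "c < x" "x < d" "{c<..<d} \<subseteq> U" "c \<notin> U" "d \<notin> U" "a \<le> c" "d \<le> b"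
proof -
  define c where "c = Sup ({a..x} - U)"
  define d where "d = Inf ({x..b} - U)"
  have ab: "a < x" "x < b" using U x by auto
  have anin: "a \<in> {a..x} - U" and bnin: "b \<in> {x..b} - U" using ab U by auto
  have cl: "closed ({a..x} - U)" "closed ({x..b} - U)" using U by (auto intro: closed_Diff)
  have "bdd_above ({a..x} - U)" by (rule bdd_aboveI[of _ x]) auto
  then have cin: "c \<in> {a..x} - U"
    unfolding c_def using anin cl by (intro closed_contains_Sup) blast+
  have "bdd_below ({x..b} - U)" by (rule bdd_belowI[of _ x]) auto
  then have din: "d \<in> {x..b} - U"
    unfolding d_def using bnin cl by (intro closed_contains_Inf) blast+
  have "{c<..<d} \<subseteq> U"
  proof
    fix y assume y: "y \<in> {c<..<d}"
    show "y \<in> U"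
    proof (rule ccontr)
      assume "y \<notin> U"
      show False
      proof (cases "y \<le> x")
        case True
        then have "y \<in> {a..x} - U" using y cin \<open>y \<notin> U\<close> by auto
        then have "y \<le> c" unfolding c_def by (intro cSup_upper bdd_aboveI[of _ x]) auto
        then show False using y by simp
      next
        case False
        then have "y \<in> {x..b} - U" using y din \<open>y \<notin> U\<close> by auto
        then have "d \<le> y" unfolding d_def by (intro cInf_lower bdd_belowI[of _ x]) auto
        then show False using y by simp
      qed
    qed
  qed
  moreover have "c < x" "x < d" using cin din x by (auto simp: less_le)
  ultimately show ?thesis using that[of c d] cin din by auto
qed

text \<open>\<open>E\<close> is \<open>{a<..<a'}\<close> together with the rising sun set of the
  primitive \<open>G\<close> on \<open>{a'<..<b}\<close>, where \<open>a'\<close> is the last point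
  with \<open>G \<ge> 0\<close>. Starting at \<open>a'\<close> makes the integral of
  \<open>g\<close> vanish exactly on every piece; from \<open>a\<close> the leftmost component could
  give only an inequality. The last conclusion is stated for all \<open>h\<close> so that
  \<open>g\<close>, \<open>- g\<close> and the exponential can all be tested on the same
  \<open>E\<close>.\<close>

lemma rising_sun:
  fixes g :: "real \<Rightarrow> real"
  assumes ab: "a < b" and g: "g absolutely_integrable_on {a..b}" and le0: "integral {a..b} g \<le> 0"
  obtains E N where "E \<in> sets lebesgue" "E \<subseteq> {a..b}" "negligible N"
    "\<And>x. x \<in> {a..b} \<Longrightarrow> x \<notin> E \<Longrightarrow> x \<notin> N \<Longrightarrow> g x \<le> 0"
    "\<And>h :: real \<Rightarrow> real. h absolutely_integrable_on {a..b} \<Longrightarrow>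
       (\<And>c d. a \<le> c \<Longrightarrow> c < d \<Longrightarrow> d \<le> b \<Longrightarrow> integral {c..d} g = 0 \<Longrightarrow> integral {c..d} h \<le> 0) \<Longrightarrow>
       integral E h \<le> 0"
proof -
  have gi: "g integrable_on {a..b}" using g by (rule set_lebesgue_integral_eq_integral(1))
  define G where "G x = integral {a..x} g" for x
  have contG: "continuous_on {a..b} G" unfolding G_def by (rule indefinite_integral_continuous_1[OF gi])
  have Gd: "integral {c..d} g = G d - G c" if "a \<le> c" "c \<le> d" "d \<le> b" for c d
    using Henstock_Kurzweil_Integration.integral_combine[of a c d g] that integrable_on_subinterval[OF gi, of a d]
    by (simp add: G_def)
  have G0: "G a = 0" "G b \<le> 0" using le0 by (auto simp: G_def)
  define a' where "a' = Sup {x \<in> {a..b}. 0 \<le> G x}"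
  have "closed {x \<in> {a..b}. 0 \<le> G x}"
    using continuous_on_closed_Collect_le[OF continuous_on_const contG, of 0] by simp
  then have a'in: "a' \<in> {x \<in> {a..b}. 0 \<le> G x}"
    unfolding a'_def using G0 ab by (intro closed_contains_Sup) (auto intro!: bdd_aboveI[of _ b] exI[of _ a])
  have after: "G x < 0" if "a' < x" "x \<le> b" for x
  proof (rule ccontr)
    assume "\<not> G x < 0"
    then have "x \<le> a'" unfolding a'_def using that a'in by (intro cSup_upper bdd_aboveI[of _ b]) auto
    then show False using that by simp
  qed
  have a'0: "G a' = 0"
  proof (rule ccontr)
    assume "G a' \<noteq> 0"
    then have "G a' > 0" using a'in by auto
    then obtain t where "a' \<le> t" "t \<le> b" "G t = 0"
      using IVT2'[of G b 0 a'] G0 a'in continuous_on_subset[OF contG, of "{a'..b}"] by auto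
    with \<open>G a' > 0\<close> after[of t] show False by (cases "t = a'") auto
  qed
  define U where "U = {x \<in> {a'<..<b}. \<exists>y \<in> {x<..b}. G x < G y}"
  have a'b: "a \<le> a'" "a' \<le> b" using a'in by auto
  have U: "open U" "U \<subseteq> {a'<..<b}"
  proof -
    have "U = (\<Union>y\<in>{a'..b}. {x \<in> {a'<..<y}. G x < G y})" unfolding U_def by fastforce
    moreover have "open {x \<in> {a'<..<y}. G x < G y}" if "y \<in> {a'..b}" for y
    proof -
      have "continuous_on {a'<..<y} G" by (rule continuous_on_subset[OF contG]) (use that a'b in auto)
      then have "openin (top_of_set {a'<..<y}) ({a'<..<y} \<inter> G -` {..<G y})"
        by (rule continuous_openin_preimage_gen) auto
      then have "open ({a'<..<y} \<inter> G -` {..<G y})" by (rule openin_open_trans) auto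
      then show ?thesis by (simp add: vimage_def Int_def)
    qed
    ultimately show "open U" by auto
    show "U \<subseteq> {a'<..<b}" by (auto simp: U_def)
  qed
  have Ul: "U \<in> sets lebesgue" using U by (intro sets_completionI_sets) simp
  have Uab: "U \<subseteq> {a..b}" using U a'b by fastforce
  define \<D> where "\<D> = {{c<..<d} | c d. c < d \<and> {c<..<d} \<subseteq> U \<and> c \<notin> U \<and> d \<notin> U \<and> a' \<le> c \<and> d \<le> b}"
  have UD: "\<Union>\<D> = U"
  proof
    show "U \<subseteq> \<Union>\<D>"
    proof
      fix x assume "x \<in> U"
      then obtain c d where "c < x" "x < d" "{c<..<d} \<subseteq> U" "c \<notin> U" "d \<notin> U" "a' \<le> c" "d \<le> b"
        using open_real_component[OF U] by metis
      then have "{c<..<d} \<in> \<D>" "x \<in> {c<..<d}" by (auto simp: \<D>_def intro!: exI)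
      then show "x \<in> \<Union>\<D>" by blast
    qed
  qed (auto simp: \<D>_def)
  have disj: "disjoint \<D>"
  proof (unfold disjoint_def, intro ballI impI)
    fix A B assume "A \<in> \<D>" "B \<in> \<D>" "A \<noteq> B"
    then obtain c d e f where A: "A = {c<..<d}" "c < d" "{c<..<d} \<subseteq> U" "c \<notin> U" "d \<notin> U"
      and B: "B = {e<..<f}" "e < f" "{e<..<f} \<subseteq> U" "e \<notin> U" "f \<notin> U" by (auto simp: \<D>_def)
    have n: "c \<notin> {e<..<f}" "d \<notin> {e<..<f}" "e \<notin> {c<..<d}" "f \<notin> {c<..<d}" using A B by blast+
    show "A \<inter> B = {}"
    proof (rule ccontr)
      assume "A \<inter> B \<noteq> {}"
      then obtain z where "z \<in> A" "z \<in> B" by blast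
      then have "c < z" "z < d" "e < z" "z < f" using A B by auto
      then have "c = e" "d = f" using n by auto
      then show False using A B \<open>A \<noteq> B\<close> by simp
    qed
  qed
  have cnt: "countable \<D>"
    by (rule countable_disjoint_open_subsets[OF _ disj]) (auto simp: \<D>_def)
  have eqG: "G c = G d" if cd: "c < d" "{c<..<d} \<subseteq> U" "c \<notin> U" "d \<notin> U" "a' \<le> c" "d \<le> b" for c d
  proof (rule antisym)
    \<comment> \<open>A point of \<open>U\<close> never maximizes \<open>G\<close> over what follows
      it, so the maximum over \<open>{x..b}\<close> sits at some \<open>z \<ge> d\<close>; and since
      \<open>d\<close> is not in \<open>U\<close>, nothing beyond \<open>d\<close> exceeds
      \<open>G d\<close>.\<close>
    have le: "G x \<le> G d" if x: "x \<in> {c<..<d}" for x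
    proof -
      obtain z where z: "z \<in> {x..b}" "\<And>y. y \<in> {x..b} \<Longrightarrow> G y \<le> G z"
      proof -
        have "continuous_on {x..b} G" by (rule continuous_on_subset[OF contG]) (use x cd a'b in auto)
        moreover have "{x..b} \<noteq> {}" using x cd by auto
        ultimately have "\<exists>z\<in>{x..b}. \<forall>y\<in>{x..b}. G y \<le> G z"
          by (intro continuous_attains_sup) auto
        then show ?thesis using that by blast
      qed
      have "z \<ge> d"
      proof (rule ccontr)
        assume "\<not> z \<ge> d"
        then have "z \<in> U" using z x cd by auto
        then obtain y where "y \<in> {z<..b}" "G z < G y" by (auto simp: U_def)
        then show False using z(2)[of y] z(1) by auto
      qed
      have "G z \<le> G d"
      proof (cases "z = d")
        case False
        then have "d < z" "z \<le> b" using \<open>z \<ge> d\<close> z by auto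
        moreover have "d \<in> {a'<..<b}" using cd \<open>d < z\<close> \<open>z \<le> b\<close> by auto
        ultimately show ?thesis using cd(4) unfolding U_def by (auto simp: not_less)
      qed simp
      then show ?thesis using z(2)[of x] x cd by force
    qed
    have "continuous_on {c..d} G" by (rule continuous_on_subset[OF contG]) (use cd a'b in auto)
    then show "G c \<le> G d"
      using continuous_ge_on_closure[of "{c<..<d}" "\<lambda>x. - G x" c "- G d"] le cd
      by (simp add: continuous_on_minus)
    show "G d \<le> G c"
    proof (cases "c = a'")
      case True
      then show ?thesis using a'0 after[of d] cd by simp
    next
      case False
      then have "c \<in> {a'<..<b}" using cd by auto
      then show ?thesis using cd unfolding U_def by (auto simp: not_less)
    qed
  qed
  define E where "E = {a<..<a'} \<union> U"
  \<comment> \<open>Outside \<open>N\<close> the right derivative of the primitive is the integrand;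
    extending \<open>g\<close> by 0 makes the differentiation theorem applicable on the whole
    line.\<close>
  obtain N where N: "negligible N" "\<And>x e. x \<notin> N \<Longrightarrow> 0 < e \<Longrightarrow>
     \<exists>d>0. \<forall>h. 0 < h \<and> h < d \<longrightarrow> norm (integral {x..x + h} (\<lambda>x. if x \<in> {a..b} then g x else 0) / h - (if x \<in> {a..b} then g x else 0)) < e"
  proof -
    have *: "(\<lambda>x. if x \<in> {a..b} then g x else 0) integrable_on cbox c d" for c d
    proof -
      have "(\<lambda>x. if x \<in> {a..b} then g x else 0) integrable_on UNIV"
        using gi by (subst integrable_restrict_UNIV)
      then show ?thesis by (rule integrable_on_subcbox) auto
    qed
    from integrable_ccontinuous_explicit[OF *] show ?thesis using that by (auto simp: divide_inverse mult.commute)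
  qed
  show ?thesis
  proof (rule that[of E "N \<union> {a, a', b}"])
    show "E \<in> sets lebesgue" unfolding E_def using Ul by (intro sets.Un) auto
    show "E \<subseteq> {a..b}" unfolding E_def using Uab a'b by auto
    show "negligible (N \<union> {a, a', b})" using N by simp
    fix x assume x: "x \<in> {a..b}" "x \<notin> E" "x \<notin> N \<union> {a, a', b}"
    then have x': "x \<in> {a'<..<b}" "x \<notin> U" using a'b by (auto simp: E_def)
    show "g x \<le> 0"
    proof (rule ccontr)
      assume "\<not> g x \<le> 0"
      then obtain d where d: "d > 0" "\<And>h. 0 < h \<Longrightarrow> h < d \<Longrightarrow> \<bar>integral {x..x + h} (\<lambda>x. if x \<in> {a..b} then g x else 0) / h - g x\<bar> < g x"
        using N(2)[of x "g x"] x by auto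
      define h where "h = min (d / 2) (b - x)"
      have h: "0 < h" "h < d" "x + h \<le> b" using d x' by (auto simp: h_def min_def)
      have "integral {x..x + h} (\<lambda>x. if x \<in> {a..b} then g x else 0) = integral {x..x + h} g"
        by (rule Henstock_Kurzweil_Integration.integral_cong) (use x h in auto)
      also have "\<dots> = G (x + h) - G x" using x h by (intro Gd) auto
      also have "\<dots> \<le> 0" using x' h unfolding U_def by (auto simp: not_less)
      finally have "integral {x..x + h} (\<lambda>x. if x \<in> {a..b} then g x else 0) / h \<le> 0" using h by (simp add: divide_le_0_iff)
      then show False using d(2)[OF h(1,2)] by linarith
    qed
  next
    fix h :: "real \<Rightarrow> real" assume h: "h absolutely_integrable_on {a..b}"
      and hle: "\<And>c d. a \<le> c \<Longrightarrow> c < d \<Longrightarrow> d \<le> b \<Longrightarrow> integral {c..d} g = 0 \<Longrightarrow> integral {c..d} h \<le> 0"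
    have io: "integral {c<..<d} h = integral {c..d} h" for c d :: real
      using integral_open_interval_real[of c d h] by simp
    have "integral U h \<le> 0"
      unfolding UD[symmetric]
    proof (rule integral_Union_le_0[OF cnt disj _ h])
      fix D assume "D \<in> \<D>"
      then obtain c d where D: "D = {c<..<d}" "c < d" "{c<..<d} \<subseteq> U" "c \<notin> U" "d \<notin> U" "a' \<le> c" "d \<le> b"
        by (auto simp: \<D>_def)
      show "D \<in> sets lebesgue" "D \<subseteq> {a..b}" using D a'b by auto
      show "integral D h \<le> 0" unfolding D(1) io
        by (rule hle) (use D a'b eqG[of c d] Gd[of c d] in auto)
    qed
    moreover have "integral {a<..<a'} h \<le> 0"
    proof (cases "a < a'")
      case True
      show ?thesis unfolding io by (rule hle) (use True a'b Gd[of a a'] a'0 G0 in auto)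
    qed simp
    moreover have "integral E h = integral {a<..<a'} h + integral U h"
      unfolding E_def
    proof (rule Henstock_Kurzweil_Integration.integral_Un)
      show "h integrable_on {a<..<a'}"
        by (rule set_lebesgue_integral_eq_integral(1)[OF set_integrable_subset[OF h]]) (use a'b in auto)
      show "h integrable_on U"
        by (rule set_lebesgue_integral_eq_integral(1)[OF set_integrable_subset[OF h]])
           (fact Ul Uab)+
      have "x \<notin> {a<..<a'}" if "x \<in> U" for x using subsetD[OF U(2) that] by simp
      then have "{a<..<a'} \<inter> U = {}" by blast
      then show "negligible ({a<..<a'} \<inter> U)" by simp
    qed
    ultimately show "integral E h \<le> 0" by simp
  qed
qed

section \<open>Chords of the exponential and the quantile function\<close>

lemma convex_on_exp_minus_affine:
  fixes a l u :: real
  shows "convex_on UNIV (\<lambda>y. exp y - a - l * (y - u))"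
proof -
  have "convex_on UNIV (\<lambda>y. exp y + (- a - l * (y - u)))"
  proof (rule convex_on_add[OF exp_convex])
    show "convex_on UNIV (\<lambda>y. - a - l * (y - u))"
      by (rule convex_onI) (auto simp: algebra_simps)
  qed
  moreover have "(\<lambda>y. exp y + (- a - l * (y - u))) = (\<lambda>y. exp y - a - l * (y - u))" by auto
  ultimately show ?thesis by simp
qed

lemma convex_between_zeros_nonpos:
  fixes \<theta> :: "real \<Rightarrow> real"
  assumes "convex_on UNIV \<theta>" "\<theta> u = 0" "\<theta> w = 0" "u \<le> y" "y \<le> w" shows "\<theta> y \<le> 0"
proof (cases "u = w")
  case False
  define t where "t = (y - u) / (w - u)"
  have "t * (w - u) = y - u" using False by (simp add: t_def)
  then have "(1 - t) *\<^sub>R u + t *\<^sub>R w = y" by (simp add: algebra_simps)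
  moreover have "0 \<le> t" "t \<le> 1" using assms False by (auto simp: t_def)
  ultimately have t: "0 \<le> t" "t \<le> 1" "(1 - t) *\<^sub>R u + t *\<^sub>R w = y" by auto
  from convex_onD[OF assms(1) t(1,2), of u w] t(3) assms show ?thesis by simp
qed (use assms in auto)

lemma convex_outside_zeros_nonneg:
  fixes \<theta> :: "real \<Rightarrow> real"
  assumes "convex_on UNIV \<theta>" "\<theta> u = 0" "\<theta> w = 0" "(y \<le> u \<and> u < w) \<or> (w < u \<and> u \<le> y)" shows "\<theta> y \<ge> 0"
proof -
  define t where "t = (u - y) / (w - y)"
  have t: "0 \<le> t" "t < 1" "(1 - t) *\<^sub>R y + t *\<^sub>R w = u"
    using assms(4) by (auto simp: t_def field_simps)
  from convex_onD[OF assms(1) t(1), of y w] t assms have "0 \<le> (1 - t) * \<theta> y" by simp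
  then show ?thesis using t by (simp add: zero_le_mult_iff)
qed

lemma abs_integrable_comp:
  fixes \<phi> h :: "real \<Rightarrow> real"
  assumes \<phi>: "\<phi> absolutely_integrable_on {a..b}" and bd: "\<And>x. x \<in> {a..b} \<Longrightarrow> \<bar>\<phi> x\<bar> \<le> M" and h: "continuous_on UNIV h"
  shows "(\<lambda>x. h (\<phi> x)) absolutely_integrable_on {a..b}"
proof -
  have "compact (h ` {-M..M})"
    by (intro compact_continuous_image continuous_on_subset[OF h]) auto
  then obtain B where B: "\<And>y. y \<in> {-M..M} \<Longrightarrow> \<bar>h y\<bar> \<le> B"
    by (metis bounded_iff compact_imp_bounded image_eqI real_norm_def)
  have hm: "h \<in> borel_measurable borel"
    using assms by (auto intro: borel_measurable_continuous_onI)
  have "\<phi> \<in> borel_measurable (lebesgue_on {a..b})"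
    using absolutely_integrable_measurable[of "{a..b}" \<phi>] \<phi> by auto
  from measurable_compose[OF this hm] show ?thesis
  proof (rule measurable_bounded_by_integrable_imp_absolutely_integrable[where g="\<lambda>_. B"])
    show "norm (h (\<phi> x)) \<le> B" if "x \<in> {a..b}" for x
      using B[of "\<phi> x"] bd[OF that] by (auto simp: abs_le_iff)
  qed auto
qed

text \<open>\<open>I\<close> is the generalized inverse of the distribution function of
  \<open>\<phi>\<close> under the uniform measure on \<open>{a..b}\<close>; it carries Lebesgue
  measure on the unit interval to the law of \<open>\<phi>\<close>.\<close>

lemma quantile_exists:
  fixes \<phi> :: "real \<Rightarrow> real"
  assumes ab: "a < b" and \<phi>: "\<phi> absolutely_integrable_on {a..b}" and bd: "\<And>x. x \<in> {a..b} \<Longrightarrow> \<bar>\<phi> x\<bar> \<le> M"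
  obtains I :: "real \<Rightarrow> real" where "mono I" "\<And>x. \<bar>I x\<bar> \<le> M"
    "\<And>h :: real \<Rightarrow> real. continuous_on UNIV h \<Longrightarrow> integral {0..1} (\<lambda>t. h (I t)) = integral {a..b} (\<lambda>x. h (\<phi> x)) / (b - a)"
proof -
  define f where "f x = (if x \<in> {a..b} then \<phi> x else 0)" for x
  have M: "M \<ge> 0" using bd[of a] ab by auto
  have fbd: "\<bar>f x\<bar> \<le> M" for x using bd M by (auto simp: f_def)
  have [measurable]: "f \<in> borel_measurable lebesgue"
    using absolutely_integrable_measurable[of "{a..b}" \<phi>] \<phi> unfolding f_def[abs_def]
    by (subst borel_measurable_if) auto
  define N where "N = uniform_measure lebesgue {a..b}"
  have ne: "emeasure lebesgue {a..b} = ennreal (b - a)" using ab by simp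
  interpret N: prob_space N
    unfolding N_def by (rule prob_space_uniform_measure) (use ab in \<open>auto simp: ne\<close>)
  have sN[simp]: "sets N = sets lebesgue" by (simp add: N_def)
  have [measurable]: "f \<in> borel_measurable N" by (simp cong: measurable_cong_sets)
  define \<mu> where "\<mu> = distr N borel f"
  have "real_distribution \<mu>" unfolding \<mu>_def by (rule N.real_distribution_distr) simp
  then interpret cdf_distribution \<mu> unfolding cdf_distribution_def .
  define Q where "Q t = Inf {x. t \<le> cdf \<mu> x}" for t
  have Qiff: "t \<le> cdf \<mu> x \<longleftrightarrow> Q t \<le> x" if "0 < t" "t < 1" for t x
    unfolding Q_def by (rule pseudoinverse) (use that in auto)
  have cdfM: "cdf \<mu> M = 1"
  proof -
    have "cdf \<mu> M = measure N (f -` {..M} \<inter> space N)"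
      unfolding cdf_def \<mu>_def by (subst measure_distr) auto
    also have "f -` {..M} \<inter> space N = space N" using fbd by (auto simp: abs_le_iff)
    finally show ?thesis by (simp add: N.prob_space)
  qed
  have cdfm: "cdf \<mu> x = 0" if "x < - M" for x
  proof -
    have "cdf \<mu> x = measure N (f -` {..x} \<inter> space N)"
      unfolding cdf_def \<mu>_def by (subst measure_distr) auto
    also have "f -` {..x} \<inter> space N = {}"
    proof -
      have "\<not> f y \<le> x" for y using fbd[of y] that by auto
      then show ?thesis by auto
    qed
    finally show ?thesis by simp
  qed
  have Qbd: "- M \<le> Q t" "Q t \<le> M" if t: "0 < t" "t < 1" for t
  proof -
    show "Q t \<le> M" using Qiff[OF t, of M] cdfM t by simp
    show "- M \<le> Q t"
    proof (rule ccontr)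
      assume "\<not> - M \<le> Q t"
      then show False using Qiff[OF t, of "Q t"] cdfm[of "Q t"] t by simp
    qed
  qed
  have Qmono: "Q s \<le> Q t" if "0 < s" "s \<le> t" "t < 1" for s t
    using Qiff[of s "Q t"] Qiff[of t "Q t"] that by auto
  \<comment> \<open>The values \<open>- M\<close> and \<open>M\<close> outside the open unit
    interval make \<open>I\<close> monotone and bounded on the whole line without affecting
    integrals over \<open>{0..1}\<close>.\<close>
  define I where "I t = (if t \<le> 0 then - M else if t \<ge> 1 then M else Q t)" for t
  have mI: "mono I"
  proof (rule monoI)
    fix s t :: real assume st: "s \<le> t"
    consider "s \<le> 0" "t \<le> 0" | "s \<le> 0" "0 < t" "t < 1" | "s \<le> 0" "1 \<le> t" | "0 < s" "t < 1" | "0 < s" "s < 1" "1 \<le> t" | "1 \<le> s"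
      using st by linarith
    then show "I s \<le> I t"
    proof cases
      case 4
      then show ?thesis using Qmono[of s t] st by (simp add: I_def)
    qed (use M st Qbd[of s] Qbd[of t] in \<open>simp_all add: I_def\<close>)
  qed
  have Ibd: "\<bar>I t\<bar> \<le> M" for t using Qbd[of t] M by (auto simp: I_def abs_le_iff)
  show ?thesis
  proof (rule that[OF mI Ibd])
    fix h :: "real \<Rightarrow> real" assume h: "continuous_on UNIV h"
    have [measurable]: "h \<in> borel_measurable borel" using h by (rule borel_measurable_continuous_onI)
    have [measurable]: "I \<in> borel_measurable borel" using mI by (rule borel_measurable_mono)
    have "compact (h ` {-M..M})"
      by (intro compact_continuous_image continuous_on_subset[OF h]) auto
    then obtain B where B: "\<And>y. y \<in> {-M..M} \<Longrightarrow> \<bar>h y\<bar> \<le> B"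
      by (metis bounded_iff compact_imp_bounded image_eqI real_norm_def)
    have law: "distr (restrict_space lborel {0<..<1::real}) borel Q = \<mu>"
      using distr_I_eq_M unfolding Q_def[abs_def] .
    have [measurable]: "Q \<in> borel_measurable (restrict_space borel {0<..<1})"
      using measurable_CI unfolding Q_def[abs_def] .
    have "integral\<^sup>L \<mu> h = integral\<^sup>L (restrict_space lborel {0<..<1}) (\<lambda>t. h (Q t))"
      unfolding law[symmetric] by (subst integral_distr) auto
    also have "\<dots> = (LINT t:{0<..<1}|lborel. h (I t))"
      unfolding set_lebesgue_integral_def
      by (subst integral_restrict_space) (auto intro!: Bochner_Integration.integral_cong simp: I_def indicator_def)
    also have "\<dots> = integral {0<..<1} (\<lambda>t. h (I t))"
    proof (rule set_borel_integral_eq_integral)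
      show "set_integrable lborel {0<..<1} (\<lambda>t. h (I t))"
        unfolding set_integrable_def
      proof (rule Bochner_Integration.integrable_bound[where f="\<lambda>t. indicator {0<..<1} t * B"])
        show "AE x in lborel. norm (indicator {0<..<1} x *\<^sub>R h (I x)) \<le> norm (indicator {0<..<1} x * B :: real)"
        proof (rule AE_I2)
          fix x
          have "I x \<in> {-M..M}" using Ibd[of x] by auto
          then have "\<bar>h (I x)\<bar> \<le> \<bar>B\<bar>" using B by fastforce
          then show "norm (indicator {0<..<1} x *\<^sub>R h (I x)) \<le> norm (indicator {0<..<1} x * B :: real)"
            by (simp add: indicator_def)
        qed
      qed auto
    qed
    also have "\<dots> = integral {0..1} (\<lambda>t. h (I t))" using integral_open_interval_real[of 0 1 "\<lambda>t. h (I t)"] by simp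
    finally have 1: "integral\<^sup>L \<mu> h = integral {0..1} (\<lambda>t. h (I t))" .
    have "integral\<^sup>L \<mu> h = integral\<^sup>L N (\<lambda>x. h (f x))"
      unfolding \<mu>_def by (subst integral_distr) auto
    also have "\<dots> = integral\<^sup>L lebesgue (\<lambda>x. (indicator {a..b} x / (b - a)) *\<^sub>R h (f x))"
    proof -
      have "N = density lebesgue (\<lambda>x. ennreal (indicator {a..b} x / (b - a)))"
        unfolding N_def uniform_measure_def ne using ab
          divide_ennreal[of 1 "b - a"]
        by (intro arg_cong[where f="density lebesgue"] ext) (auto simp: indicator_def)
      moreover have "(\<lambda>x. indicator {a..b} x / (b - a) :: real) \<in> borel_measurable lebesgue"
        by (intro borel_measurable_divide borel_measurable_indicator borel_measurable_const) simp
      moreover have "(\<lambda>x. h (f x)) \<in> borel_measurable lebesgue" by measurable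
      ultimately show ?thesis using ab by (simp only:) (rule integral_density, auto)
    qed
    also have "\<dots> = (LINT x:{a..b}|lebesgue. h (\<phi> x)) / (b - a)"
      unfolding set_lebesgue_integral_def
      integral_divide_zero[symmetric]
      by (intro Bochner_Integration.integral_cong) (auto simp: f_def indicator_def)
    also have "(LINT x:{a..b}|lebesgue. h (\<phi> x)) = integral {a..b} (\<lambda>x. h (\<phi> x))"
      by (rule set_lebesgue_integral_eq_integral(2)[OF abs_integrable_comp[of a b \<phi> M h]]) (use \<phi> bd h in auto)
    finally show "integral {0..1} (\<lambda>t. h (I t)) = integral {a..b} (\<lambda>x. h (\<phi> x)) / (b - a)" using 1 by simp
  qed
qed

text \<open>Clipping at \<open>c\<close> removes the part of \<open>\<phi>\<close> beyond \<open>c\<close>, seen from \<open>\<alpha>\<close>; the chord function of the exponential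
  through \<open>\<alpha>\<close> and \<open>c\<close> is nonpositive outside the rising sun set, so its integral is controlled by
  the intervals on which \<open>\<phi>\<close> has average \<open>\<alpha>\<close>.\<close>

lemma clipped_chord_integral_le:
  fixes \<phi> :: "real \<Rightarrow> real" and \<sigma> \<alpha> c :: real
  assumes ab: "a < b" and \<phi>: "\<phi> absolutely_integrable_on {a..b}" and bd: "\<And>x. x \<in> {a..b} \<Longrightarrow> \<bar>\<phi> x\<bar> \<le> M"
    and C: "C \<ge> 1"
    and A: "\<And>c d. a \<le> c \<Longrightarrow> c < d \<Longrightarrow> d \<le> b \<Longrightarrow>
      integral {c..d} (\<lambda>x. exp (\<phi> x)) \<le> C * (d - c) * exp (integral {c..d} \<phi> / (d - c))"
    and \<sigma>: "\<sigma> = 1 \<or> \<sigma> = -1" "\<sigma> * (\<alpha> - c) > 0"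
    and le0: "integral {a..b} (\<lambda>x. \<sigma> * (\<phi> x - \<alpha>)) \<le> 0"
  defines "\<theta> \<equiv> \<lambda>y. exp y - exp \<alpha> - (exp c - exp \<alpha>) / (c - \<alpha>) * (y - \<alpha>)"
    and "clip \<equiv> \<lambda>y. c + \<sigma> * max (\<sigma> * (y - c)) 0"
  shows "integral {a..b} (\<lambda>x. \<theta> (clip (\<phi> x)))
     \<le> (C - 1) * exp \<alpha> * (integral {a..b} (\<lambda>x. max (\<sigma> * (\<phi> x - c)) 0) / (\<sigma> * (\<alpha> - c)))"
proof -
  have comp: "(\<lambda>x. h (\<phi> x)) absolutely_integrable_on {a..b}" if "continuous_on UNIV h" for h :: "real \<Rightarrow> real"
    using abs_integrable_comp[of a b \<phi> M h] \<phi> bd that by blast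
  have ce: "continuous_on UNIV (exp :: real \<Rightarrow> real)" by (intro continuous_intros)
  have ne: "\<alpha> \<noteq> c" using \<sigma> by auto
  have th: "\<theta> \<alpha> = 0" "\<theta> c = 0" using ne by (auto simp: \<theta>_def)
  have th3: "convex_on UNIV \<theta>" unfolding \<theta>_def by (rule convex_on_exp_minus_affine)
  have cth: "continuous_on UNIV \<theta>" unfolding \<theta>_def by (intro continuous_intros) (use ne in auto)
  have ccl: "continuous_on UNIV clip" unfolding clip_def by (intro continuous_intros)
  have cthcl: "continuous_on UNIV (\<lambda>y. \<theta> (clip y))"
    by (rule continuous_on_compose2[OF cth ccl]) auto
  have g: "(\<lambda>x. \<sigma> * (\<phi> x - \<alpha>)) absolutely_integrable_on {a..b}"
    by (rule comp[of "\<lambda>y. \<sigma> * (y - \<alpha>)"]) (auto intro!: continuous_intros)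
  obtain E N where E: "E \<in> sets lebesgue" "E \<subseteq> {a..b}" "negligible N"
    "\<And>x. x \<in> {a..b} \<Longrightarrow> x \<notin> E \<Longrightarrow> x \<notin> N \<Longrightarrow> \<sigma> * (\<phi> x - \<alpha>) \<le> 0"
    and Eh: "\<And>h :: real \<Rightarrow> real. h absolutely_integrable_on {a..b} \<Longrightarrow>
       (\<And>c d. a \<le> c \<Longrightarrow> c < d \<Longrightarrow> d \<le> b \<Longrightarrow> integral {c..d} (\<lambda>x. \<sigma> * (\<phi> x - \<alpha>)) = 0 \<Longrightarrow> integral {c..d} h \<le> 0) \<Longrightarrow>
       integral E h \<le> 0"
    using rising_sun[OF ab g le0] by blast
  have int: "(\<lambda>x. h (\<phi> x)) integrable_on S" if "continuous_on UNIV h" "S \<in> sets lebesgue" "S \<subseteq> {a..b}" for h :: "real \<Rightarrow> real" and S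
    by (rule set_lebesgue_integral_eq_integral(1)[OF set_integrable_subset[OF comp[OF that(1)] that(2,3)]])
  have Ec: "{a..b} - E \<in> sets lebesgue" using E(1) by (intro sets.Diff) auto
  note intE = int[OF _ E(1,2)]
  have intE1: "(\<lambda>x. 1::real) integrable_on E" using intE[of "\<lambda>x. 1"] by (simp add: continuous_on_const)
  define e where "e = integral E (\<lambda>x. 1::real)"
  have intEphi: "\<phi> integrable_on E" using intE[of "\<lambda>x. x"] by simp
  have cE: "integral E (\<lambda>x. k) = k * e" for k :: real
    using integral_mult_right[of E k "\<lambda>_. 1"] by (simp add: e_def)
  \<comment> \<open>The rising sun conclusion applies to the test function and to its negative, so
    the average over \<open>E\<close> is exactly \<open>\<alpha>\<close>.\<close>
  have eq\<alpha>: "integral E \<phi> = \<alpha> * e"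
  proof -
    have "integral E (\<lambda>x. \<sigma> * (\<phi> x - \<alpha>)) \<le> 0" by (rule Eh[OF g]) auto
    moreover have "integral E (\<lambda>x. - (\<sigma> * (\<phi> x - \<alpha>))) \<le> 0"
    proof (rule Eh)
      show "(\<lambda>x. - (\<sigma> * (\<phi> x - \<alpha>))) absolutely_integrable_on {a..b}"
        by (rule comp[of "\<lambda>y. - (\<sigma> * (y - \<alpha>))"]) (auto intro!: continuous_intros)
    qed auto
    ultimately have "\<sigma> * integral E (\<lambda>x. \<phi> x - \<alpha>) = 0" by simp
    moreover have "integral E (\<lambda>x. \<phi> x - \<alpha>) = integral E \<phi> - \<alpha> * e"
      using intEphi integrable_on_cmult_left[OF intE1, of \<alpha>] by (subst Henstock_Kurzweil_Integration.integral_diff) (auto simp: cE)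
    ultimately show ?thesis using \<sigma> by auto
  qed
  have expE: "integral E (\<lambda>x. exp (\<phi> x)) \<le> C * exp \<alpha> * e"
  proof -
    have "integral E (\<lambda>x. exp (\<phi> x) - C * exp \<alpha>) \<le> 0"
    proof (rule Eh)
      show "(\<lambda>x. exp (\<phi> x) - C * exp \<alpha>) absolutely_integrable_on {a..b}"
        by (rule comp[of "\<lambda>y. exp y - C * exp \<alpha>"]) (auto intro!: continuous_intros)
      fix c d assume cd: "a \<le> c" "c < d" "d \<le> b" "integral {c..d} (\<lambda>x. \<sigma> * (\<phi> x - \<alpha>)) = 0"
      have i: "(\<lambda>x. h (\<phi> x)) integrable_on {c..d}" if "continuous_on UNIV h" for h :: "real \<Rightarrow> real"
        by (rule int[OF that]) (use cd in auto)
      have "\<sigma> * integral {c..d} (\<lambda>x. \<phi> x - \<alpha>) = 0" using cd by simp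
      moreover have "integral {c..d} (\<lambda>x. \<phi> x - \<alpha>) = integral {c..d} \<phi> - \<alpha> * (d - c)"
        using i[of "\<lambda>x. x"] cd by (subst Henstock_Kurzweil_Integration.integral_diff) auto
      ultimately have "integral {c..d} \<phi> / (d - c) = \<alpha>" using \<sigma> cd by (auto simp: field_simps)
      with A[OF cd(1-3)] have "integral {c..d} (\<lambda>x. exp (\<phi> x)) \<le> C * (d - c) * exp \<alpha>" by simp
      moreover have "integral {c..d} (\<lambda>x. exp (\<phi> x) - C * exp \<alpha>) = integral {c..d} (\<lambda>x. exp (\<phi> x)) - C * exp \<alpha> * (d - c)"
        using i[OF ce] cd by (subst Henstock_Kurzweil_Integration.integral_diff) (auto intro!: continuous_intros)
      ultimately show "integral {c..d} (\<lambda>x. exp (\<phi> x) - C * exp \<alpha>) \<le> 0" by (simp add: mult_ac)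
    qed
    moreover have "integral E (\<lambda>x. exp (\<phi> x) - C * exp \<alpha>) = integral E (\<lambda>x. exp (\<phi> x)) - C * exp \<alpha> * e"
      using intE[OF ce] integrable_on_cmult_left[OF intE1, of "C * exp \<alpha>"]
      by (subst Henstock_Kurzweil_Integration.integral_diff) (auto simp: cE intro!: continuous_intros)
    ultimately show ?thesis by simp
  qed
  \<comment> \<open>A Chebyshev estimate: on \<open>E\<close> the function
    \<open>\<sigma> * (\<phi> x - c)\<close> has average \<open>\<sigma> * (\<alpha> - c)\<close>,
    and it is dominated by its positive part, whose integral only grows when \<open>E\<close> is
    enlarged to \<open>{a..b}\<close>.\<close>
  have e_le: "e \<le> integral {a..b} (\<lambda>x. max (\<sigma> * (\<phi> x - c)) 0) / (\<sigma> * (\<alpha> - c))"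
  proof -
    have c1: "continuous_on UNIV (\<lambda>y. max (\<sigma> * (y - c)) 0)" by (intro continuous_intros)
    have "\<sigma> * (\<alpha> - c) * e = integral E (\<lambda>x. \<sigma> * (\<phi> x - c))"
      using intEphi integrable_on_cmult_left[OF intE1, of c]
      by (simp, subst Henstock_Kurzweil_Integration.integral_diff) (auto simp: cE eq\<alpha> algebra_simps)
    also have "\<dots> \<le> integral E (\<lambda>x. max (\<sigma> * (\<phi> x - c)) 0)"
      by (intro integral_le intE[OF c1] intE[of "\<lambda>y. \<sigma> * (y - c)"] continuous_intros) auto
    also have "\<dots> \<le> integral {a..b} (\<lambda>x. max (\<sigma> * (\<phi> x - c)) 0)"
      by (intro integral_subset_le E intE[OF c1] int[OF c1]) auto
    finally show ?thesis using \<sigma>(2) by (simp add: field_simps)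
  qed
  have cl_between: "\<theta> (clip y) \<le> 0" if "\<sigma> * (y - \<alpha>) \<le> 0" for y
  proof -
    have "(c \<le> clip y \<and> clip y \<le> \<alpha>) \<or> (\<alpha> \<le> clip y \<and> clip y \<le> c)"
      using that \<sigma> by (auto simp: clip_def max_def)
    then show ?thesis using convex_between_zeros_nonpos[OF th3] th by blast
  qed
  \<comment> \<open>Clipping moves a value to the zero \<open>c\<close> of \<open>\<theta>\<close>
    from the side facing away from \<open>\<alpha>\<close>, where convexity makes
    \<open>\<theta>\<close> nonnegative.\<close>
  have cl_le: "\<theta> (clip y) \<le> \<theta> y" for y
  proof (cases "\<sigma> * (y - c) \<ge> 0")
    case True
    then have "clip y = y" using \<sigma> by (auto simp: clip_def max_def)
    then show ?thesis by simp
  next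
    case False
    then have "clip y = c" "(y \<le> c \<and> c < \<alpha>) \<or> (\<alpha> < c \<and> c \<le> y)" using \<sigma> by (auto simp: clip_def max_def)
    then show ?thesis using convex_outside_zeros_nonneg[OF th3 th(2,1)] th by auto
  qed
  have "integral {a..b} (\<lambda>x. \<theta> (clip (\<phi> x))) = integral E (\<lambda>x. \<theta> (clip (\<phi> x))) + integral ({a..b} - E) (\<lambda>x. \<theta> (clip (\<phi> x)))"
  proof -
    have "{a..b} = E \<union> ({a..b} - E)" using E by auto
    then show ?thesis
      using Ec Henstock_Kurzweil_Integration.integral_Un[of "\<lambda>x. \<theta> (clip (\<phi> x))" E "{a..b} - E"] intE[OF cthcl] int[OF cthcl, of "{a..b} - E"] E by auto
  qed
  also have "integral ({a..b} - E) (\<lambda>x. \<theta> (clip (\<phi> x))) \<le> 0"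
  proof -
    have "integral ({a..b} - E) (\<lambda>x. \<theta> (clip (\<phi> x))) = integral ({a..b} - E) (\<lambda>x. if x \<in> N then 0 else \<theta> (clip (\<phi> x)))"
      by (rule integral_spike[OF E(3)]) auto
    also have "\<dots> \<le> integral ({a..b} - E) (\<lambda>x. 0)"
    proof (rule integral_le)
      show "(\<lambda>x. if x \<in> N then 0 else \<theta> (clip (\<phi> x))) integrable_on {a..b} - E"
        by (rule integrable_spike[OF int[OF cthcl Ec] E(3)]) auto
    qed (use cl_between E in \<open>auto intro: integrable_0\<close>)
    finally show ?thesis by simp
  qed
  also have "integral E (\<lambda>x. \<theta> (clip (\<phi> x))) \<le> integral E (\<lambda>x. \<theta> (\<phi> x))"
    by (intro integral_le intE cth cthcl cl_le)
  also have "integral E (\<lambda>x. \<theta> (\<phi> x)) = integral E (\<lambda>x. exp (\<phi> x)) - exp \<alpha> * e"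
  proof (rule integral_unique)
    define l where "l = (exp c - exp \<alpha>) / (c - \<alpha>)"
    have cst: "((\<lambda>x. k) has_integral k * e) E" for k
      using integrable_integral[OF integrable_on_cmult_left[OF intE1, of k]] by (simp add: cE)
    have "((\<lambda>x. exp (\<phi> x) - exp \<alpha> - l * (\<phi> x - \<alpha>)) has_integral integral E (\<lambda>x. exp (\<phi> x)) - exp \<alpha> * e - l * (\<alpha> * e - \<alpha> * e)) E"
    proof (intro has_integral_diff has_integral_mult_right cst)
      show "((\<lambda>x. exp (\<phi> x)) has_integral integral E (\<lambda>x. exp (\<phi> x))) E" by (intro integrable_integral intE continuous_intros)
      show "(\<phi> has_integral \<alpha> * e) E" using integrable_integral[OF intEphi] by (simp add: eq\<alpha>)
    qed
    then show "((\<lambda>x. \<theta> (\<phi> x)) has_integral integral E (\<lambda>x. exp (\<phi> x)) - exp \<alpha> * e) E"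
      by (simp add: \<theta>_def l_def)
  qed
  also have "integral E (\<lambda>x. exp (\<phi> x)) - exp \<alpha> * e \<le> (C - 1) * exp \<alpha> * e"
    using expE by (simp add: algebra_simps)
  finally have "integral {a..b} (\<lambda>x. \<theta> (clip (\<phi> x))) \<le> (C - 1) * exp \<alpha> * e" by simp
  also have "\<dots> \<le> (C - 1) * exp \<alpha> * (integral {a..b} (\<lambda>x. max (\<sigma> * (\<phi> x - c)) 0) / (\<sigma> * (\<alpha> - c)))"
    using C e_le by (intro mult_left_mono) auto
  finally show ?thesis .
qed

section \<open>Transfer of the constant to the monotone rearrangement\<close>

text \<open>Clipping \<open>I\<close> at \<open>c\<close> keeps it on \<open>{l..r}\<close> and
  sends it to the zero \<open>c\<close> of \<open>\<theta>\<close> elsewhere, so the integral of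
  \<open>\<theta>\<close> of the clipped profile is that of \<open>exp (I t) - exp \<alpha>\<close>
  over \<open>{l..r}\<close>: the linear part cancels because \<open>\<alpha>\<close> is the average
  there. Equality of laws turns this into an integral of \<open>\<phi>\<close>, for which
  \<open>clipped_chord_integral_le\<close> gives the bound. The sign \<open>\<sigma>\<close> treats
  final and initial intervals at once.\<close>

lemma rearrangement_piece:
  fixes \<phi> I :: "real \<Rightarrow> real"
  assumes ab: "a < b" and \<phi>: "\<phi> absolutely_integrable_on {a..b}" and bd: "\<And>x. x \<in> {a..b} \<Longrightarrow> \<bar>\<phi> x\<bar> \<le> M"
    and C: "C \<ge> 1"
    and A: "\<And>c d. a \<le> c \<Longrightarrow> c < d \<Longrightarrow> d \<le> b \<Longrightarrow>
      integral {c..d} (\<lambda>x. exp (\<phi> x)) \<le> C * (d - c) * exp (integral {c..d} \<phi> / (d - c))"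
    and I: "mono I" "\<And>x. \<bar>I x\<bar> \<le> M"
    and law: "\<And>h :: real \<Rightarrow> real. continuous_on UNIV h \<Longrightarrow> integral {0..1} (\<lambda>t. h (I t)) = integral {a..b} (\<lambda>x. h (\<phi> x)) / (b - a)"
    and lr: "0 \<le> l" "l < r" "r \<le> 1" and \<sigma>: "\<sigma> = 1 \<or> \<sigma> = -1"
    and ins: "\<And>t. t \<in> {l..r} \<Longrightarrow> 0 \<le> \<sigma> * (I t - c)"
    and out: "\<And>t. t \<in> {0..1} - {l..r} \<Longrightarrow> \<sigma> * (I t - c) \<le> 0"
  shows "integral {l..r} (\<lambda>t. exp (I t)) / (r - l) \<le> C * exp (integral {l..r} I / (r - l))"
proof -
  define \<alpha> where "\<alpha> = integral {l..r} I / (r - l)"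
  have ii: "(\<lambda>t. h (I t)) integrable_on {x..y}" if "continuous_on UNIV h" for h :: "real \<Rightarrow> real" and x y
    by (rule integrable_comp_mono[OF I that])
  have Ii: "I integrable_on {x..y}" for x y using ii[of "\<lambda>x. x"] by simp
  have Int: "integral {l..r} I = (r - l) * \<alpha>" using lr by (simp add: \<alpha>_def)
  have const: "((\<lambda>t. k) has_integral (r - l) * k) {l..r}" for k :: real
    using has_integral_const_real[of k l r] lr by simp
  have hasI: "(I has_integral (r - l) * \<alpha>) {l..r}" using integrable_integral[OF Ii, of l r] by (simp add: Int)
  have hasE: "((\<lambda>t. exp (I t)) has_integral integral {l..r} (\<lambda>t. exp (I t))) {l..r}"
    by (intro integrable_integral ii continuous_intros)
  have affine: "integral {l..r} (\<lambda>t. \<sigma> * (I t - k)) = (r - l) * (\<sigma> * (\<alpha> - k))" for k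
  proof -
    have "((\<lambda>t. \<sigma> * (I t - k)) has_integral \<sigma> * ((r - l) * \<alpha> - (r - l) * k)) {l..r}"
      by (intro has_integral_mult_right has_integral_diff hasI const)
    from integral_unique[OF this] show ?thesis by (simp only:) (simp add: algebra_simps)
  qed
  have ge: "0 \<le> \<sigma> * (\<alpha> - c)"
  proof -
    have "0 \<le> integral {l..r} (\<lambda>t. \<sigma> * (I t - c))"
      using ins by (intro integral_nonneg ii[of "\<lambda>y. \<sigma> * (y - c)"] continuous_intros) auto
    then have "0 \<le> (r - l) * (\<sigma> * (\<alpha> - c))" unfolding affine .
    then show ?thesis using lr by (auto simp: zero_le_mult_iff)
  qed
  have restr: "integral {0..1} (\<lambda>t. if t \<in> {l..r} then f t else 0) = integral {l..r} f" for f :: "real \<Rightarrow> real"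
    using lr by (subst integral_restrict_Int) (simp add: Int_absorb1)
  have main: "integral {l..r} (\<lambda>t. exp (I t)) \<le> C * exp \<alpha> * (r - l)"
  proof (cases "\<alpha> = c")
    \<comment> \<open>The chord degenerates. But then the nonnegative function
      \<open>\<sigma> * (I t - c)\<close> has integral 0 on \<open>{l..r}\<close>, and a multiple of
      it dominates \<open>exp (I t) - exp c\<close>.\<close>
    case True
    have "exp y - exp c \<le> exp M * (\<sigma> * (y - c))" if y: "\<bar>y\<bar> \<le> M" "0 \<le> \<sigma> * (y - c)" for y
    proof -
      have "exp c = exp y * exp (c - y)" by (simp flip: exp_add)
      also have "\<dots> \<ge> exp y * (1 + (c - y))" by (intro mult_left_mono exp_ge_add_one_self) auto
      finally have "exp y - exp c \<le> exp y * (y - c)" by (simp add: algebra_simps)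
      also have "\<dots> \<le> exp y * (\<sigma> * (y - c))" using \<sigma> y(2) by (intro mult_left_mono) auto
      also have "\<dots> \<le> exp M * (\<sigma> * (y - c))" using y by (intro mult_right_mono) auto
      finally show ?thesis .
    qed
    then have "integral {l..r} (\<lambda>t. exp (I t) - exp c) \<le> integral {l..r} (\<lambda>t. exp M * (\<sigma> * (I t - c)))"
      using ins I by (intro integral_le ii[of "\<lambda>y. exp y - exp c"] ii[of "\<lambda>y. exp M * (\<sigma> * (y - c))"] continuous_intros) auto
    also have "\<dots> = 0" using affine[of c] True by (simp add: integral_mult_right)
    also have "integral {l..r} (\<lambda>t. exp (I t) - exp c) = integral {l..r} (\<lambda>t. exp (I t)) - (r - l) * exp c"
      by (rule integral_unique) (intro has_integral_diff hasE const)
    finally have "integral {l..r} (\<lambda>t. exp (I t)) \<le> 1 * (exp \<alpha> * (r - l))" using True by (simp add: mult.commute)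
    also have "\<dots> \<le> C * (exp \<alpha> * (r - l))" using C lr by (intro mult_right_mono) auto
    finally show ?thesis by (simp add: mult.assoc)
  next
    case False
    then have gt: "\<sigma> * (\<alpha> - c) > 0" using ge \<sigma> by (auto simp: less_le)
    have divE: "X / (b - a) = V \<Longrightarrow> X = (b - a) * V" and div0: "X / (b - a) \<le> 0 \<Longrightarrow> X \<le> 0" for X V :: real
      using ab by (auto simp: divide_le_0_iff)
    define sl where "sl = (exp c - exp \<alpha>) / (c - \<alpha>)"
    define \<theta> where "\<theta> = (\<lambda>y. exp y - exp \<alpha> - (exp c - exp \<alpha>) / (c - \<alpha>) * (y - \<alpha>))"
    define clip where "clip = (\<lambda>y. c + \<sigma> * max (\<sigma> * (y - c)) 0)"
    have thc: "\<theta> c = 0" using False by (simp add: \<theta>_def)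
    have cth: "continuous_on UNIV \<theta>" unfolding \<theta>_def by (intro continuous_intros) (use False in auto)
    have ccl: "continuous_on UNIV clip" unfolding clip_def by (intro continuous_intros)
    have cthcl: "continuous_on UNIV (\<lambda>y. \<theta> (clip y))"
      by (rule continuous_on_compose2[OF cth ccl]) auto
    have cm: "continuous_on UNIV (\<lambda>y. max (\<sigma> * (y - c)) 0)" by (intro continuous_intros)
    have ca: "continuous_on UNIV (\<lambda>y. \<sigma> * (y - \<alpha>))" by (intro continuous_intros)
    have clin: "clip (I t) = I t" if "t \<in> {l..r}" for t using ins[OF that] \<sigma> by (auto simp: clip_def)
    have clout: "clip (I t) = c" if "t \<in> {0..1} - {l..r}" for t using out[OF that] \<sigma> by (auto simp: clip_def max_def)
    have "integral {0..1} (\<lambda>t. \<theta> (clip (I t))) = integral {0..1} (\<lambda>t. if t \<in> {l..r} then \<theta> (I t) else 0)"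
      by (rule Henstock_Kurzweil_Integration.integral_cong) (use clin clout thc in auto)
    also have "\<dots> = integral {l..r} (\<lambda>t. \<theta> (I t))" by (rule restr)
    also have "\<dots> = integral {l..r} (\<lambda>t. exp (I t)) - (r - l) * exp \<alpha>"
    proof (rule integral_unique)
      have "((\<lambda>t. exp (I t) - exp \<alpha> - sl * (I t - \<alpha>)) has_integral integral {l..r} (\<lambda>t. exp (I t)) - (r - l) * exp \<alpha> - sl * ((r - l) * \<alpha> - (r - l) * \<alpha>)) {l..r}"
        by (intro has_integral_diff has_integral_mult_right hasI hasE const)
      then show "((\<lambda>t. \<theta> (I t)) has_integral integral {l..r} (\<lambda>t. exp (I t)) - (r - l) * exp \<alpha>) {l..r}"
        by (simp add: \<theta>_def sl_def)
    qed
    finally have "integral {a..b} (\<lambda>x. \<theta> (clip (\<phi> x))) / (b - a) = integral {l..r} (\<lambda>t. exp (I t)) - (r - l) * exp \<alpha>"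
      unfolding law[OF cthcl] .
    then have 1: "integral {a..b} (\<lambda>x. \<theta> (clip (\<phi> x))) = (b - a) * (integral {l..r} (\<lambda>t. exp (I t)) - (r - l) * exp \<alpha>)"
      by (rule divE)
    have "integral {0..1} (\<lambda>t. max (\<sigma> * (I t - c)) 0) = integral {0..1} (\<lambda>t. if t \<in> {l..r} then \<sigma> * (I t - c) else 0)"
    proof (rule Henstock_Kurzweil_Integration.integral_cong)
      fix t :: real assume t: "t \<in> {0..1}"
      show "max (\<sigma> * (I t - c)) 0 = (if t \<in> {l..r} then \<sigma> * (I t - c) else 0)"
      proof (cases "t \<in> {l..r}")
        case True
        then show ?thesis using ins[OF True] by (simp only: max_absorb1) simp
      next
        case False
        then show ?thesis using out[of t] t by (simp only: max_absorb2) simp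
      qed
    qed
    also have "\<dots> = (r - l) * (\<sigma> * (\<alpha> - c))" by (subst restr) (rule affine)
    finally have "integral {a..b} (\<lambda>x. max (\<sigma> * (\<phi> x - c)) 0) / (b - a) = (r - l) * (\<sigma> * (\<alpha> - c))"
      unfolding law[OF cm] .
    then have 2: "integral {a..b} (\<lambda>x. max (\<sigma> * (\<phi> x - c)) 0) = (b - a) * ((r - l) * (\<sigma> * (\<alpha> - c)))"
      by (rule divE)
    have "integral {0..1} (\<lambda>t. \<sigma> * (I t - \<alpha>)) \<le> integral {0..1} (\<lambda>t. if t \<in> {l..r} then \<sigma> * (I t - \<alpha>) else 0)"
    proof (rule integral_le)
      show "(\<lambda>t. if t \<in> {l..r} then \<sigma> * (I t - \<alpha>) else 0) integrable_on {0..1}"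
        using ii[OF ca, of l r] lr by (subst integrable_restrict_Int) (simp add: Int_absorb2)
      fix t :: real assume t: "t \<in> {0..1}"
      show "\<sigma> * (I t - \<alpha>) \<le> (if t \<in> {l..r} then \<sigma> * (I t - \<alpha>) else 0)"
      proof (cases "t \<in> {l..r}")
        case False
        have "\<sigma> * (I t - \<alpha>) = \<sigma> * (I t - c) - \<sigma> * (\<alpha> - c)" by (simp add: algebra_simps)
        also have "\<dots> \<le> 0" using out[of t] ge t False by simp
        finally show ?thesis using False by simp
      qed simp
    qed (rule ii[OF ca])
    also have "\<dots> = 0" by (subst restr, subst affine) simp
    finally have "integral {a..b} (\<lambda>x. \<sigma> * (\<phi> x - \<alpha>)) / (b - a) \<le> 0"
      unfolding law[OF ca] .
    then have 3: "integral {a..b} (\<lambda>x. \<sigma> * (\<phi> x - \<alpha>)) \<le> 0"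
      by (rule div0)
    have "integral {a..b} (\<lambda>x. \<theta> (clip (\<phi> x)))
     \<le> (C - 1) * exp \<alpha> * (integral {a..b} (\<lambda>x. max (\<sigma> * (\<phi> x - c)) 0) / (\<sigma> * (\<alpha> - c)))"
      unfolding \<theta>_def clip_def
      by (rule clipped_chord_integral_le[OF ab \<phi> bd C A \<sigma> gt 3]) auto
    then have "(b - a) * (integral {l..r} (\<lambda>t. exp (I t)) - (r - l) * exp \<alpha>) \<le> (C - 1) * exp \<alpha> * ((b - a) * (r - l))"
    proof -
      have "(b - a) * ((r - l) * (\<sigma> * (\<alpha> - c))) / (\<sigma> * (\<alpha> - c)) = (b - a) * (r - l)"
      proof -
        have "X * (Y * Z) / Z = X * Y" if "Z > 0" for X Y Z :: real using that by simp
        from this[OF gt] show ?thesis .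
      qed
      then show "integral {a..b} (\<lambda>x. \<theta> (clip (\<phi> x)))
     \<le> (C - 1) * exp \<alpha> * (integral {a..b} (\<lambda>x. max (\<sigma> * (\<phi> x - c)) 0) / (\<sigma> * (\<alpha> - c))) \<Longrightarrow> ?thesis"
        unfolding 1 2 by (simp only:)
    qed
    then have "(b - a) * (integral {l..r} (\<lambda>t. exp (I t)) - (r - l) * exp \<alpha>) \<le> (b - a) * ((C - 1) * exp \<alpha> * (r - l))"
      by (simp add: mult_ac)
    then have "integral {l..r} (\<lambda>t. exp (I t)) - (r - l) * exp \<alpha> \<le> (C - 1) * exp \<alpha> * (r - l)"
      using ab by (simp add: mult_le_cancel_left_pos)
    then show ?thesis by (simp add: algebra_simps)
  qed
  then show ?thesis using lr unfolding \<alpha>_def[symmetric] by (simp add: field_simps)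
qed

text \<open>By monotonicity the value \<open>I s\<close> separates the final interval from the
  initial one, so it serves as the cutting level for both, with opposite signs
  \<open>\<sigma>\<close>.\<close>

lemma A_infinity_rearrangement:
  fixes \<phi> :: "real \<Rightarrow> real"
  assumes ab: "a < b" and \<phi>: "\<phi> absolutely_integrable_on {a..b}" and bd: "\<And>x. x \<in> {a..b} \<Longrightarrow> \<bar>\<phi> x\<bar> \<le> M"
    and C: "C \<ge> 1"
    and A: "\<And>c d. a \<le> c \<Longrightarrow> c < d \<Longrightarrow> d \<le> b \<Longrightarrow>
      integral {c..d} (\<lambda>x. exp (\<phi> x)) \<le> C * (d - c) * exp (integral {c..d} \<phi> / (d - c))"
  shows "\<exists>I :: real \<Rightarrow> real. mono I \<and> (\<forall>x. \<bar>I x\<bar> \<le> M) \<and>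
    (\<forall>h :: real \<Rightarrow> real. continuous_on UNIV h \<longrightarrow>
      integral {0..1} (\<lambda>t. h (I t)) = integral {a..b} (\<lambda>x. h (\<phi> x)) / (b - a)) \<and>
    (\<forall>s. 0 \<le> s \<longrightarrow> s < 1 \<longrightarrow> integral {s..1} (\<lambda>t. exp (I t)) / (1 - s) \<le> C * exp (integral {s..1} I / (1 - s))) \<and>
    (\<forall>s. 0 < s \<longrightarrow> s \<le> 1 \<longrightarrow> integral {0..s} (\<lambda>t. exp (I t)) / s \<le> C * exp (integral {0..s} I / s))"
proof -
  obtain I :: "real \<Rightarrow> real" where I: "mono I" "\<And>x. \<bar>I x\<bar> \<le> M"
    and law: "\<And>h :: real \<Rightarrow> real. continuous_on UNIV h \<Longrightarrow> integral {0..1} (\<lambda>t. h (I t)) = integral {a..b} (\<lambda>x. h (\<phi> x)) / (b - a)"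
    using quantile_exists[OF ab \<phi> bd] by metis
  show ?thesis
  proof (intro exI[of _ I] conjI allI impI I law)
    fix s :: real
    assume s: "0 \<le> s" "s < 1"
    show "integral {s..1} (\<lambda>t. exp (I t)) / (1 - s) \<le> C * exp (integral {s..1} I / (1 - s))"
      by (rule rearrangement_piece[OF ab \<phi> bd C A I law, where c="I s" and \<sigma>=1]) (use s monoD[OF I(1)] in auto)
  next
    fix s :: real
    assume s: "0 < s" "s \<le> 1"
    show "integral {0..s} (\<lambda>t. exp (I t)) / s \<le> C * exp (integral {0..s} I / s)"
      using rearrangement_piece[OF ab \<phi> bd C A I law, where c="I s" and \<sigma>="-1" and l=0 and r=s] s monoD[OF I(1)] by force
  qed
qed

section \<open>Comparison of centered means and truncation\<close>

lemma convex_on_abs_powr: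
  fixes p :: real assumes p: "p \<ge> 1" shows "convex_on UNIV (\<lambda>x::real. \<bar>x\<bar> powr p)"
proof (rule convex_onI)
  fix t x y :: real assume t: "0 < t" "t < 1"
  have "\<bar>(1 - t) *\<^sub>R x + t *\<^sub>R y\<bar> \<le> (1 - t) *\<^sub>R \<bar>x\<bar> + t *\<^sub>R \<bar>y\<bar>"
    using t abs_triangle_ineq[of "(1 - t) * x" "t * y"] by (simp add: abs_mult)
  then have "\<bar>(1 - t) *\<^sub>R x + t *\<^sub>R y\<bar> powr p \<le> ((1 - t) *\<^sub>R \<bar>x\<bar> + t *\<^sub>R \<bar>y\<bar>) powr p"
    using p by (intro powr_mono2) auto
  also have "\<dots> \<le> (1 - t) * \<bar>x\<bar> powr p + t * \<bar>y\<bar> powr p"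
  proof (cases "x = 0 \<or> y = 0")
    case True
    have q: "q powr p \<le> q" if "0 < q" "q < 1" for q
      using powr_mono'[of 1 p q] that p by simp
    from True show ?thesis
    proof
      assume "x = 0"
      then show ?thesis using q[of t] t p by (simp add: powr_mult mult_right_mono)
    next
      assume "y = 0"
      then show ?thesis using q[of "1 - t"] t p by (simp add: powr_mult mult_right_mono)
    qed
  next
    case False
    then show ?thesis
      using convex_onD[OF powr_convex[OF p], of t "\<bar>x\<bar>" "\<bar>y\<bar>"] t by auto
  qed
  finally show "\<bar>(1 - t) *\<^sub>R x + t *\<^sub>R y\<bar> powr p \<le> (1 - t) * \<bar>x\<bar> powr p + t * \<bar>y\<bar> powr p" .
qed simp

text \<open>\<open>s\<close> is a subgradient at \<open>y\<close>. If \<open>b\<close> lies between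
  \<open>y\<close> and \<open>a\<close>, convexity makes the difference quotient from
  \<open>b\<close> to \<open>a\<close> at least \<open>s\<close> when moving right and at most
  \<open>s\<close> when moving left; in both cases the inequality results.\<close>

lemma abs_powr_slope:
  fixes p y :: real assumes p: "p \<ge> 1"
  obtains s where "\<And>a b. (y \<le> b \<and> b \<le> a) \<or> (a \<le> b \<and> b \<le> y) \<Longrightarrow> \<bar>b\<bar> powr p + s * (a - b) \<le> \<bar>a\<bar> powr p"
proof -
  note conv = convex_on_abs_powr[OF p]
  obtain s where s: "\<And>z. \<bar>y\<bar> powr p + s * (z - y) \<le> \<bar>z\<bar> powr p"
  proof (cases "y = 0")
    case True
    then show ?thesis using that[of 0] by simp
  next
    case False
    have "p * spow p y * (z - y) \<le> \<bar>z\<bar> powr p - \<bar>y\<bar> powr p" for z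
      by (rule convex_on_imp_above_tangent[OF conv]) (use DERIV_abs_powr[OF False, of p] in auto)
    then show ?thesis using that[of "p * spow p y"] by (smt (verit))
  qed
  have "\<bar>b\<bar> powr p + s * (a - b) \<le> \<bar>a\<bar> powr p" if ab: "(y \<le> b \<and> b \<le> a) \<or> (a \<le> b \<and> b \<le> y)" for a b
  proof (cases "a = y")
    case True
    then show ?thesis using ab by auto
  next
    case False
    define t where "t = (b - y) / (a - y)"
    have t: "0 \<le> t" "t \<le> 1" using ab False by (auto simp: t_def divide_simps)
    have tb: "t * (a - y) = b - y" using False by (simp add: t_def)
    then have b: "b = (1 - t) *\<^sub>R y + t *\<^sub>R a" by (simp add: algebra_simps)
    have "\<bar>b\<bar> powr p \<le> (1 - t) * \<bar>y\<bar> powr p + t * \<bar>a\<bar> powr p"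
      unfolding b by (rule convex_onD[OF conv t]) auto
    moreover have "(1 - t) * (\<bar>y\<bar> powr p + s * (a - y)) \<le> (1 - t) * \<bar>a\<bar> powr p"
      using t by (intro mult_left_mono s) auto
    moreover have "s * (a - b) = (1 - t) * (s * (a - y))"
    proof -
      have "a - b = (1 - t) * (a - y)" using tb by (simp add: algebra_simps)
      then show ?thesis by simp
    qed
    ultimately show ?thesis by (simp add: algebra_simps)
  qed
  then show ?thesis by (rule that)
qed

text \<open>A single subgradient slope \<open>s\<close> works at all points because of the single
  crossing level \<open>y\<close>, and the linear term \<open>s * (f x - g x)\<close> integrates to
  0. The nonnegative integrals admit an infinite right side.\<close>

lemma centered_power_comparison:
  fixes f g :: "'a \<Rightarrow> real"
  assumes p: "p \<ge> 1" and f: "integrable M f" and g: "integrable M g" and eq: "integral\<^sup>L M f = integral\<^sup>L M g"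
    and cross: "\<And>x. x \<in> space M \<Longrightarrow> (y \<le> g x \<and> g x \<le> f x) \<or> (f x \<le> g x \<and> g x \<le> y)"
  shows "(\<integral>\<^sup>+x. ennreal (\<bar>g x\<bar> powr p) \<partial>M) \<le> (\<integral>\<^sup>+x. ennreal (\<bar>f x\<bar> powr p) \<partial>M)"
proof (cases "(\<integral>\<^sup>+x. ennreal (\<bar>f x\<bar> powr p) \<partial>M) = \<infinity>")
  case False
  have [measurable]: "f \<in> borel_measurable M" "g \<in> borel_measurable M" using f g by auto
  obtain s where s: "\<And>a b. (y \<le> b \<and> b \<le> a) \<or> (a \<le> b \<and> b \<le> y) \<Longrightarrow> \<bar>b\<bar> powr p + s * (a - b) \<le> \<bar>a\<bar> powr p"
    using abs_powr_slope[OF p] by blast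
  have if_: "integrable M (\<lambda>x. \<bar>f x\<bar> powr p)"
    using False by (intro integrableI_nonneg) (auto simp: less_top)
  then have int: "integrable M (\<lambda>x. \<bar>f x\<bar> powr p - s * (f x - g x))" using f g by simp
  have le: "\<bar>g x\<bar> powr p \<le> \<bar>f x\<bar> powr p - s * (f x - g x)" if "x \<in> space M" for x
    using s[OF cross[OF that]] by simp
  have "(\<integral>\<^sup>+x. ennreal (\<bar>g x\<bar> powr p) \<partial>M) \<le> (\<integral>\<^sup>+x. ennreal (\<bar>f x\<bar> powr p - s * (f x - g x)) \<partial>M)"
    by (intro nn_integral_mono ennreal_leI le)
  also have "\<dots> = ennreal (integral\<^sup>L M (\<lambda>x. \<bar>f x\<bar> powr p - s * (f x - g x)))"
    by (intro nn_integral_eq_integral int AE_I2 order_trans[OF _ le]) auto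
  also have "integral\<^sup>L M (\<lambda>x. \<bar>f x\<bar> powr p - s * (f x - g x)) = integral\<^sup>L M (\<lambda>x. \<bar>f x\<bar> powr p)"
    using f g if_ eq by simp
  also have "ennreal \<dots> = (\<integral>\<^sup>+x. ennreal (\<bar>f x\<bar> powr p) \<partial>M)"
    by (intro nn_integral_eq_integral[symmetric] if_) auto
  finally show ?thesis .
qed (simp only: top_greatest infinity_ennreal_def)

section \<open>Averages over subintervals of the unit interval\<close>

lemma subintervals_endpoints:
  assumes "J \<in> subintervals {0<..<1::real}"
  obtains a b where "0 \<le> a" "a < b" "b \<le> 1" "{a<..<b} \<subseteq> J" "J \<subseteq> {a..b}"
proof -
  have J: "is_interval J" "interior J \<noteq> {}" "J \<subseteq> {0<..<1}" using assms by (auto simp: subintervals_def)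
  then have ne: "J \<noteq> {}" using interior_subset by blast
  have J01: "0 < x" "x < 1" if "x \<in> J" for x using subsetD[OF J(3) that] by auto
  have bb: "bdd_below J" "bdd_above J"
    by (rule bdd_belowI[of _ 0], simp add: J01 less_imp_le) (rule bdd_aboveI[of _ 1], simp add: J01 less_imp_le)
  define a b where "a = Inf J" and "b = Sup J"
  have J2: "J \<subseteq> {a..b}" using bb by (auto simp: a_def b_def intro: cInf_lower cSup_upper)
  have J1: "{a<..<b} \<subseteq> J"
  proof
    fix x assume "x \<in> {a<..<b}"
    then obtain u v where "u \<in> J" "u < x" "v \<in> J" "x < v"
      using cInf_less_iff[OF ne bb(1)] less_cSup_iff[OF ne bb(2)] by (auto simp: a_def b_def)
    then show "x \<in> J" using J(1) by (meson is_interval_1 less_imp_le)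
  qed
  have "a < b"
  proof (rule ccontr)
    assume "\<not> a < b"
    then have "J \<subseteq> {a}" using J2 by force
    then have "interior J \<subseteq> interior {a}" by (rule interior_mono)
    then show False using J by simp
  qed
  moreover have "0 \<le> a" "b \<le> 1"
    unfolding a_def b_def using J01 ne by (auto intro!: cInf_greatest cSup_least simp: less_imp_le)
  ultimately show ?thesis using that J1 J2 by blast
qed

lemma subinterval_null_diff:
  fixes a b :: real
  assumes "{a<..<b} \<subseteq> J" "J \<subseteq> {a..b}"
  shows "AE x in lebesgue. x \<in> J \<longleftrightarrow> x \<in> {a<..<b}" "J \<in> sets lebesgue"
proof -
  have "negligible {a, b}" by simp
  then have "{a, b} \<in> null_sets lebesgue" by (simp only: negligible_iff_null_sets)
  then have "AE x in lebesgue. x \<notin> {a, b}" by (rule AE_not_in)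
  then show "AE x in lebesgue. x \<in> J \<longleftrightarrow> x \<in> {a<..<b}"
  proof eventually_elim
    fix x assume x: "x \<notin> {a, b}"
    show "x \<in> J \<longleftrightarrow> x \<in> {a<..<b}"
    proof
      assume "x \<in> J"
      then have "x \<in> {a..b}" using assms by blast
      then show "x \<in> {a<..<b}" using x by auto
    qed (use assms in blast)
  qed
  have "J = {a<..<b} \<union> (J \<inter> {a, b})"
  proof
    show "J \<subseteq> {a<..<b} \<union> (J \<inter> {a, b})"
    proof
      fix x assume "x \<in> J"
      then have "x \<in> {a..b}" using assms by blast
      then show "x \<in> {a<..<b} \<union> (J \<inter> {a, b})" using \<open>x \<in> J\<close> by (cases "x = a \<or> x = b") auto
    qed
  qed (use assms in blast)
  moreover have "J \<inter> {a, b} \<in> sets lebesgue"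
    using negligible_subset[of "{a,b}" "J \<inter> {a, b}"] by (simp add: negligible_imp_sets)
  moreover have "{a<..<b} \<in> sets lebesgue" by simp
  ultimately show "J \<in> sets lebesgue" by (metis sets.Un)
qed

lemma nnavg_open_interval:
  fixes a b :: real
  assumes "{a<..<b} \<subseteq> J" "J \<subseteq> {a..b}" "a < b"
  shows "nnavg J f = (\<integral>\<^sup>+x\<in>{a<..<b}. ennreal (f x) \<partial>lebesgue) / ennreal (b - a)"
proof -
  note ae = subinterval_null_diff[OF assms(1,2)]
  have "emeasure lebesgue J = emeasure lebesgue {a<..<b}"
    by (rule emeasure_eq_AE) (use ae in auto)
  then have "emeasure lebesgue J = ennreal (b - a)" using assms by simp
  moreover have "(\<integral>\<^sup>+x\<in>J. ennreal (f x) \<partial>lebesgue) = (\<integral>\<^sup>+x\<in>{a<..<b}. ennreal (f x) \<partial>lebesgue)"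
    by (rule nn_integral_cong_AE) (use ae(1) in \<open>auto simp: indicator_def\<close>)
  ultimately show ?thesis by (simp add: nnavg_def)
qed

lemma avg_open_interval:
  fixes a b :: real
  assumes "{a<..<b} \<subseteq> J" "J \<subseteq> {a..b}" "a < b" and m: "set_borel_measurable lebesgue J f"
  shows "avg J f = (LINT x:{a<..<b}|lebesgue. f x) / (b - a)"
proof -
  note ae = subinterval_null_diff[OF assms(1,2)]
  have "emeasure lebesgue J = emeasure lebesgue {a<..<b}"
    by (rule emeasure_eq_AE) (use ae in auto)
  then have "measure lebesgue J = b - a" using assms by (simp add: measure_def)
  moreover have "(LINT x:J|lebesgue. f x) = (LINT x:{a<..<b}|lebesgue. f x)"
  proof (rule set_integral_cong_set)
    show "set_borel_measurable lebesgue {a<..<b} f" by (rule set_borel_measurable_subset[OF m _ assms(1)]) simp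
    show "AE x in lebesgue. x \<in> {a<..<b} \<longleftrightarrow> x \<in> J" using ae(1) by eventually_elim blast
  qed (fact m)
  ultimately show ?thesis by (simp add: avg_def)
qed

lemma nnavg_centered_comparison:
  fixes \<phi> \<psi> :: "real \<Rightarrow> real"
  assumes p: "p \<ge> 1" and J: "J \<in> subintervals {0<..<1}"
    and f: "set_integrable lebesgue J \<phi>" and g: "set_integrable lebesgue J \<psi>"
    and cross: "\<And>x. x \<in> J \<Longrightarrow> (y \<le> \<psi> x - avg J \<psi> \<and> \<psi> x - avg J \<psi> \<le> \<phi> x - avg J \<phi>) \<or>
       (\<phi> x - avg J \<phi> \<le> \<psi> x - avg J \<psi> \<and> \<psi> x - avg J \<psi> \<le> y)"
  shows "nnavg J (\<lambda>x. \<bar>\<psi> x - avg J \<psi>\<bar> powr p) \<le> nnavg J (\<lambda>x. \<bar>\<phi> x - avg J \<phi>\<bar> powr p)"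
proof -
  obtain a b where ab: "0 \<le> a" "a < b" "b \<le> 1" "{a<..<b} \<subseteq> J" "J \<subseteq> {a..b}"
    using subintervals_endpoints[OF J] .
  note ae = subinterval_null_diff[OF ab(4,5)]
  have "emeasure lebesgue J = emeasure lebesgue {a<..<b}"
    by (rule emeasure_eq_AE) (use ae in auto)
  then have em: "emeasure lebesgue J = ennreal (b - a)" "measure lebesgue J = b - a" using ab by (auto simp: measure_def)
  let ?M = "lebesgue_on J"
  have sp: "space ?M = J" by simp
  have fm: "finite_measure ?M"
    by (rule finite_measureI) (use ae em in \<open>simp add: emeasure_restrict_space\<close>)
  then have cst: "integrable ?M (\<lambda>x. c)" for c :: real by (simp add: finite_measure.integrable_const)
  have mM: "measure ?M J = b - a" using ae em by (simp add: measure_restrict_space)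
  have on: "integrable ?M h" "integral\<^sup>L ?M h = avg J h * (b - a)" if "set_integrable lebesgue J h" for h :: "real \<Rightarrow> real"
    using that ae em ab by (auto simp: set_integrable_def integrable_restrict_space integral_restrict_space avg_def set_lebesgue_integral_def)
  have cent: "integrable ?M (\<lambda>x. h x - avg J h)" "integral\<^sup>L ?M (\<lambda>x. h x - avg J h) = 0" if "set_integrable lebesgue J h" for h :: "real \<Rightarrow> real"
  proof -
    show "integrable ?M (\<lambda>x. h x - avg J h)" using on[OF that] cst by simp
    have "integral\<^sup>L ?M (\<lambda>x. h x - avg J h) = integral\<^sup>L ?M h - integral\<^sup>L ?M (\<lambda>x. avg J h)"
      using on[OF that] cst by (intro Bochner_Integration.integral_diff) auto
    then show "integral\<^sup>L ?M (\<lambda>x. h x - avg J h) = 0" using on[OF that] mM by simp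
  qed
  have "(\<integral>\<^sup>+x. ennreal (\<bar>\<psi> x - avg J \<psi>\<bar> powr p) \<partial>?M) \<le> (\<integral>\<^sup>+x. ennreal (\<bar>\<phi> x - avg J \<phi>\<bar> powr p) \<partial>?M)"
    by (rule centered_power_comparison[OF p, where y=y]) (use cent f g cross in auto)
  then have "(\<integral>\<^sup>+x\<in>J. ennreal (\<bar>\<psi> x - avg J \<psi>\<bar> powr p) \<partial>lebesgue) \<le> (\<integral>\<^sup>+x\<in>J. ennreal (\<bar>\<phi> x - avg J \<phi>\<bar> powr p) \<partial>lebesgue)"
    using ae by (simp add: nn_integral_restrict_space)
  then show ?thesis unfolding nnavg_def by (rule divide_right_mono_ennreal)
qed

text \<open>Truncation from above lowers the mean and truncation from below raises it. Where the
  function is unchanged, the difference of the centered functions therefore has a fixed sign, and it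
  can change sign only where \<open>\<psi>\<close> has the constant value \<open>T\<close>.\<close>

lemma nnavg_truncation_le:
  fixes \<phi> :: "real \<Rightarrow> real"
  assumes p: "p \<ge> 1" and J: "J \<in> subintervals {0<..<1}" and f: "set_integrable lebesgue J \<phi>"
    and g: "set_integrable lebesgue J \<psi>" and \<psi>: "\<psi> = (\<lambda>x. min (\<phi> x) T) \<or> \<psi> = (\<lambda>x. max (\<phi> x) T)"
  shows "nnavg J (\<lambda>x. \<bar>\<psi> x - avg J \<psi>\<bar> powr p) \<le> nnavg J (\<lambda>x. \<bar>\<phi> x - avg J \<phi>\<bar> powr p)"
proof (rule nnavg_centered_comparison[OF p J f g, where y="T - avg J \<psi>"])
  have avg_mono: "avg J h \<le> avg J k" if "set_integrable lebesgue J h" "set_integrable lebesgue J k" "\<And>x. h x \<le> k x" for h k :: "real \<Rightarrow> real"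
    unfolding avg_def using that by (intro divide_right_mono set_integral_mono) auto
  fix x
  from \<psi> show "(T - avg J \<psi> \<le> \<psi> x - avg J \<psi> \<and> \<psi> x - avg J \<psi> \<le> \<phi> x - avg J \<phi>) \<or>
       (\<phi> x - avg J \<phi> \<le> \<psi> x - avg J \<psi> \<and> \<psi> x - avg J \<psi> \<le> T - avg J \<psi>)"
  proof
    assume m: "\<psi> = (\<lambda>x. min (\<phi> x) T)"
    have "avg J \<psi> \<le> avg J \<phi>" by (rule avg_mono[OF g f]) (simp add: m)
    moreover have "\<psi> x = min (\<phi> x) T" by (simp add: m)
    ultimately show ?thesis by (auto simp: min_def)
  next
    assume m: "\<psi> = (\<lambda>x. max (\<phi> x) T)"
    have "avg J \<phi> \<le> avg J \<psi>" by (rule avg_mono[OF f g]) (simp add: m)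
    moreover have "\<psi> x = max (\<phi> x) T" by (simp add: m)
    ultimately show ?thesis by (auto simp: max_def)
  qed
qed

section \<open>Oscillation of the logarithm\<close>

text \<open>This is the moment of order \<open>p\<close> of \<open>- ln x - 1\<close> over the unit
  interval, and the power of exponent \<open>p\<close> of the John--Nirenberg constant.\<close>

definition log_moment :: "real \<Rightarrow> real" where
  "log_moment p = p / exp 1 * (Gamma p - integral {0..1} (\<lambda>t. t powr (p - 1) * exp t)) + 1"

lemma integral_powr_exp_by_parts:
  fixes p :: real assumes p: "p \<ge> 1"
  shows "((\<lambda>u. u powr p * exp u) has_integral exp 1 - p * integral {0..1} (\<lambda>t. t powr (p - 1) * exp t)) {0..1}"
proof -
  have c: "continuous_on {0..1::real} (\<lambda>u. u powr p * exp u)"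
    using p by (intro continuous_on_mult continuous_on_powr' continuous_intros) auto
  have "((\<lambda>u. p * (u powr (p - 1) * exp u) + u powr p * exp u) has_integral (1 powr p * exp 1 - 0 powr p * exp 0)) {0..1::real}"
    by (rule fundamental_theorem_of_calculus_interior[OF _ c])
       (auto intro!: derivative_eq_intros simp: algebra_simps simp flip: has_real_derivative_iff_has_vector_derivative)
  then have 1: "((\<lambda>u. p * (u powr (p - 1) * exp u) + u powr p * exp u) has_integral exp 1) {0..1::real}" by simp
  have 2: "((\<lambda>u. u powr p * exp u) has_integral integral {0..1} (\<lambda>u. u powr p * exp u)) {0..1}"
    using c by (intro integrable_integral integrable_continuous_real)
  have "((\<lambda>u. p * (u powr (p - 1) * exp u)) has_integral exp 1 - integral {0..1} (\<lambda>u. u powr p * exp u)) {0..1}"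
    using has_integral_diff[OF 1 2] by simp
  from integral_unique[OF this] have "p * integral {0..1} (\<lambda>t. t powr (p - 1) * exp t) = exp 1 - integral {0..1} (\<lambda>u. u powr p * exp u)"
    by (simp add: integral_mult_right)
  with 2 show ?thesis by simp
qed

lemma log_substitution:
  fixes f :: "real \<Rightarrow> real"
  assumes i: "((\<lambda>t. exp (c - t) * f (exp (c - t))) has_integral I) S" and S: "S \<in> sets lebesgue"
    and f: "\<And>x. x \<in> (\<lambda>t. exp (c - t)) ` S \<Longrightarrow> 0 \<le> f x"
  shows "(f has_integral I) ((\<lambda>t. exp (c - t)) ` S)" "f absolutely_integrable_on ((\<lambda>t. exp (c - t)) ` S)"
proof -
  have der: "((\<lambda>t. exp (c - t)) has_real_derivative - exp (c - t)) (at t within S)" for t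
    by (auto intro!: derivative_eq_intros)
  have eq: "(\<lambda>t. \<bar>- exp (c - t)\<bar> * f (exp (c - t))) = (\<lambda>t. exp (c - t) * f (exp (c - t)))" by auto
  have "(\<lambda>t. exp (c - t) * f (exp (c - t))) absolutely_integrable_on S"
    using i f by (intro nonnegative_absolutely_integrable_1) auto
  moreover have "integral S (\<lambda>t. exp (c - t) * f (exp (c - t))) = I" using i by (rule integral_unique)
  ultimately have *: "f absolutely_integrable_on ((\<lambda>t. exp (c - t)) ` S) \<and> integral ((\<lambda>t. exp (c - t)) ` S) f = I"
    using has_absolute_integral_change_of_variables_1'[OF S, of "\<lambda>t. exp (c - t)" "\<lambda>t. - exp (c - t)" f I] der unfolding eq
    by (auto simp: inj_on_def)
  then show "f absolutely_integrable_on ((\<lambda>t. exp (c - t)) ` S)" by simp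
  then show "(f has_integral I) ((\<lambda>t. exp (c - t)) ` S)"
    using * set_lebesgue_integral_eq_integral(1) has_integral_iff by blast
qed

lemma image_exp_atLeast: "(\<lambda>t. exp (c - t)) ` {0..} = {0<..exp c}" for c :: real
proof
  show "{0<..exp c} \<subseteq> (\<lambda>t. exp (c - t)) ` {0..}"
  proof
    fix x assume x: "x \<in> {0<..exp c}"
    then have "ln x \<le> c" by (metis exp_gt_zero greaterThanAtMost_iff ln_exp ln_le_cancel_iff)
    then show "x \<in> (\<lambda>t. exp (c - t)) ` {0..}" using x by (intro image_eqI[of _ _ "c - ln x"]) auto
  qed
qed auto

lemma Gamma_has_integral:
  fixes p :: real assumes "p > -1" shows "((\<lambda>t. exp (- t) * t powr p) has_integral Gamma (p + 1)) {0..}"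
  using Gamma_integral_real[of "p + 1"] assms by (simp add: exp_minus field_simps)

lemma neg_ln_has_integral:
  "((\<lambda>x. - ln x) has_integral 1) {0<..<1::real}" "(\<lambda>x. - ln x) absolutely_integrable_on {0<..<1::real}"
proof -
  have "((\<lambda>t::real. exp (- t) * t) has_integral 1) {0..}"
  proof -
    have "((\<lambda>t::real. exp (- t) * t powr 1) has_integral Gamma (1 + 1)) {0..}" by (rule Gamma_has_integral) simp
    moreover have "Gamma (1 + 1 :: real) = 1" using Gamma_fact[of 1, where 'a=real] by simp
    ultimately have "((\<lambda>t::real. exp (- t) * t powr 1) has_integral (1::real)) {0..}" by (simp only:)
    then show ?thesis by (rule has_integral_eq[rotated]) auto
  qed
  then have i: "((\<lambda>t::real. exp (0 - t) * (- ln (exp (0 - t)))) has_integral 1) {0..}" by simp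
  have nn: "0 \<le> - ln x" if "x \<in> (\<lambda>t. exp (0 - t)) ` {0..}" for x :: real using that by auto
  note s = log_substitution[OF i _ nn, unfolded image_exp_atLeast, simplified]
  show "((\<lambda>x. - ln x) has_integral 1) {0<..<1::real}"
    by (rule has_integral_spike_set_eq[THEN iffD1, OF _ _ s(1)]) (auto intro: negligible_subset[of "{1}"])
  show "(\<lambda>x. - ln x) absolutely_integrable_on {0<..<1::real}"
    by (rule set_integrable_subset[OF s(2)]) auto
qed

lemma Gamma_plus1_real: "Gamma (p + 1) = p * Gamma p" if "p > 0" for p :: real
proof (rule Gamma_plus1)
  show "p \<notin> \<int>\<^sub>\<le>\<^sub>0" using that by (auto elim!: nonpos_Ints_cases)
qed

text \<open>The substitution \<open>x = exp (-1 - t)\<close> turns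
  \<open>\<bar>- ln x - 1\<bar>\<close> into \<open>\<bar>t\<bar>\<close>. The part
  \<open>t \<ge> 0\<close> gives \<open>Gamma (p + 1)\<close>, and \<open>{-1..0}\<close> gives the
  integral of \<open>u powr p * exp u\<close>, both with the factor \<open>exp (-1)\<close>;
  integration by parts brings the second to the stated form.\<close>

lemma log_moment_has_integral:
  fixes p :: real assumes p: "p \<ge> 1"
  shows "((\<lambda>x. \<bar>- ln x - 1\<bar> powr p) has_integral log_moment p) {0<..<1}"
proof -
  let ?f = "\<lambda>x::real. \<bar>- ln x - 1\<bar> powr p"
  let ?g = "integral {0..1} (\<lambda>t. t powr (p - 1) * exp t)"
  have e: "exp (- 1 - t) = exp (- 1) * exp (- t)" for t :: real by (simp add: mult_exp_exp)
  have "((\<lambda>t. exp (-1) * (exp (- t) * t powr p)) has_integral exp (-1) * Gamma (p + 1)) {0..}"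
    using p by (intro has_integral_mult_right Gamma_has_integral) auto
  then have "((\<lambda>t. exp (-1 - t) * ?f (exp (-1 - t))) has_integral exp (-1) * Gamma (p + 1)) {0..}"
    by (rule has_integral_eq[rotated]) (subst ln_exp, subst e, simp)
  from log_substitution(1)[OF this] have 1: "(?f has_integral exp (-1) * Gamma (p + 1)) {0<..exp (-1)}"
    unfolding image_exp_atLeast by simp
  have "((\<lambda>u. exp (-1) * (u powr p * exp u)) has_integral exp (-1) * (exp 1 - p * ?g)) {0..1}"
    by (intro has_integral_mult_right integral_powr_exp_by_parts p)
  then have "((\<lambda>u. exp (-1) * ((-u) powr p * exp (-u))) has_integral exp (-1) * (exp 1 - p * ?g)) {-1..0}"
    using has_integral_reflect_real[where f="\<lambda>u. exp (-1) * (u powr p * exp u)" and i="exp (-1) * (exp 1 - p * ?g)" and a=0 and b=1]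
    by simp
  then have "((\<lambda>t. exp (-1 - t) * ?f (exp (-1 - t))) has_integral exp (-1) * (exp 1 - p * ?g)) {-1..0}"
    by (rule has_integral_eq[rotated]) (subst ln_exp, subst e, simp)
  note s2 = log_substitution(1)[OF this]
  have "(\<lambda>t. exp (-1 - t)) ` {-1..0} = {exp (-1)..1::real}"
  proof
    show "{exp (-1)..1::real} \<subseteq> (\<lambda>t. exp (-1 - t)) ` {-1..0}"
    proof
      fix x :: real assume x: "x \<in> {exp (-1)..1}"
      then have "x > 0" by (meson atLeastAtMost_iff exp_gt_zero less_le_trans)
      moreover have "ln x \<ge> -1" using x \<open>x > 0\<close> by (simp add: ln_ge_iff)
      moreover have "ln x \<le> 0" using x \<open>x > 0\<close> by simp
      ultimately show "x \<in> (\<lambda>t. exp (-1 - t)) ` {-1..0}" by (intro image_eqI[of _ _ "-1 - ln x"]) auto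
    qed
  qed auto
  with s2 have 2: "(?f has_integral exp (-1) * (exp 1 - p * ?g)) {exp (-1)..1}" by simp
  have "(?f has_integral exp (-1) * Gamma (p + 1) + exp (-1) * (exp 1 - p * ?g)) ({0<..exp (-1)} \<union> {exp (-1)..1})"
    by (rule has_integral_Un[OF 1 2]) (auto intro: negligible_subset[of "{exp (-1)}"])
  moreover have "{0<..exp (-1)} \<union> {exp (-1)..1} = {0<..1::real}"
  proof -
    have "{0<..c} \<union> {c..1} = {0<..1}" if "0 < c" "c \<le> 1" for c :: real using that by auto
    then show ?thesis by simp
  qed
  moreover have "exp (-1) * Gamma (p + 1) + exp (-1) * (exp 1 - p * ?g) = log_moment p"
    using Gamma_plus1_real[of p] p by (simp add: log_moment_def exp_minus field_simps)
  ultimately have "(?f has_integral log_moment p) {0<..1}" by simp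
  then show ?thesis
    by (rule has_integral_spike_set_eq[THEN iffD1, rotated 2]) (auto intro: negligible_subset[of "{1}"])
qed

lemma log_moment_pos:
  fixes p :: real assumes p: "p \<ge> 1" shows "log_moment p > 0"
proof -
  have "0 \<le> exp (-1) * integral {0..1} (\<lambda>u. u powr p * exp u)"
    using integral_powr_exp_by_parts[OF p] by (intro mult_nonneg_nonneg integral_nonneg) auto
  then have "0 \<le> exp (-1) * (exp 1 - p * integral {0..1} (\<lambda>t. t powr (p - 1) * exp t))"
    using integral_unique[OF integral_powr_exp_by_parts[OF p]] by simp
  moreover have "exp (-1) * Gamma (p + 1) > 0" using p by (simp add: Gamma_real_pos)
  moreover have "exp (-1) * Gamma (p + 1) + exp (-1) * (exp 1 - p * integral {0..1} (\<lambda>t. t powr (p - 1) * exp t)) = log_moment p"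
    using Gamma_plus1_real[of p] p by (simp add: log_moment_def exp_minus field_simps)
  ultimately show ?thesis by linarith
qed

text \<open>After rescaling \<open>{a<..<b}\<close> to the unit interval, the centered logarithm
  \<open>f\<close> of the unit interval and the rescaled one \<open>g\<close> differ by
  \<open>ln (a / t + (b - a)) - \<kappa>\<close>. This is nonincreasing in \<open>t\<close>, as is
  \<open>g\<close>, so there is one sign change in the direction required by
  \<open>centered_power_comparison\<close>.\<close>

lemma log_oscillation_le:
  fixes a b p :: real
  assumes p: "p \<ge> 1" and ab: "0 \<le> a" "a < b" "b \<le> 1"
  defines "m \<equiv> (LINT x:{a<..<b}|lebesgue. - ln x) / (b - a)"
  shows "(\<integral>\<^sup>+x\<in>{a<..<b}. ennreal (\<bar>- ln x - m\<bar> powr p) \<partial>lebesgue) / ennreal (b - a) \<le> ennreal (log_moment p)"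
proof -
  let ?M = "lebesgue_on {0<..<1::real}"
  define f where "f t = - ln t - 1" for t :: real
  define g where "g t = - ln (a + (b - a) * t) - m" for t :: real
  have absint: "integrable ?M h \<longleftrightarrow> h absolutely_integrable_on {0<..<1}" for h :: "real \<Rightarrow> real"
    by (simp add: set_integrable_def integrable_restrict_space)
  have intM: "integral\<^sup>L ?M h = (LINT x:{0<..<1}|lebesgue. h x)" for h :: "real \<Rightarrow> real"
    by (simp add: set_lebesgue_integral_def integral_restrict_space)
  have cst: "integrable ?M (\<lambda>x. c)" "integral\<^sup>L ?M (\<lambda>x. c) = c" for c :: real
  proof -
    have "finite_measure ?M" by (rule finite_measureI) (simp add: emeasure_restrict_space)
    then show "integrable ?M (\<lambda>x. c)" by (simp add: finite_measure.integrable_const)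
    show "integral\<^sup>L ?M (\<lambda>x. c) = c" by (simp add: measure_restrict_space)
  qed
  have lnint: "integrable ?M (\<lambda>x. - ln x)" "integral\<^sup>L ?M (\<lambda>x. - ln x) = 1"
    unfolding absint intM set_lebesgue_integral_eq_integral(2)[OF neg_ln_has_integral(2)]
    by (rule neg_ln_has_integral(2), rule integral_unique[OF neg_ln_has_integral(1)])
  have fe: "f = (\<lambda>t. - ln t - 1)" and ge: "g = (\<lambda>t. - ln (a + (b - a) * t) - m)" by (auto simp: f_def g_def)
  have f: "integrable ?M f" "integral\<^sup>L ?M f = 0"
    unfolding fe Bochner_Integration.integral_diff[OF lnint(1) cst(1)] lnint(2) cst(2)
    by (rule Bochner_Integration.integrable_diff[OF lnint(1) cst(1)]) simp
  have lnab: "(\<lambda>x. - ln x) absolutely_integrable_on {a<..<b}"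
    by (rule set_integrable_subset[OF neg_ln_has_integral(2)]) (use ab in auto)
  have img: "(\<lambda>t. a + (b - a) * t) ` {0<..<1} = {a<..<b}"
  proof
    show "{a<..<b} \<subseteq> (\<lambda>t. a + (b - a) * t) ` {0<..<1}"
    proof
      fix x assume "x \<in> {a<..<b}"
      then show "x \<in> (\<lambda>t. a + (b - a) * t) ` {0<..<1}"
        using ab by (intro image_eqI[of _ _ "(x - a) / (b - a)"]) (auto simp: field_simps)
    qed
    show "(\<lambda>t. a + (b - a) * t) ` {0<..<1} \<subseteq> {a<..<b}"
    proof
      fix x assume "x \<in> (\<lambda>t. a + (b - a) * t) ` {0<..<1}"
      then obtain t where t: "0 < t" "t < 1" "x = a + (b - a) * t" by auto
      have "0 < (b - a) * t" "(b - a) * t < (b - a) * 1"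
        using t ab by (auto intro!: mult_strict_left_mono simp del: mult_1_right)
      then show "x \<in> {a<..<b}" using t by auto
    qed
  qed
  have der: "((\<lambda>t. a + (b - a) * t) has_real_derivative b - a) (at t within {0<..<1})" for t
    by (auto intro!: derivative_eq_intros)
  have "(\<lambda>t. \<bar>b - a\<bar> * (- ln (a + (b - a) * t))) absolutely_integrable_on {0<..<1} \<and>
      integral {0<..<1} (\<lambda>t. \<bar>b - a\<bar> * (- ln (a + (b - a) * t))) = integral {a<..<b} (\<lambda>x. - ln x)"
    using has_absolute_integral_change_of_variables_1'[of "{0<..<1}" "\<lambda>t. a + (b - a) * t" "\<lambda>t. b - a" "\<lambda>x. - ln x" "integral {a<..<b} (\<lambda>x. - ln x)"]
      lnab ab der unfolding img by (auto simp: inj_on_def)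
  note h = this
  have ml: "(b - a) * m = integral {a<..<b} (\<lambda>x. - ln x)"
    unfolding m_def set_lebesgue_integral_eq_integral(2)[OF lnab] using ab by simp
  have "integral\<^sup>L ?M (\<lambda>t. \<bar>b - a\<bar> * (- ln (a + (b - a) * t))) = (b - a) * m"
    unfolding intM set_lebesgue_integral_eq_integral(2)[OF conjunct1[OF h]] ml by (rule conjunct2[OF h])
  then have g2i: "\<bar>b - a\<bar> * integral\<^sup>L ?M (\<lambda>t. - ln (a + (b - a) * t)) = (b - a) * m"
    unfolding Bochner_Integration.integral_mult_right_zero .
  have "integrable ?M (\<lambda>t. \<bar>b - a\<bar> * (- ln (a + (b - a) * t)))"
    unfolding absint by (rule conjunct1[OF h])
  then have g2: "integrable ?M (\<lambda>t. - ln (a + (b - a) * t))"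
    using ab unfolding integrable_mult_left_iff by auto
  have g2': "integral\<^sup>L ?M (\<lambda>t. - ln (a + (b - a) * t)) = m"
  proof -
    have "X = m" if "\<bar>b - a\<bar> * X = (b - a) * m" for X using that ab by simp
    from this[OF g2i] show ?thesis .
  qed
  have g: "integrable ?M g" "integral\<^sup>L ?M g = 0"
    unfolding ge Bochner_Integration.integral_diff[OF g2 cst(1)] g2' cst(2)
    by (rule Bochner_Integration.integrable_diff[OF g2 cst(1)]) simp
  define \<kappa> where "\<kappa> = 1 - m"
  have diff: "f t - g t = ln (a / t + (b - a)) - \<kappa>" if t: "0 < t" "t < 1" for t
  proof -
    have "a + (b - a) * t > 0" using t ab by (simp add: add_nonneg_pos)
    moreover have "a / t + (b - a) = (a + (b - a) * t) / t" using t by (simp add: field_simps)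
    ultimately show ?thesis using t by (simp add: f_def g_def \<kappa>_def ln_div)
  qed
  have Idiff: "integrable ?M (\<lambda>t. f t - g t)" "integral\<^sup>L ?M (\<lambda>t. f t - g t) = 0" using f g by auto
  \<comment> \<open>The difference has mean 0 and never falls below \<open>ln b - \<kappa>\<close>.
    For \<open>a > 0\<close> this makes \<open>exp \<kappa> - (b - a)\<close> positive, so that the
    crossing point \<open>t0\<close> exists.\<close>
  have k: "ln b \<le> \<kappa>"
  proof -
    have "integral\<^sup>L ?M (\<lambda>t. ln b - \<kappa>) \<le> integral\<^sup>L ?M (\<lambda>t. f t - g t)"
    proof (rule integral_mono[OF cst(1) Idiff(1)])
      fix t assume "t \<in> space ?M"
      then have t: "0 < t" "t < 1" by auto
      have "a * t \<le> a" using t ab by (simp add: mult_left_le)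
      then have "b \<le> a / t + (b - a)" using t by (simp add: field_simps)
      then have "ln b \<le> ln (a / t + (b - a))" using ab by simp
      then show "ln b - \<kappa> \<le> f t - g t" using diff[OF t] by simp
    qed
    then show ?thesis unfolding Idiff(2) cst(2) by simp
  qed
  obtain y where cross: "\<And>t. t \<in> {0<..<1} \<Longrightarrow> (y \<le> g t \<and> g t \<le> f t) \<or> (f t \<le> g t \<and> g t \<le> y)"
  proof (cases "a = 0")
    case True
    have "integral\<^sup>L ?M (\<lambda>t. f t - g t) = integral\<^sup>L ?M (\<lambda>t. ln b - \<kappa>)"
      by (rule Bochner_Integration.integral_cong) (use diff True in auto)
    then have "ln b = \<kappa>" unfolding Idiff(2) cst(2) by simp
    then have "f t = g t" if "t \<in> {0<..<1}" for t using diff[of t] that True by auto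
    then show ?thesis using that by (metis linorder_linear order_refl)
  next
    case False
    then have a: "a > 0" using ab by simp
    have "b - a < b" using a by simp
    also have "b \<le> exp \<kappa>" using k ab by (metis exp_le_cancel_iff exp_ln order_le_less_trans)
    finally have e: "exp \<kappa> - (b - a) > 0" by simp
    define t0 where "t0 = a / (exp \<kappa> - (b - a))"
    have t0: "t0 > 0" "a / t0 + (b - a) = exp \<kappa>" using a e by (auto simp: t0_def)
    show ?thesis
    proof (rule that[of "g t0"])
      fix t :: real assume t: "t \<in> {0<..<1}"
      have pos: "a / t + (b - a) > 0" "a + (b - a) * t > 0" "a + (b - a) * t0 > 0" 
        using t a ab t0 by (auto simp: add_pos_pos)
      show "(g t0 \<le> g t \<and> g t \<le> f t) \<or> (f t \<le> g t \<and> g t \<le> g t0)"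
      proof (cases "t \<le> t0")
        case True
        have "a / t0 \<le> a / t" using True t t0 a by (intro divide_left_mono) auto
        then have "exp \<kappa> \<le> a / t + (b - a)" using t0 by linarith
        then have "\<kappa> \<le> ln (a / t + (b - a))" using pos by (simp add: ln_ge_iff)
        moreover have "(b - a) * t \<le> (b - a) * t0" using True ab by (intro mult_left_mono) auto
        then have "g t0 \<le> g t" using pos by (simp add: g_def)
        ultimately show ?thesis using diff[of t] t by auto
      next
        case False
        have "a / t \<le> a / t0" using False t t0 a by (intro divide_left_mono) auto
        then have "a / t + (b - a) \<le> exp \<kappa>" using t0 by linarith
        then have "ln (a / t + (b - a)) \<le> \<kappa>" using pos by (metis ln_exp ln_le_cancel_iff exp_gt_zero)
        moreover have "(b - a) * t0 \<le> (b - a) * t" using False ab by (intro mult_left_mono) auto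
        then have "g t \<le> g t0" using pos by (simp add: g_def)
        ultimately show ?thesis using diff[of t] t by auto
      qed
    qed
  qed
  have "(\<integral>\<^sup>+t. ennreal (\<bar>g t\<bar> powr p) \<partial>?M) \<le> (\<integral>\<^sup>+t. ennreal (\<bar>f t\<bar> powr p) \<partial>?M)"
    by (rule centered_power_comparison[OF p f(1) g(1), where y=y]) (use f g cross in auto)
  also have "\<dots> = (\<integral>\<^sup>+t. ennreal (\<bar>- ln t - 1\<bar> powr p) * indicator {0<..<1} t \<partial>lborel)"
    by (simp add: nn_integral_restrict_space nn_integral_completion f_def)
  also have "\<dots> = ennreal (log_moment p)"
    by (rule nn_integral_has_integral_lebesgue'[OF _ log_moment_has_integral[OF p]]) simp
  finally have 1: "(\<integral>\<^sup>+t. ennreal (\<bar>g t\<bar> powr p) \<partial>?M) \<le> ennreal (log_moment p)" .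
  have "(\<integral>\<^sup>+x\<in>{a<..<b}. ennreal (\<bar>- ln x - m\<bar> powr p) \<partial>lebesgue)
      = (\<integral>\<^sup>+x. ennreal (\<bar>- ln x - m\<bar> powr p) * indicator {a<..<b} x \<partial>lborel)"
    by (simp add: nn_integral_completion)
  also have "\<dots> = ennreal \<bar>b - a\<bar> * (\<integral>\<^sup>+t. ennreal (\<bar>- ln (a + (b - a) * t) - m\<bar> powr p) * indicator {a<..<b} (a + (b - a) * t) \<partial>lborel)"
    using ab by (subst nn_integral_real_affine[where t=a and c="b - a"]) auto
  also have "(\<integral>\<^sup>+t. ennreal (\<bar>- ln (a + (b - a) * t) - m\<bar> powr p) * indicator {a<..<b} (a + (b - a) * t) \<partial>lborel)
      = (\<integral>\<^sup>+t. ennreal (\<bar>g t\<bar> powr p) \<partial>?M)"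
  proof -
    have "a + (b - a) * t \<in> {a<..<b} \<longleftrightarrow> t \<in> {0<..<1}" for t
    proof -
      have "a + (b - a) * t < b \<longleftrightarrow> (b - a) * t < (b - a) * 1" by auto
      then show ?thesis using ab by (simp add: zero_less_mult_iff)
    qed
    then have "indicator {a<..<b} (a + (b - a) * t) = (indicator {0<..<1} t :: ennreal)" for t by (simp only: indicator_def)
    then show ?thesis by (simp add: nn_integral_restrict_space nn_integral_completion g_def)
  qed
  finally have "(\<integral>\<^sup>+x\<in>{a<..<b}. ennreal (\<bar>- ln x - m\<bar> powr p) \<partial>lebesgue) / ennreal (b - a) = (\<integral>\<^sup>+t. ennreal (\<bar>g t\<bar> powr p) \<partial>?M)"
    using ab by (simp add: ennreal_mult_divide_eq mult.commute[of "ennreal (b - a)"])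
  then show ?thesis using 1 by simp
qed

section \<open>The function \<open>jn_k\<close>\<close>

lemma xi_equation_iff:
  fixes C x :: real
  assumes "C \<ge> 1" shows "exp (- x) = C * (1 - x) \<longleftrightarrow> (1 - x) * exp x = 1 / C"
  using assms by (auto simp: exp_minus field_simps)

lemma one_minus_exp_strict_antimono:
  fixes x y :: real assumes "0 \<le> x" "x < y" shows "(1 - y) * exp y < (1 - x) * exp x"
proof (rule DERIV_neg_imp_decreasing_open[where f="\<lambda>x. (1 - x) * exp x"])
  fix z assume "x < z" "z < y"
  then show "\<exists>D. ((\<lambda>x. (1 - x) * exp x) has_real_derivative D) (at z) \<and> D < 0"
    using assms by (intro exI[of _ "- z * exp z"]) (auto intro!: derivative_eq_intros simp: algebra_simps)
qed (use assms in \<open>auto intro!: continuous_intros\<close>)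

lemma one_minus_exp_strict_mono:
  fixes x y :: real assumes "x < y" "y \<le> 0" shows "(1 - x) * exp x < (1 - y) * exp y"
proof (rule DERIV_pos_imp_increasing_open[where f="\<lambda>x. (1 - x) * exp x"])
  fix z assume "x < z" "z < y"
  then show "\<exists>D. ((\<lambda>x. (1 - x) * exp x) has_real_derivative D) (at z) \<and> D > 0"
    using assms by (intro exI[of _ "- z * exp z"]) (auto intro!: derivative_eq_intros simp: algebra_simps mult_less_0_iff)
qed (use assms in \<open>auto intro!: continuous_intros\<close>)

lemma xi_plus_ex1:
  fixes C :: real assumes C: "C \<ge> 1"
  shows "\<exists>!x. 0 \<le> x \<and> x < 1 \<and> exp (- x) = C * (1 - x)"
proof -
  have "\<exists>x\<ge>0. x \<le> 1 \<and> (1 - x) * exp x = 1 / C"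
    by (rule IVT2'[of "\<lambda>x. (1 - x) * exp x"]) (use C in \<open>auto intro!: continuous_intros\<close>)
  then obtain x where x: "0 \<le> x" "x \<le> 1" "(1 - x) * exp x = 1 / C" by auto
  moreover have "x \<noteq> 1" using x C by auto
  ultimately have "0 \<le> x \<and> x < 1 \<and> exp (- x) = C * (1 - x)" using xi_equation_iff[OF C] by auto
  moreover have "y = x" if "0 \<le> y \<and> y < 1 \<and> exp (- y) = C * (1 - y)" for y
  proof (rule ccontr)
    assume "y \<noteq> x"
    then consider "x < y" | "y < x" by linarith
    then show False
      using one_minus_exp_strict_antimono[of x y] one_minus_exp_strict_antimono[of y x] x that xi_equation_iff[OF C, of y] by cases auto
  qed
  ultimately show ?thesis by blast
qed

lemma xi_minus_ex1:
  fixes C :: real assumes C: "C \<ge> 1"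
  shows "\<exists>!x. x \<le> 0 \<and> exp (- x) = C * (1 - x)"
proof -
  \<comment> \<open>The point \<open>- (2 * C)\<close> lies far enough to the left to start the
    intermediate value argument.\<close>
  have "(1 + 2 * C) * exp (- (2 * C)) \<le> 1 / C"
  proof -
    have "1 + 2 * C + (2 * C)\<^sup>2 / 2 \<le> exp (2 * C)" using exp_lower_Taylor_quadratic[of "2 * C"] C by simp
    then have "C * (1 + 2 * C) \<le> exp (2 * C)" using C by (simp add: power2_eq_square algebra_simps)
    then show ?thesis using C by (simp add: exp_minus field_simps)
  qed
  then have "\<exists>x\<ge>-(2*C). x \<le> 0 \<and> (1 - x) * exp x = 1 / C"
    by (intro IVT'[of "\<lambda>x. (1 - x) * exp x"]) (use C in \<open>auto intro!: continuous_intros\<close>)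
  then obtain x where x: "x \<le> 0" "(1 - x) * exp x = 1 / C" by auto
  then have "x \<le> 0 \<and> exp (- x) = C * (1 - x)" using xi_equation_iff[OF C] by auto
  moreover have "y = x" if "y \<le> 0 \<and> exp (- y) = C * (1 - y)" for y
  proof (rule ccontr)
    assume "y \<noteq> x"
    then consider "x < y" | "y < x" by linarith
    then show False
      using one_minus_exp_strict_mono[of x y] one_minus_exp_strict_mono[of y x] x that xi_equation_iff[OF C, of y] by cases auto
  qed
  ultimately show ?thesis by blast
qed

lemma xi_plus:
  assumes "C \<ge> 1"
  shows "0 \<le> xi_plus C" "xi_plus C < 1" "exp (- xi_plus C) = C * (1 - xi_plus C)"
  using theI'[OF xi_plus_ex1[OF assms]] unfolding xi_plus_def by auto

lemma xi_plus_eqI: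
  assumes "C \<ge> 1" "0 \<le> x" "x < 1" "exp (- x) = C * (1 - x)" shows "xi_plus C = x"
  using xi_plus_ex1[OF assms(1)] xi_plus[OF assms(1)] assms by blast

lemma xi_minus:
  assumes "C \<ge> 1"
  shows "xi_minus C \<le> 0" "exp (- xi_minus C) = C * (1 - xi_minus C)"
  using theI'[OF xi_minus_ex1[OF assms]] unfolding xi_minus_def by auto

lemma xi_minus_eqI:
  assumes "C \<ge> 1" "x \<le> 0" "exp (- x) = C * (1 - x)" shows "xi_minus C = x"
  using xi_minus_ex1[OF assms(1)] xi_minus[OF assms(1)] assms by blast

lemma xi_plus_pos: assumes "C > 1" shows "xi_plus C > 0"
  using xi_plus[of C] assms by (cases "xi_plus C = 0") auto

lemma xi_minus_neg: assumes "C > 1" shows "xi_minus C < 0"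
  using xi_minus[of C] assms by (cases "xi_minus C = 0") auto

text \<open>\<open>ent\<close> takes the value \<open>1 - 1 / C\<close> at \<open>exp (xi_plus C)\<close> and \<open>exp (xi_minus C)\<close>, so \<open>jn_k C\<close> is twice a
  height divided by the width of the sublevel set of a convex function at that height.\<close>

definition ent :: "real \<Rightarrow> real" where "ent t = t * ln t - t + 1"

lemma ent_tangent_le:
  assumes "t > 0" "z > 0" shows "ent z + ln z * (t - z) \<le> ent t"
proof -
  have "ln (z / t) \<le> z / t - 1" using assms by (intro ln_le_minus_one) simp
  then have "t * ln (z / t) \<le> t * (z / t - 1)" using assms by (intro mult_left_mono) auto
  then show ?thesis using assms by (simp add: ent_def ln_div algebra_simps)
qed

lemma ent_tangent_less:
  assumes "t > 0" "z > 0" "t \<noteq> z" shows "ent z + ln z * (t - z) < ent t"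
proof -
  have "ln (z / t) < z / t - 1" using assms ln_eq_minus_one[of "z / t"] ln_le_minus_one[of "z / t"] by fastforce
  then have "t * ln (z / t) < t * (z / t - 1)" using assms by (intro mult_strict_left_mono) auto
  then show ?thesis using assms by (simp add: ent_def ln_div algebra_simps)
qed

lemma ent_1: "ent 1 = 0" by (simp add: ent_def)

text \<open>Strict convexity on the segment from 1, where \<open>ent\<close> vanishes, to
  \<open>t\<close>: the tangent at the intermediate point is compared with \<open>ent\<close> at
  both ends.\<close>

lemma ent_scaled_less:
  assumes "t > 0" "t \<noteq> 1" "0 < l" "l < 1" shows "ent (1 + l * (t - 1)) < l * ent t"
proof -
  define z where "z = 1 + l * (t - 1)"
  have z: "z = (1 - l) + l * t" by (simp add: z_def algebra_simps)
  then have z0: "z > 0" using assms by (simp add: add_pos_pos)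
  have "t - z = (1 - l) * (t - 1)" by (simp add: z_def algebra_simps)
  then have "t \<noteq> z" using assms by auto
  then have "l * (ent z + ln z * (t - z)) < l * ent t"
    using assms z0 ent_tangent_less[of t z] by (intro mult_strict_left_mono) auto
  moreover have "(1 - l) * (ent z + ln z * (1 - z)) \<le> (1 - l) * ent 1"
    using assms z0 ent_tangent_le[of 1 z] by (intro mult_left_mono) auto
  moreover have "l * (ent z + ln z * (t - z)) + (1 - l) * (ent z + ln z * (1 - z)) = ent z"
  proof -
    have "l * (t - z) + (1 - l) * (1 - z) = 0" by (simp add: z_def algebra_simps)
    then have "ln z * (l * (t - z) + (1 - l) * (1 - z)) = 0" by simp
    then show ?thesis by (simp add: algebra_simps)
  qed
  ultimately show ?thesis by (simp add: ent_1 z_def)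
qed

context
  fixes C :: real assumes C: "C > 1"
begin

lemma ent_exp_xi: "ent (exp (xi_plus C)) = 1 - 1 / C" "ent (exp (xi_minus C)) = 1 - 1 / C"
proof -
  have "(1 - xi_plus C) * exp (xi_plus C) = 1 / C" "(1 - xi_minus C) * exp (xi_minus C) = 1 / C"
    using xi_plus[of C] xi_minus[of C] C xi_equation_iff[of C] by auto
  then show "ent (exp (xi_plus C)) = 1 - 1 / C" "ent (exp (xi_minus C)) = 1 - 1 / C"
    by (auto simp: ent_def algebra_simps)
qed

lemma jn_k_eq: "jn_k C = 2 * (1 - 1 / C) / (exp (xi_plus C) - exp (xi_minus C))"
proof -
  define X where "X = exp (xi_plus C)"
  define Y where "Y = exp (xi_minus C)"
  have XY: "X > 0" "Y > 0" "X > Y" using xi_plus_pos[OF C] xi_minus_neg[OF C] by (auto simp: X_def Y_def)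
  have x: "1 - xi_plus C = 1 / (C * X)" using xi_plus[of C] C by (simp add: X_def exp_minus field_simps)
  have y: "1 - xi_minus C = 1 / (C * Y)" using xi_minus[of C] C by (simp add: Y_def exp_minus field_simps)
  have "xi_plus C - xi_minus C = 1 / (C * Y) - 1 / (C * X)" using x y by linarith
  also have "\<dots> = (X - Y) / (C * X * Y)" using XY C by (simp add: field_simps)
  finally have "jn_k C = 2 * (1 / (C * Y) * (1 / (C * X)) / ((X - Y) / (C * X * Y))) * (C - 1)"
    using C by (simp add: jn_k_def x y)
  also have "\<dots> = 2 * (1 - 1 / C) / (X - Y)" using XY C by (simp add: field_simps)
  finally show ?thesis by (simp add: X_def Y_def)
qed

lemma jn_k_pos: "jn_k C > 0"
  unfolding jn_k_eq using C xi_plus_pos[OF C] xi_minus_neg[OF C] by (intro divide_pos_pos mult_pos_pos) auto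

text \<open>The sublevel set lies inside \<open>{0<..<exp 1}\<close>, so its width is below
  \<open>exp 1\<close>. The bound tends to \<open>2 / exp 1\<close>, so \<open>jn_k\<close> gets
  beyond every smaller number.\<close>

lemma jn_k_gt: "2 * (1 - 1 / C) / exp 1 < jn_k C"
proof -
  have "exp (xi_plus C) - exp (xi_minus C) < exp 1" 
    using xi_plus[of C] C by (smt (verit) exp_gt_zero exp_less_cancel_iff)
  then show ?thesis unfolding jn_k_eq using C xi_plus_pos[OF C] xi_minus_neg[OF C]
    by (intro divide_strict_left_mono mult_pos_pos) auto
qed

text \<open>From \<open>ln X \<le> X - 1\<close> the height \<open>h\<close> is at most
  \<open>(X - 1)\<^sup>2\<close>, so the sublevel set has width at least \<open>sqrt h\<close>. This
  makes \<open>jn_k\<close> small near \<open>C = 1\<close>.\<close>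

lemma jn_k_le: "jn_k C \<le> 2 * sqrt (1 - 1 / C)"
proof -
  define X where "X = exp (xi_plus C)"
  define h where "h = 1 - 1 / C"
  have X: "X > 1" using xi_plus_pos[OF C] by (simp add: X_def)
  have h: "h > 0" using C by (simp add: h_def)
  have "h = X * ln X - X + 1" using ent_exp_xi by (simp add: h_def X_def ent_def)
  also have "\<dots> \<le> X * (X - 1) - X + 1" using X ln_le_minus_one[of X] by (simp add: mult_left_mono)
  also have "\<dots> = (X - 1)\<^sup>2" by (simp add: power2_eq_square algebra_simps)
  finally have "sqrt h \<le> X - 1" using X by (simp add: real_le_lsqrt)
  also have "\<dots> \<le> X - exp (xi_minus C)" using xi_minus_neg[OF C] by simp
  finally have "2 * h / (X - exp (xi_minus C)) \<le> 2 * h / sqrt h"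
    using h X xi_minus_neg[OF C] less_le_trans[of "exp (xi_minus C)" 1 X] by (intro divide_left_mono mult_pos_pos) auto
  also have "\<dots> = 2 * sqrt h" using h real_div_sqrt[of h] by (simp flip: times_divide_eq_right)
  finally show ?thesis unfolding jn_k_eq h_def X_def .
qed

end

text \<open>Shrinking the sublevel set at height \<open>g\<close> towards the minimum point 1 by the
  factor \<open>l = h / g\<close> lands strictly inside the one at height \<open>h\<close>, by
  strict convexity. So the width grows more slowly than the height.\<close>

lemma jn_k_strict_mono:
  assumes "1 \<le> C" "C < D" shows "jn_k C < jn_k D"
proof (cases "C = 1")
  case True
  then show ?thesis using jn_k_pos[of D] assms by (simp add: jn_k_def)
next
  case False
  then have C: "C > 1" and D: "D > 1" using assms by auto
  define h where "h = 1 - 1 / C"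
  define g where "g = 1 - 1 / D"
  have hg: "0 < h" "h < g" using C D assms by (auto simp: h_def g_def field_simps)
  define l where "l = h / g"
  have l: "0 < l" "l < 1" "l * g = h" using hg by (auto simp: l_def)
  define X where "X = exp (xi_plus C)" define Y where "Y = exp (xi_minus C)"
  define X' where "X' = exp (xi_plus D)" define Y' where "Y' = exp (xi_minus D)"
  have ord: "X > 1" "X' > 1" "0 < Y" "Y < 1" "0 < Y'" "Y' < 1"
    using xi_plus_pos C D xi_minus_neg by (auto simp: X_def X'_def Y_def Y'_def)
  have e: "ent X = h" "ent Y = h" "ent X' = g" "ent Y' = g"
    using ent_exp_xi C D by (auto simp: X_def X'_def Y_def Y'_def h_def g_def)
  have "1 + l * (X' - 1) < X"
  proof (rule ccontr)
    define z where "z = 1 + l * (X' - 1)"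
    assume "\<not> 1 + l * (X' - 1) < X"
    then have "X \<le> z" by (simp add: z_def)
    then have "0 \<le> ln X * (z - X)" using ord by simp
    then have "ent X \<le> ent z" using ent_tangent_le[of z X] ord \<open>X \<le> z\<close> by linarith
    moreover have "ent z < l * g" using ent_scaled_less[of X' l] ord l e by (simp add: z_def)
    ultimately show False using e l by simp
  qed
  moreover have "Y < 1 + l * (Y' - 1)"
  proof (rule ccontr)
    define z where "z = 1 + l * (Y' - 1)"
    assume "\<not> Y < 1 + l * (Y' - 1)"
    then have "z \<le> Y" by (simp add: z_def)
    moreover have "z = (1 - l) + l * Y'" by (simp add: z_def algebra_simps)
    then have z0: "z > 0" using l ord by (simp add: add_pos_pos)
    have "ln Y \<le> 0" using ord by simp
    then have "0 \<le> ln Y * (z - Y)" using \<open>z \<le> Y\<close> by (intro mult_nonpos_nonpos) auto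
    then have "ent Y \<le> ent z" using ent_tangent_le[of z Y] ord z0 by linarith
    moreover have "ent z < l * g" using ent_scaled_less[of Y' l] ord l e by (simp add: z_def)
    ultimately show False using e l by simp
  qed
  ultimately have "l * (X' - Y') < X - Y" by (simp add: algebra_simps)
  then have "h * (X' - Y') < g * (X - Y)"
    using hg by (simp add: l_def field_simps)
  then have "2 * h / (X - Y) < 2 * g / (X' - Y')" using ord by (simp add: field_simps)
  then show ?thesis using jn_k_eq[OF C] jn_k_eq[OF D] by (simp add: h_def g_def X_def Y_def X'_def Y'_def)
qed

text \<open>Both functions invert \<open>exp (- x) / (1 - x)\<close> on a compact interval, and the
  inverse of a continuous injection on a compact set is continuous.\<close>

lemma continuous_on_xi:
  assumes "D \<ge> 1"
  shows "continuous_on {1..D} xi_plus" "continuous_on {1..D} xi_minus"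
proof -
  define K where "K x = exp (- x) / (1 - x)" for x :: real
  have K: "exp (- x) = C * (1 - x) \<longleftrightarrow> C = K x" if "x < 1" for x C using that by (auto simp: K_def field_simps)
  have K1: "1 \<le> K x" if "x < 1" for x 
    using that exp_ge_add_one_self[of "- x"] by (simp add: K_def field_simps)
  show "continuous_on {1..D} xi_plus"
  proof (rule continuous_on_subset)
    let ?S = "{0..xi_plus D}"
    show "continuous_on (K ` ?S) xi_plus"
    proof (rule continuous_on_inv)
      show "continuous_on ?S K" unfolding K_def using xi_plus[OF assms] by (intro continuous_intros) auto
      show "\<forall>x\<in>?S. xi_plus (K x) = x"
        using xi_plus[OF assms] K1 K by (auto intro!: xi_plus_eqI)
    qed simp
    show "{1..D} \<subseteq> K ` ?S"
    proof
      fix c assume c: "c \<in> {1..D}"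
      have "K (xi_plus D) = D" using K[of "xi_plus D" D] xi_plus[OF assms] by simp
      then have "\<exists>x\<ge>0. x \<le> xi_plus D \<and> K x = c"
        using c xi_plus[OF assms] unfolding K_def by (intro IVT') (auto intro!: continuous_intros)
      then show "c \<in> K ` ?S" by auto
    qed
  qed
  show "continuous_on {1..D} xi_minus"
  proof (rule continuous_on_subset)
    let ?S = "{xi_minus D..0}"
    show "continuous_on (K ` ?S) xi_minus"
    proof (rule continuous_on_inv)
      show "continuous_on ?S K" unfolding K_def by (intro continuous_intros) auto
      show "\<forall>x\<in>?S. xi_minus (K x) = x"
        using xi_minus[OF assms] K1 K by (auto intro!: xi_minus_eqI)
    qed simp
    show "{1..D} \<subseteq> K ` ?S"
    proof
      fix c assume c: "c \<in> {1..D}"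
      have "K (xi_minus D) = D" using K[of "xi_minus D" D] xi_minus[OF assms] by simp
      then have "\<exists>x\<ge>xi_minus D. x \<le> 0 \<and> K x = c"
        using c xi_minus[OF assms] unfolding K_def by (intro IVT2') (auto intro!: continuous_intros)
      then show "c \<in> K ` ?S" by auto
    qed
  qed
qed

lemma jn_k_inverse:
  assumes \<epsilon>: "0 \<le> \<epsilon>" "\<epsilon> < 2 / exp 1"
  shows "1 \<le> inv_into {1..} jn_k \<epsilon>" "jn_k (inv_into {1..} jn_k \<epsilon>) = \<epsilon>"
proof -
  have "\<exists>C\<ge>1. jn_k C = \<epsilon>"
  proof (cases "\<epsilon> = 0")
    case True then show ?thesis by (intro exI[of _ 1]) (simp add: jn_k_def)
  next
    case False
    then have pos: "\<epsilon> > 0" using \<epsilon> by simp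
    have e2: "exp 1 > (2::real)" using e_approx_32 by (simp add: abs_if split: if_splits)
    define h where "h = (\<epsilon> / 2)\<^sup>2"
    define g where "g = exp 1 * \<epsilon> / 2"
    have "\<epsilon> < 1" using \<epsilon> e2 by (smt (verit) divide_less_eq_1_pos)
    have g: "g < 1" using \<epsilon> by (simp add: g_def field_simps)
    have "h \<le> g"
    proof -
      have "\<epsilon> / 2 * (\<epsilon> / 2) \<le> exp 1 * (\<epsilon> / 2)" using pos \<open>\<epsilon> < 1\<close> e2 by (intro mult_right_mono) auto
      then show ?thesis by (simp add: h_def g_def power2_eq_square)
    qed
    have h: "0 < h" using pos by (simp add: h_def)
    \<comment> \<open>\<open>c\<close> and \<open>d\<close> have heights
      \<open>1 - 1 / c = h\<close> and \<open>1 - 1 / d = g\<close>, chosen so that the bounds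
      \<open>2 * sqrt h\<close> of \<open>jn_k_le\<close> and \<open>2 * g / exp 1\<close> of
      \<open>jn_k_gt\<close> both equal \<open>\<epsilon>\<close>.\<close>
    define c where "c = 1 / (1 - h)" define d where "d = 1 / (1 - g)"
    have cd: "1 < c" "c \<le> d" using h \<open>h \<le> g\<close> g by (auto simp: c_def d_def field_simps)
    have "jn_k c \<le> \<epsilon>"
      using jn_k_le[OF cd(1)] pos by (simp add: c_def h_def)
    moreover have "\<epsilon> \<le> jn_k d"
      using jn_k_gt[of d] cd by (simp add: d_def g_def)
    moreover have "continuous_on {c..d} jn_k"
    proof -
      have sub: "{c..d} \<subseteq> {1..d}" using cd by auto
      note cx = continuous_on_subset[OF continuous_on_xi(1) sub] continuous_on_subset[OF continuous_on_xi(2) sub]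
      have "continuous_on {c..d} (\<lambda>C. 2 * (1 - 1 / C) / (exp (xi_plus C) - exp (xi_minus C)))"
      proof (intro continuous_intros cx)
        show "\<forall>x\<in>{c..d}. exp (xi_plus x) - exp (xi_minus x) \<noteq> 0"
        proof
          fix x assume "x \<in> {c..d}"
          then have "x > 1" using cd by auto
          then show "exp (xi_plus x) - exp (xi_minus x) \<noteq> 0" using xi_plus_pos[of x] xi_minus_neg[of x] by auto
        qed
      qed (use cd in auto)
      then show ?thesis by (rule continuous_on_eq) (use cd jn_k_eq in auto)
    qed
    ultimately obtain C where "c \<le> C" "jn_k C = \<epsilon>" using IVT'[of jn_k c \<epsilon> d] cd by auto
    then show ?thesis using cd by (intro exI[of _ C]) auto
  qed
  then have "\<epsilon> \<in> jn_k ` {1..}" by auto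
  from inv_into_into[OF this] f_inv_into_f[OF this]
  show "1 \<le> inv_into {1..} jn_k \<epsilon>" "jn_k (inv_into {1..} jn_k \<epsilon>) = \<epsilon>" by auto
qed

section \<open>The best constant\<close>

lemma epowr_le_iff:
  assumes p: "p \<ge> 1" and r: "r \<ge> 0"
  shows "epowr x (1 / p) \<le> ennreal r \<longleftrightarrow> x \<le> ennreal (r powr p)"
proof (cases "x = \<infinity>")
  case False
  then obtain t where t: "x = ennreal t" "t \<ge> 0" by (cases x) auto
  have "t powr (1 / p) \<le> r \<longleftrightarrow> t \<le> r powr p"
  proof
    assume "t powr (1 / p) \<le> r"
    then have "(t powr (1 / p)) powr p \<le> r powr p" using p by (intro powr_mono2) auto
    then show "t \<le> r powr p" using p t by (simp add: powr_powr)
  next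
    assume "t \<le> r powr p"
    then have "t powr (1 / p) \<le> (r powr p) powr (1 / p)" using p t by (intro powr_mono2) auto
    then show "t powr (1 / p) \<le> r" using p r by (simp add: powr_powr)
  qed
  then show ?thesis using t r by (simp add: epowr_def)
qed (simp add: epowr_def top_unique)

lemma bmo_norm_le_iff:
  assumes "p \<ge> 1" "\<epsilon> \<ge> 0"
  shows "bmo_norm p Q \<phi> \<le> ennreal \<epsilon> \<longleftrightarrow>
    (\<forall>J\<in>subintervals Q. nnavg J (\<lambda>x. \<bar>\<phi> x - avg J \<phi>\<bar> powr p) \<le> ennreal (\<epsilon> powr p))"
  unfolding bmo_norm_def SUP_le_iff using epowr_le_iff[OF assms] by simp

lemma open_interval_subinterval:
  "0 \<le> a \<Longrightarrow> a < b \<Longrightarrow> b \<le> 1 \<Longrightarrow> {a<..<b::real} \<in> subintervals {0<..<1}"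
  by (auto simp: subintervals_def is_interval_1)

lemma jn_C_mono:
  assumes "\<epsilon> \<le> \<epsilon>'" shows "jn_C \<epsilon> p \<le> jn_C \<epsilon>' p"
  unfolding jn_C_def
proof (rule Inf_superset_mono, safe)
  fix C assume "jn_admissible \<epsilon>' p C"
  then show "jn_admissible \<epsilon> p C"
    unfolding jn_admissible_def using ennreal_leI[OF assms] by (meson order_trans)
qed

text \<open>The test function \<open>- \<xi> * ln x\<close> has norm at most the given radius,
  average \<open>\<xi>\<close> over the unit interval, and its exponential has average
  \<open>1 / (1 - \<xi>)\<close>.\<close>

lemma jn_C_ge_log:
  assumes p: "p \<ge> 1" and \<xi>: "0 \<le> \<xi>" "\<xi> < 1"
  shows "ennreal (exp (- \<xi>) / (1 - \<xi>)) \<le> jn_C (\<xi> * log_moment p powr (1 / p)) p"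
proof -
  define \<phi> where "\<phi> x = \<xi> * (- ln x)" for x :: real
  have phi: "\<phi> = (\<lambda>x. \<xi> * (- ln x))" by (auto simp: \<phi>_def)
  have int: "set_integrable lebesgue {0<..<1} \<phi>"
    unfolding phi by (rule set_integrable_mult_right) (rule neg_ln_has_integral(2))
  let ?e = "\<xi> * log_moment p powr (1 / p)"
  have e0: "?e \<ge> 0" using \<xi> by simp
  have ep: "?e powr p = \<xi> powr p * log_moment p"
    using log_moment_pos[OF p] \<xi> p by (simp add: powr_mult powr_powr)
  have av: "avg J \<phi> = \<xi> * ((LINT x:{a<..<b}|lebesgue. - ln x) / (b - a))"
    if "{a<..<b} \<subseteq> J" "J \<subseteq> {a..b}" "a < b" "J \<subseteq> {0<..<1}" for a b J
  proof -
    have "set_integrable lebesgue J \<phi>"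
      by (rule set_integrable_subset[OF int subinterval_null_diff(2)[OF that(1,2)] that(4)])
    then have "set_borel_measurable lebesgue J \<phi>"
      unfolding set_integrable_def set_borel_measurable_def by auto
    from avg_open_interval[OF that(1-3) this] show ?thesis
      unfolding phi set_integral_mult_right by (simp only: times_divide_eq_right)
  qed
  have norm: "bmo_norm p {0<..<1} \<phi> \<le> ennreal ?e"
    unfolding bmo_norm_le_iff[OF p e0] ep
  proof
    fix J assume J: "J \<in> subintervals {0<..<1::real}"
    obtain a b where ab: "0 \<le> a" "a < b" "b \<le> 1" "{a<..<b} \<subseteq> J" "J \<subseteq> {a..b}"
      using subintervals_endpoints[OF J] .
    define m where "m = (LINT x:{a<..<b}|lebesgue. - ln x) / (b - a)"
    have avJ: "avg J \<phi> = \<xi> * m" unfolding m_def by (rule av) (use ab J in \<open>auto simp: subintervals_def\<close>)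
    have "nnavg J (\<lambda>x. \<bar>\<phi> x - avg J \<phi>\<bar> powr p) = (\<integral>\<^sup>+x\<in>{a<..<b}. ennreal (\<bar>\<phi> x - avg J \<phi>\<bar> powr p) \<partial>lebesgue) / ennreal (b - a)"
      by (rule nnavg_open_interval[OF ab(4,5,2)])
    also have "(\<integral>\<^sup>+x\<in>{a<..<b}. ennreal (\<bar>\<phi> x - avg J \<phi>\<bar> powr p) \<partial>lebesgue)
       = (\<integral>\<^sup>+x. ennreal (\<xi> powr p) * (ennreal (\<bar>- ln x - m\<bar> powr p) * indicator {a<..<b} x) \<partial>lebesgue)"
    proof (rule nn_integral_cong)
      fix x :: real
      have "\<phi> x - avg J \<phi> = \<xi> * (- ln x - m)" by (simp add: avJ \<phi>_def algebra_simps)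
      then have "\<bar>\<phi> x - avg J \<phi>\<bar> powr p = \<xi> powr p * \<bar>- ln x - m\<bar> powr p"
        using \<xi> by (simp add: abs_mult powr_mult)
      then show "ennreal (\<bar>\<phi> x - avg J \<phi>\<bar> powr p) * indicator {a<..<b} x = ennreal (\<xi> powr p) * (ennreal (\<bar>- ln x - m\<bar> powr p) * indicator {a<..<b} x)"
        by (simp add: ennreal_mult mult.assoc)
    qed
    also have "\<dots> = ennreal (\<xi> powr p) * (\<integral>\<^sup>+x\<in>{a<..<b}. ennreal (\<bar>- ln x - m\<bar> powr p) \<partial>lebesgue)"
      unfolding nn_integral_completion by (rule nn_integral_cmult) simp
    also have "\<dots> / ennreal (b - a) = ennreal (\<xi> powr p) * ((\<integral>\<^sup>+x\<in>{a<..<b}. ennreal (\<bar>- ln x - m\<bar> powr p) \<partial>lebesgue) / ennreal (b - a))"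
      by (simp add: ennreal_times_divide)
    also have "\<dots> \<le> ennreal (\<xi> powr p) * ennreal (log_moment p)"
      unfolding m_def using ab by (intro mult_left_mono log_oscillation_le p) auto
    finally show "nnavg J (\<lambda>x. \<bar>\<phi> x - avg J \<phi>\<bar> powr p) \<le> ennreal (\<xi> powr p * log_moment p)"
      using log_moment_pos[OF p] by (simp add: ennreal_mult)
  qed
  have bmo: "\<phi> \<in> bmo p {0<..<1}"
  proof -
    have "locally_integrable {0<..<1} \<phi>"
      unfolding locally_integrable_def
    proof safe
      fix K :: "real set" assume "compact K" "K \<subseteq> {0<..<1}"
      then show "\<phi> absolutely_integrable_on K"
        by (intro set_integrable_subset[OF int]) (auto intro: lmeasurable_compact fmeasurableD)
    qed
    moreover have "bmo_norm p {0<..<1} \<phi> < \<infinity>" using norm le_less_trans by (metis ennreal_less_top infinity_ennreal_def)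
    ultimately show ?thesis by (simp add: bmo_def)
  qed
  show ?thesis
    unfolding jn_C_def
  proof (rule Inf_greatest, clarify)
    fix C :: ennreal assume "1 \<le> C" "jn_admissible ?e p C"
    then have le: "nnavg {0<..<1} (\<lambda>x. exp (\<phi> x)) \<le> C * ennreal (exp (avg {0<..<1} \<phi>))"
      unfolding jn_admissible_def using bmo norm open_interval_subinterval[of 0 1] by auto
    have "avg {0<..<1} \<phi> = \<xi> * ((LINT x:{0<..<1}|lebesgue. - ln x) / (1 - 0))"
      by (rule av) auto
    also have "(LINT x:{0<..<1::real}|lebesgue. - ln x) = 1"
      unfolding set_lebesgue_integral_eq_integral(2)[OF neg_ln_has_integral(2)] by (rule integral_unique[OF neg_ln_has_integral(1)])
    finally have a: "avg {0<..<1} \<phi> = \<xi>" by simp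
    have "((\<lambda>x. x powr (- \<xi>)) has_integral (1 powr (- \<xi> + 1) / (- \<xi> + 1))) {0..1::real}"
      by (rule has_integral_powr_from_0) (use \<xi> in auto)
    then have "((\<lambda>x. x powr (- \<xi>)) has_integral (1 / (1 - \<xi>))) {0<..<1::real}"
      by (simp add: has_integral_Icc_iff_Ioo)
    then have "((\<lambda>x. exp (\<phi> x)) has_integral (1 / (1 - \<xi>))) {0<..<1::real}"
      by (rule has_integral_eq[rotated]) (auto simp: \<phi>_def powr_def)
    from nn_integral_has_integral_lebesgue'[OF _ this]
    have "(\<integral>\<^sup>+x\<in>{0<..<1}. ennreal (exp (\<phi> x)) \<partial>lebesgue) = ennreal (1 / (1 - \<xi>))"
      unfolding nn_integral_completion by simp
    then have "nnavg {0<..<1} (\<lambda>x. exp (\<phi> x)) = ennreal (1 / (1 - \<xi>))" by (simp add: nnavg_def divide_ennreal_def)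
    with le a have "ennreal (1 / (1 - \<xi>)) \<le> C * ennreal (exp \<xi>)" by simp
    then have "ennreal (1 / (1 - \<xi>)) * ennreal (exp (- \<xi>)) \<le> C * ennreal (exp \<xi>) * ennreal (exp (- \<xi>))"
      by (intro mult_right_mono) auto
    also have "\<dots> = C" by (simp add: mult.assoc flip: ennreal_mult exp_add)
    also have "ennreal (1 / (1 - \<xi>)) * ennreal (exp (- \<xi>)) = ennreal (exp (- \<xi>) / (1 - \<xi>))"
      using \<xi> by (simp flip: ennreal_mult)
    finally show "ennreal (exp (- \<xi>) / (1 - \<xi>)) \<le> C" .
  qed
qed

text \<open>A finite oscillation of order \<open>p \<ge> 1\<close> about some constant on the whole
  unit interval bounds the integral of \<open>\<bar>\<phi> x\<bar>\<close>. The argument works for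
  any constant \<open>c\<close>, so the value of \<open>avg\<close> before integrability is known
  does no harm.\<close>

lemma bmo_integrable:
  assumes p: "p \<ge> 1" and \<phi>: "\<phi> \<in> bmo p {0<..<1}"
  shows "integrable lebesgue (\<lambda>x. indicator {0<..<1} x * \<phi> x)"
proof -
  define f where "f x = indicator {0<..<1} x * \<phi> x" for x
  have [measurable]: "f \<in> borel_measurable lebesgue"
  proof (rule borel_measurable_LIMSEQ_real)
    \<comment> \<open>Local integrability gives measurability only on compact subsets, so the open
      interval is exhausted by the intervals \<open>K n\<close>.\<close>
    define q where "q n = 1 / (real n + 2)" for n
    have q: "q n > 0" for n by (simp add: q_def)
    define K where "K n = {q n .. 1 - q n}" for n
    show "(\<lambda>x. indicator (K n) x * \<phi> x) \<in> borel_measurable lebesgue" for n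
    proof -
      have "K n \<subseteq> {0<..<1}"
      proof
        fix x assume "x \<in> K n"
        then show "x \<in> {0<..<1}" using q[of n] unfolding K_def by auto
      qed
      moreover have "compact (K n)" by (simp add: K_def)
      ultimately have "\<phi> absolutely_integrable_on K n"
        using \<phi> by (simp add: bmo_def locally_integrable_def)
      then show ?thesis unfolding set_integrable_def by auto
    qed
    fix x :: real
    show "(\<lambda>n. indicator (K n) x * \<phi> x) \<longlonglongrightarrow> f x"
    proof (cases "x \<in> {0<..<1}")
      case True
      have "q \<longlonglongrightarrow> 0" unfolding q_def by real_asymp
      moreover have "min x (1 - x) > 0" using True by auto
      ultimately have "\<forall>\<^sub>F n in sequentially. q n < min x (1 - x)" by (rule order_tendstoD)
      then have "\<forall>\<^sub>F n in sequentially. f x = indicator (K n) x * \<phi> x"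
        by eventually_elim (use True in \<open>auto simp: f_def K_def\<close>)
      then show ?thesis by (rule Lim_transform_eventually[OF tendsto_const])
    next
      case False
      have "x \<notin> K n" for n
      proof
        assume "x \<in> K n"
        then show False using False q[of n] unfolding K_def by auto
      qed
      then show ?thesis using False by (simp add: f_def)
    qed
  qed
  define c where "c = avg {0<..<1} \<phi>"
  have "epowr (nnavg {0<..<1} (\<lambda>x. \<bar>\<phi> x - c\<bar> powr p)) (1 / p) \<le> bmo_norm p {0<..<1} \<phi>"
    unfolding bmo_norm_def c_def using open_interval_subinterval[of 0 1] by (intro SUP_upper) simp
  then have "epowr (nnavg {0<..<1} (\<lambda>x. \<bar>\<phi> x - c\<bar> powr p)) (1 / p) < \<infinity>"
    using \<phi> by (simp add: bmo_def le_less_trans)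
  then have "nnavg {0<..<1} (\<lambda>x. \<bar>\<phi> x - c\<bar> powr p) < \<infinity>"
    by (auto simp: epowr_def less_top split: if_splits)
  then have fin: "(\<integral>\<^sup>+x\<in>{0<..<1}. ennreal (\<bar>\<phi> x - c\<bar> powr p) \<partial>lebesgue) < \<infinity>"
    by (simp add: nnavg_def divide_ennreal_def)
  have bound: "\<bar>\<phi> x\<bar> \<le> (\<bar>c\<bar> + 1) + \<bar>\<phi> x - c\<bar> powr p" for x
  proof -
    have "\<bar>\<phi> x - c\<bar> \<le> 1 + \<bar>\<phi> x - c\<bar> powr p"
    proof (cases "\<bar>\<phi> x - c\<bar> \<le> 1")
      case False
      then have "\<bar>\<phi> x - c\<bar> powr 1 \<le> \<bar>\<phi> x - c\<bar> powr p" using p by (intro powr_mono) auto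
      then show ?thesis using False by simp
    qed (simp add: add_increasing2)
    then show ?thesis by linarith
  qed
  have "(\<integral>\<^sup>+x. ennreal (norm (f x)) \<partial>lebesgue) \<le> (\<integral>\<^sup>+x. ennreal (\<bar>c\<bar> + 1) * indicator {0<..<1} x + ennreal (\<bar>\<phi> x - c\<bar> powr p) * indicator {0<..<1} x \<partial>lebesgue)"
  proof (rule nn_integral_mono)
    fix x :: real
    show "ennreal (norm (f x)) \<le> ennreal (\<bar>c\<bar> + 1) * indicator {0<..<1} x + ennreal (\<bar>\<phi> x - c\<bar> powr p) * indicator {0<..<1} x"
      using ennreal_leI[OF bound[of x]] by (auto simp: f_def indicator_def ennreal_plus simp del: ennreal_plus_if)
  qed
  also have "\<dots> = (\<integral>\<^sup>+x. ennreal (\<bar>c\<bar> + 1) * indicator {0<..<1::real} x \<partial>lebesgue) + (\<integral>\<^sup>+x\<in>{0<..<1}. ennreal (\<bar>\<phi> x - c\<bar> powr p) \<partial>lebesgue)"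
  proof (rule nn_integral_add)
    have "(\<lambda>x. ennreal (\<bar>f x - c\<bar> powr p)) \<in> borel_measurable lebesgue" by measurable
    then have "(\<lambda>x. ennreal (\<bar>f x - c\<bar> powr p) * indicator {0<..<1} x) \<in> borel_measurable lebesgue"
      by (intro borel_measurable_times_ennreal borel_measurable_indicator) auto
    moreover have "(\<lambda>x. ennreal (\<bar>f x - c\<bar> powr p) * indicator {0<..<1} x) = (\<lambda>x. ennreal (\<bar>\<phi> x - c\<bar> powr p) * indicator {0<..<1} x)"
      by (auto simp: f_def indicator_def)
    ultimately show "(\<lambda>x. ennreal (\<bar>\<phi> x - c\<bar> powr p) * indicator {0<..<1} x) \<in> borel_measurable lebesgue" by simp
    show "(\<lambda>x. ennreal (\<bar>c\<bar> + 1) * indicator {0<..<1::real} x) \<in> borel_measurable lebesgue"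
      by (intro borel_measurable_times_ennreal borel_measurable_indicator) auto
  qed
  also have "(\<integral>\<^sup>+x. ennreal (\<bar>c\<bar> + 1) * indicator {0<..<1::real} x \<partial>lebesgue) = ennreal (\<bar>c\<bar> + 1) * emeasure lebesgue {0<..<1::real}"
    by (rule nn_integral_cmult_indicator) simp
  also have "\<dots> + (\<integral>\<^sup>+x\<in>{0<..<1}. ennreal (\<bar>\<phi> x - c\<bar> powr p) \<partial>lebesgue) < \<infinity>"
    using fin by (simp add: ennreal_mult_less_top)
  finally show ?thesis unfolding f_def[abs_def, symmetric] by (intro integrableI_bounded) auto
qed

section \<open>Upper bounds for the best constant\<close>

text \<open>The supporting planes are affine in the average of the exponential. \<open>B\<close> is
  the value when this average reaches \<open>C\<close>, and \<open>\<tau>\<close> is the slope that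
  measures the loss when \<open>C\<close> is only nearly attained; its sign is left open.\<close>

definition A_infinity_lower_bound :: "real \<Rightarrow> real \<Rightarrow> real \<Rightarrow> real \<Rightarrow> bool" where
  "A_infinity_lower_bound p C B \<tau> \<longleftrightarrow>
    (\<forall>a b M (\<psi>::real \<Rightarrow> real). a < b \<longrightarrow> \<psi> absolutely_integrable_on {a..b} \<longrightarrow>
      (\<forall>x. \<bar>\<psi> x\<bar> \<le> M) \<longrightarrow>
      (\<forall>c d. a \<le> c \<longrightarrow> c < d \<longrightarrow> d \<le> b \<longrightarrow> integral {c..d} (\<lambda>x. exp (\<psi> x)) \<le> C * (d - c) * exp (integral {c..d} \<psi> / (d - c))) \<longrightarrow>
      integral {a..b} \<psi> = 0 \<longrightarrow>
      B + \<tau> * (integral {a..b} (\<lambda>x. exp (\<psi> x)) / (b - a) - C) \<le> integral {a..b} (\<lambda>x. \<bar>\<psi> x\<bar> powr p) / (b - a))"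

text \<open>The supremum \<open>C\<close> of the quotients \<open>R c d\<close> is finite because
  \<open>\<psi>\<close> is bounded. If it exceeded \<open>Cs\<close>, the lower bound with this very
  \<open>C\<close>, applied to the centered function on a nearly extremal interval, would contradict
  the small oscillation there.\<close>

lemma A_infinity_of_small_oscillation:
  fixes \<psi> :: "real \<Rightarrow> real"
  assumes Cs: "Cs \<ge> 1" and int: "integrable lebesgue \<psi>" and bd: "\<And>x. \<bar>\<psi> x\<bar> \<le> M"
    and osc: "\<And>c d. 0 \<le> c \<Longrightarrow> c < d \<Longrightarrow> d \<le> 1 \<Longrightarrow>
      integral {c..d} (\<lambda>x. \<bar>\<psi> x - integral {c..d} \<psi> / (d - c)\<bar> powr p) / (d - c) \<le> \<epsilon> powr p"
    and H: "\<And>C. C > Cs \<Longrightarrow> \<exists>B \<tau>. \<epsilon> powr p < B \<and> A_infinity_lower_bound p C B \<tau>"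
    and cd: "0 \<le> c0" "c0 < d0" "d0 \<le> 1"
  shows "integral {c0..d0} (\<lambda>x. exp (\<psi> x)) \<le> Cs * (d0 - c0) * exp (integral {c0..d0} \<psi> / (d0 - c0))"
proof -
  have ai: "\<psi> absolutely_integrable_on {c..d}" for c d
    unfolding set_integrable_def using integrable_mult_indicator[OF _ int, of "{c..d}"] by simp
  have ii: "(\<lambda>x. h (\<psi> x)) integrable_on {c..d}" if "continuous_on UNIV h" for h :: "real \<Rightarrow> real" and c d
    by (rule set_lebesgue_integral_eq_integral(1)[OF abs_integrable_comp[of c d \<psi> M h]]) (use ai bd that in auto)
  have ip: "\<psi> integrable_on {c..d}" for c d using ii[of "\<lambda>x. x"] by simp
  have ie: "(\<lambda>x. exp (\<psi> x)) integrable_on {c..d}" for c d using ii[of exp] by (simp add: continuous_on_exp)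
  define R where "R c d = integral {c..d} (\<lambda>x. exp (\<psi> x)) / (d - c) * exp (- (integral {c..d} \<psi> / (d - c)))" for c d
  define S where "S = {R c d | c d. 0 \<le> c \<and> c < d \<and> d \<le> 1}"
  have R_iff: "R c d \<le> C \<longleftrightarrow> integral {c..d} (\<lambda>x. exp (\<psi> x)) \<le> C * (d - c) * exp (integral {c..d} \<psi> / (d - c))" if "c < d" for c d C
    using that by (simp add: R_def exp_minus field_simps)
  have "bdd_above S"
  proof (rule bdd_aboveI[of _ "exp M * exp M"])
    fix y assume "y \<in> S"
    then obtain c d where y: "y = R c d" "c < d" by (auto simp: S_def)
    have "integral {c..d} (\<lambda>x. exp (\<psi> x)) \<le> integral {c..d} (\<lambda>x. exp M)"
      by (intro integral_le ie) (use bd in \<open>auto simp: abs_le_iff\<close>)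
    then have "integral {c..d} (\<lambda>x. exp (\<psi> x)) / (d - c) \<le> exp M" using y by (simp add: field_simps)
    moreover have "integral {c..d} (\<lambda>x. - M) \<le> integral {c..d} \<psi>"
      by (intro integral_le ip) (use bd in \<open>auto simp: abs_le_iff minus_le_iff\<close>)
    then have "- (integral {c..d} \<psi> / (d - c)) \<le> M" using y by (simp add: field_simps)
    moreover have "0 \<le> integral {c..d} (\<lambda>x. exp (\<psi> x)) / (d - c)"
      using y by (intro divide_nonneg_nonneg integral_nonneg ie) auto
    ultimately show "y \<le> exp M * exp M" unfolding y R_def by (intro mult_mono) auto
  qed
  define C where "C = Sup S"
  have SC: "R c d \<le> C" if "0 \<le> c" "c < d" "d \<le> 1" for c d
    unfolding C_def using that \<open>bdd_above S\<close> by (intro cSup_upper) (auto simp: S_def)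
  have "C \<le> Cs"
  proof (rule ccontr)
    assume "\<not> C \<le> Cs"
    then have CC: "C > Cs" by simp
    obtain B \<tau> where B: "\<epsilon> powr p < B" and main: "\<And>a b M (\<psi>::real \<Rightarrow> real). a < b \<Longrightarrow> \<psi> absolutely_integrable_on {a..b} \<Longrightarrow>
      (\<forall>x. \<bar>\<psi> x\<bar> \<le> M) \<Longrightarrow>
      (\<forall>c d. a \<le> c \<longrightarrow> c < d \<longrightarrow> d \<le> b \<longrightarrow> integral {c..d} (\<lambda>x. exp (\<psi> x)) \<le> C * (d - c) * exp (integral {c..d} \<psi> / (d - c))) \<Longrightarrow>
      integral {a..b} \<psi> = 0 \<Longrightarrow>
      B + \<tau> * (integral {a..b} (\<lambda>x. exp (\<psi> x)) / (b - a) - C) \<le> integral {a..b} (\<lambda>x. \<bar>\<psi> x\<bar> powr p) / (b - a)"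
      using H[OF CC] unfolding A_infinity_lower_bound_def by blast
    \<comment> \<open>Small enough that the defect term stays below the gap between \<open>B\<close>
      and \<open>\<epsilon> powr p\<close>; the added 1 avoids division by 0 when
      \<open>\<tau>\<close> vanishes.\<close>
    define \<eta> where "\<eta> = (B - \<epsilon> powr p) / (2 * (\<bar>\<tau>\<bar> + 1))"
    have \<eta>: "\<eta> > 0" using B by (simp add: \<eta>_def)
    have "R 0 1 \<in> S" unfolding S_def by (intro CollectI exI conjI refl) auto
    then have "S \<noteq> {}" by blast
    then obtain y where "y \<in> S" "C - \<eta> < y"
      using less_cSup_iff[OF _ \<open>bdd_above S\<close>, of "C - \<eta>"] \<eta> by (auto simp: C_def)
    then obtain c d where cd: "0 \<le> c" "c < d" "d \<le> 1" "C - \<eta> < R c d" by (auto simp: S_def)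
    define k where "k = integral {c..d} \<psi> / (d - c)"
    define \<zeta> where "\<zeta> x = \<psi> x - k" for x
    have zeta: "\<zeta> = (\<lambda>x. \<psi> x - k)" by (auto simp: \<zeta>_def)
    have intz: "integral {u..v} \<zeta> = integral {u..v} \<psi> - k * (v - u)" if "u \<le> v" for u v
      unfolding zeta using that by (subst Henstock_Kurzweil_Integration.integral_diff[OF ip]) auto
    have expz: "integral {u..v} (\<lambda>x. exp (\<zeta> x)) = exp (- k) * integral {u..v} (\<lambda>x. exp (\<psi> x))" for u v
      unfolding zeta exp_diff by (simp add: exp_minus field_simps)
    have "B + \<tau> * (integral {c..d} (\<lambda>x. exp (\<zeta> x)) / (d - c) - C) \<le> integral {c..d} (\<lambda>x. \<bar>\<zeta> x\<bar> powr p) / (d - c)"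
    proof (rule main[where M="M + \<bar>k\<bar>"])
      show "\<zeta> absolutely_integrable_on {c..d}"
        unfolding zeta by (rule abs_integrable_comp[of c d \<psi> M "\<lambda>x. x - k"]) (use ai bd in \<open>auto intro!: continuous_intros\<close>)
      show "\<forall>x. \<bar>\<zeta> x\<bar> \<le> M + \<bar>k\<bar>"
      proof
        fix x show "\<bar>\<zeta> x\<bar> \<le> M + \<bar>k\<bar>" using bd[of x] unfolding \<zeta>_def by linarith
      qed
      show "\<forall>u v. c \<le> u \<longrightarrow> u < v \<longrightarrow> v \<le> d \<longrightarrow> integral {u..v} (\<lambda>x. exp (\<zeta> x)) \<le> C * (v - u) * exp (integral {u..v} \<zeta> / (v - u))"
      proof (intro allI impI)
        fix u v assume uv: "c \<le> u" "u < v" "v \<le> d"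
        have "integral {u..v} (\<lambda>x. exp (\<psi> x)) \<le> C * (v - u) * exp (integral {u..v} \<psi> / (v - u))"
          using SC[of u v] R_iff[OF uv(2)] uv cd by simp
        then have "exp (- k) * integral {u..v} (\<lambda>x. exp (\<psi> x)) \<le> exp (- k) * (C * (v - u) * exp (integral {u..v} \<psi> / (v - u)))"
          by (rule mult_left_mono) simp
        also have "\<dots> = C * (v - u) * (exp (integral {u..v} \<psi> / (v - u)) * exp (- k))" by simp
        also have "exp (integral {u..v} \<psi> / (v - u)) * exp (- k) = exp (integral {u..v} \<zeta> / (v - u))"
          using uv by (simp add: intz diff_divide_distrib mult_exp_exp)
        finally show "integral {u..v} (\<lambda>x. exp (\<zeta> x)) \<le> C * (v - u) * exp (integral {u..v} \<zeta> / (v - u))"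
          unfolding expz .
      qed
      show "integral {c..d} \<zeta> = 0" using cd by (simp add: intz k_def)
    qed (use cd in auto)
    moreover have "integral {c..d} (\<lambda>x. exp (\<zeta> x)) / (d - c) = R c d"
      by (simp add: expz R_def k_def)
    moreover have "integral {c..d} (\<lambda>x. \<bar>\<zeta> x\<bar> powr p) / (d - c) \<le> \<epsilon> powr p"
      using osc[OF cd(1-3)] by (simp add: \<zeta>_def k_def)
    moreover have "\<tau> * (R c d - C) \<ge> - (\<bar>\<tau>\<bar> * \<eta>)"
    proof -
      have "\<bar>R c d - C\<bar> \<le> \<eta>" using cd SC[OF cd(1-3)] by auto
      then have "\<bar>\<tau> * (R c d - C)\<bar> \<le> \<bar>\<tau>\<bar> * \<eta>" unfolding abs_mult by (intro mult_left_mono) auto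
      then show ?thesis by linarith
    qed
    moreover have "\<bar>\<tau>\<bar> * \<eta> < B - \<epsilon> powr p"
    proof -
      have "\<bar>\<tau>\<bar> * \<eta> \<le> (\<bar>\<tau>\<bar> + 1) * \<eta>" using \<eta> by (intro mult_right_mono) auto
      also have "\<dots> = (B - \<epsilon> powr p) / 2"
      proof -
        have "t * (X / (2 * t)) = X / 2" if "t > 0" for t X :: real using that by simp
        from this[of "\<bar>\<tau>\<bar> + 1" "B - \<epsilon> powr p"] show ?thesis unfolding \<eta>_def by linarith
      qed
      also have "\<dots> < B - \<epsilon> powr p" using B by simp
      finally show ?thesis .
    qed
    ultimately show False by simp
  qed
  then have "R c0 d0 \<le> Cs" using SC[OF cd] by simp
  then show ?thesis using R_iff cd by simp
qed

text \<open>Two-sided truncations are bounded and keep the oscillation bound, so the preceding lemma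
  applies to them with a constant independent of \<open>n\<close>. In the limit the exponentials are
  controlled by Fatou and the averages by dominated convergence.\<close>

lemma jn_C_le:
  assumes p: "p \<ge> 1" and \<epsilon>: "\<epsilon> \<ge> 0" and Cs: "Cs \<ge> 1"
    and H: "\<And>C. C > Cs \<Longrightarrow> \<exists>B \<tau>. \<epsilon> powr p < B \<and> A_infinity_lower_bound p C B \<tau>"
  shows "jn_C \<epsilon> p \<le> ennreal Cs"
proof -
  have "jn_admissible \<epsilon> p (ennreal Cs)"
    unfolding jn_admissible_def
  proof (intro ballI impI)
    fix \<phi> J assume \<phi>: "\<phi> \<in> bmo p {0<..<1}" "bmo_norm p {0<..<1} \<phi> \<le> ennreal \<epsilon>" and J: "J \<in> subintervals {0<..<1::real}"
    define f where "f x = indicator {0<..<1} x * \<phi> x" for x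
    have f: "integrable lebesgue f" unfolding f_def by (rule bmo_integrable[OF p \<phi>(1)])
    have [measurable]: "f \<in> borel_measurable lebesgue" using f by simp
    have avf: "avg K f = avg K \<phi>" if "K \<subseteq> {0<..<1}" "K \<in> sets lebesgue" for K
      unfolding avg_def using that
      by (intro arg_cong2[where f="(/)"] set_lebesgue_integral_cong) (auto simp: f_def indicator_def)
    have nnf: "nnavg K (\<lambda>x. h (f x)) = nnavg K (\<lambda>x. h (\<phi> x))" if "K \<subseteq> {0<..<1}" for K and h :: "real \<Rightarrow> real"
      unfolding nnavg_def using that
      by (intro arg_cong2[where f="(/)"] nn_integral_cong) (auto simp: f_def indicator_def)
    define \<psi> where "\<psi> n x = max (min (f x) (real n)) (- real n)" for n x
    have \<psi>f: "\<bar>\<psi> n x\<bar> \<le> \<bar>f x\<bar>" and \<psi>bd: "\<bar>\<psi> n x\<bar> \<le> real n" for n x by (auto simp: \<psi>_def max_def min_def)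
    have \<psi>m[measurable]: "\<psi> n \<in> borel_measurable lebesgue" for n unfolding \<psi>_def by measurable
    have \<psi>i: "integrable lebesgue (\<psi> n)" for n
      by (rule Bochner_Integration.integrable_bound[OF f \<psi>m]) (use \<psi>f in auto)
    have si: "set_integrable lebesgue K h" if "integrable lebesgue h" "K \<in> sets lebesgue" for K and h :: "real \<Rightarrow> real"
      unfolding set_integrable_def using integrable_mult_indicator[OF that(2,1)] .
    have subm: "K \<in> sets lebesgue" "K \<subseteq> {0<..<1}" if K: "K \<in> subintervals {0<..<1::real}" for K
    proof -
      obtain a b where ab: "{a<..<b} \<subseteq> K" "K \<subseteq> {a..b}" using subintervals_endpoints[OF K] by metis
      show "K \<in> sets lebesgue" by (rule subinterval_null_diff(2)[OF ab])
      show "K \<subseteq> {0<..<1}" using K by (simp add: subintervals_def)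
    qed
    have osc: "nnavg K (\<lambda>x. \<bar>\<psi> n x - avg K (\<psi> n)\<bar> powr p) \<le> ennreal (\<epsilon> powr p)" if K: "K \<in> subintervals {0<..<1}" for K n
    proof -
      define g where "g x = min (f x) (real n)" for x
      have gm: "g \<in> borel_measurable lebesgue" unfolding g_def by measurable
      have g: "integrable lebesgue g"
        by (rule Bochner_Integration.integrable_bound[OF f gm]) (auto simp: g_def min_def)
      have "nnavg K (\<lambda>x. \<bar>\<psi> n x - avg K (\<psi> n)\<bar> powr p) \<le> nnavg K (\<lambda>x. \<bar>g x - avg K g\<bar> powr p)"
        by (rule nnavg_truncation_le[OF p K si[OF g] si[OF \<psi>i], where T="- real n"])
           (use subm[OF K] in \<open>auto simp: \<psi>_def g_def\<close>)
      also have "\<dots> \<le> nnavg K (\<lambda>x. \<bar>f x - avg K f\<bar> powr p)"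
        by (rule nnavg_truncation_le[OF p K si[OF f] si[OF g], where T="real n"])
           (use subm[OF K] in \<open>auto simp: g_def\<close>)
      also have "\<dots> = nnavg K (\<lambda>x. \<bar>\<phi> x - avg K \<phi>\<bar> powr p)"
        unfolding avf[OF subm(2)[OF K] subm(1)[OF K]]
        by (rule nnf[OF subm(2)[OF K], of "\<lambda>t. \<bar>t - avg K \<phi>\<bar> powr p"])
      also have "\<dots> \<le> ennreal (\<epsilon> powr p)" using \<phi>(2) K unfolding bmo_norm_le_iff[OF p \<epsilon>] by blast
      finally show ?thesis .
    qed
    have lint: "(LINT x:{c<..<d}|lebesgue. h x) = integral {c..d} h" if "integrable lebesgue h" for c d and h :: "real \<Rightarrow> real"
    proof -
      have "(LINT x:{c<..<d}|lebesgue. h x) = integral {c<..<d} h"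
        by (rule set_lebesgue_integral_eq_integral(2)[OF si[OF that]]) simp
      also have "\<dots> = integral {c..d} h" using integral_open_interval_real[of c d h] by simp
      finally show ?thesis .
    qed
    have av: "avg K h = integral {c..d} h / (d - c)" if "integrable lebesgue h" "{c<..<d} \<subseteq> K" "K \<subseteq> {c..d}" "c < d" for c d K and h :: "real \<Rightarrow> real"
    proof -
      have "set_borel_measurable lebesgue K h"
        using si[OF that(1) subinterval_null_diff(2)[OF that(2,3)]] unfolding set_integrable_def set_borel_measurable_def by auto
      from avg_open_interval[OF that(2,3,4) this] show ?thesis unfolding lint[OF that(1)] .
    qed
    have nnint: "(\<integral>\<^sup>+x\<in>{c<..<d}. ennreal (h (\<psi> n x)) \<partial>lebesgue) = ennreal (integral {c..d} (\<lambda>x. h (\<psi> n x)))"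
      if h: "continuous_on UNIV h" "\<And>y. h y \<ge> 0" for c d n and h :: "real \<Rightarrow> real"
    proof -
      have "(\<lambda>x. h (\<psi> n x)) absolutely_integrable_on {c..d}"
        by (rule abs_integrable_comp[of c d "\<psi> n" "real n" h]) (use si[OF \<psi>i] \<psi>bd h in auto)
      then have "((\<lambda>x. h (\<psi> n x)) has_integral integral {c..d} (\<lambda>x. h (\<psi> n x))) {c..d}"
        using set_lebesgue_integral_eq_integral(1) by blast
      then have "((\<lambda>x. h (\<psi> n x)) has_integral integral {c..d} (\<lambda>x. h (\<psi> n x))) {c<..<d}"
        by (simp add: has_integral_Icc_iff_Ioo)
      from nn_integral_has_integral_lebesgue'[OF h(2) this] show ?thesis
        unfolding nn_integral_completion .
    qed
    have A: "integral {c..d} (\<lambda>x. exp (\<psi> n x)) \<le> Cs * (d - c) * exp (integral {c..d} (\<psi> n) / (d - c))"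
      if "0 \<le> c" "c < d" "d \<le> 1" for c d n
    proof (rule A_infinity_of_small_oscillation[OF Cs \<psi>i \<psi>bd _ H that])
      fix c d :: real assume cd: "0 \<le> c" "c < d" "d \<le> 1"
      let ?k = "integral {c..d} (\<psi> n) / (d - c)"
      have "avg {c<..<d} (\<psi> n) = ?k" by (rule av[OF \<psi>i]) (use cd in auto)
      then have "nnavg {c<..<d} (\<lambda>x. \<bar>\<psi> n x - ?k\<bar> powr p) \<le> ennreal (\<epsilon> powr p)"
        using osc[OF open_interval_subinterval[OF cd], of n] by simp
      moreover have "nnavg {c<..<d} (\<lambda>x. \<bar>\<psi> n x - ?k\<bar> powr p) = (\<integral>\<^sup>+x\<in>{c<..<d}. ennreal (\<bar>\<psi> n x - ?k\<bar> powr p) \<partial>lebesgue) / ennreal (d - c)"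
        by (rule nnavg_open_interval) (use cd in auto)
      moreover have "(\<integral>\<^sup>+x\<in>{c<..<d}. ennreal (\<bar>\<psi> n x - ?k\<bar> powr p) \<partial>lebesgue) = ennreal (integral {c..d} (\<lambda>x. \<bar>\<psi> n x - ?k\<bar> powr p))"
      proof (rule nnint[of "\<lambda>t. \<bar>t - ?k\<bar> powr p"])
        show "continuous_on UNIV (\<lambda>t. \<bar>t - ?k\<bar> powr p)"
          by (rule continuous_on_powr') (use p in \<open>auto intro!: continuous_intros\<close>)
      qed simp
      moreover have "integral {c..d} (\<lambda>x. \<bar>\<psi> n x - ?k\<bar> powr p) \<ge> 0"
        by (cases "(\<lambda>x. \<bar>\<psi> n x - ?k\<bar> powr p) integrable_on {c..d}") (auto intro: integral_nonneg simp: not_integrable_integral)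
      ultimately show "integral {c..d} (\<lambda>x. \<bar>\<psi> n x - ?k\<bar> powr p) / (d - c) \<le> \<epsilon> powr p"
        using cd by (simp add: divide_ennreal)
    qed
    obtain a b where ab: "0 \<le> a" "a < b" "b \<le> 1" "{a<..<b} \<subseteq> J" "J \<subseteq> {a..b}"
      using subintervals_endpoints[OF J] .
    have conv: "(\<lambda>n. \<psi> n x) \<longlonglongrightarrow> f x" for x
    proof -
      obtain N where N: "\<bar>f x\<bar> \<le> real N" using real_arch_simple by blast
      have "\<forall>\<^sub>F n in sequentially. f x = \<psi> n x"
        using eventually_ge_at_top[of N]
      proof eventually_elim
        fix n assume "N \<le> n"
        then have "\<bar>f x\<bar> \<le> real n" using N by simp
        then show "f x = \<psi> n x" by (auto simp: \<psi>_def max_def min_def)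
      qed
      then show ?thesis by (rule Lim_transform_eventually[OF tendsto_const])
    qed
    have "(\<lambda>n. LINT x:{a<..<b}|lebesgue. \<psi> n x) \<longlonglongrightarrow> (LINT x:{a<..<b}|lebesgue. f x)"
      unfolding set_lebesgue_integral_def
    proof (rule integral_dominated_convergence[where w="\<lambda>x. indicator {a<..<b} x *\<^sub>R \<bar>f x\<bar>"])
      show "integrable lebesgue (\<lambda>x. indicator {a<..<b} x *\<^sub>R \<bar>f x\<bar>)"
        using f by (intro integrable_mult_indicator) auto
      show "(\<lambda>x. indicator {a<..<b} x *\<^sub>R f x) \<in> borel_measurable lebesgue"
        by (rule borel_measurable_integrable[OF integrable_mult_indicator[OF _ f]]) simp
      show "(\<lambda>x. indicator {a<..<b} x *\<^sub>R \<psi> n x) \<in> borel_measurable lebesgue" for n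
        by (rule borel_measurable_integrable[OF integrable_mult_indicator[OF _ \<psi>i]]) simp
      show "AE x in lebesgue. (\<lambda>n. indicator {a<..<b} x *\<^sub>R \<psi> n x) \<longlonglongrightarrow> indicator {a<..<b} x *\<^sub>R f x"
        by (intro AE_I2 tendsto_scaleR tendsto_const conv)
      show "AE x in lebesgue. norm (indicator {a<..<b} x *\<^sub>R \<psi> n x) \<le> indicator {a<..<b} x *\<^sub>R \<bar>f x\<bar>" for n
        using \<psi>f by (intro AE_I2) (auto simp: indicator_def)
    qed
    then have Iconv: "(\<lambda>n. integral {a..b} (\<psi> n)) \<longlonglongrightarrow> integral {a..b} f"
      unfolding lint[OF f] lint[OF \<psi>i] .
    have lim: "(\<lambda>n. Cs * (b - a) * exp (integral {a..b} (\<psi> n) / (b - a))) \<longlonglongrightarrow> Cs * (b - a) * exp (integral {a..b} f / (b - a))"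
      using ab by (intro tendsto_intros Iconv) auto
    have "(\<integral>\<^sup>+x\<in>{a<..<b}. ennreal (exp (f x)) \<partial>lebesgue) = (\<integral>\<^sup>+x. liminf (\<lambda>n. ennreal (exp (\<psi> n x)) * indicator {a<..<b} x) \<partial>lebesgue)"
    proof (rule nn_integral_cong)
      fix x :: real
      have "(\<lambda>n. ennreal (exp (\<psi> n x)) * indicator {a<..<b} x) \<longlonglongrightarrow> ennreal (exp (f x)) * indicator {a<..<b} x"
      proof (cases "x \<in> {a<..<b}")
        case True
        then show ?thesis by (simp add: tendsto_exp conv tendsto_ennrealI)
      qed simp
      then show "ennreal (exp (f x)) * indicator {a<..<b} x = liminf (\<lambda>n. ennreal (exp (\<psi> n x)) * indicator {a<..<b} x)"
        by (simp add: lim_imp_Liminf)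
    qed
    also have "\<dots> \<le> liminf (\<lambda>n. \<integral>\<^sup>+x\<in>{a<..<b}. ennreal (exp (\<psi> n x)) \<partial>lebesgue)"
    proof (rule nn_integral_liminf)
      fix n
      have "(\<lambda>x. ennreal (exp (\<psi> n x))) \<in> borel_measurable lebesgue" by measurable
      then show "(\<lambda>x. ennreal (exp (\<psi> n x)) * indicator {a<..<b} x) \<in> borel_measurable lebesgue"
        by (intro borel_measurable_times_ennreal borel_measurable_indicator) auto
    qed
    also have "\<dots> \<le> liminf (\<lambda>n. ennreal (Cs * (b - a) * exp (integral {a..b} (\<psi> n) / (b - a))))"
    proof (intro Liminf_mono always_eventually allI)
      fix n
      have "(\<integral>\<^sup>+x\<in>{a<..<b}. ennreal (exp (\<psi> n x)) \<partial>lebesgue) = ennreal (integral {a..b} (\<lambda>x. exp (\<psi> n x)))"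
        by (rule nnint) (auto intro!: continuous_intros)
      also have "\<dots> \<le> ennreal (Cs * (b - a) * exp (integral {a..b} (\<psi> n) / (b - a)))"
        by (intro ennreal_leI A ab)
      finally show "(\<integral>\<^sup>+x\<in>{a<..<b}. ennreal (exp (\<psi> n x)) \<partial>lebesgue) \<le> ennreal (Cs * (b - a) * exp (integral {a..b} (\<psi> n) / (b - a)))" .
    qed
    also have "\<dots> = ennreal (Cs * (b - a) * exp (integral {a..b} f / (b - a)))"
      by (intro lim_imp_Liminf tendsto_ennrealI lim) simp
    finally have le: "(\<integral>\<^sup>+x\<in>{a<..<b}. ennreal (exp (f x)) \<partial>lebesgue) \<le> ennreal (Cs * (b - a) * exp (integral {a..b} f / (b - a)))" .
    have avJ: "avg J \<phi> = integral {a..b} f / (b - a)"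
      unfolding avf[OF subm(2)[OF J] subm(1)[OF J], symmetric] by (rule av[OF f ab(4,5,2)])
    have "nnavg J (\<lambda>x. exp (\<phi> x)) = nnavg J (\<lambda>x. exp (f x))" by (rule nnf[OF subm(2)[OF J], symmetric])
    also have "\<dots> = (\<integral>\<^sup>+x\<in>{a<..<b}. ennreal (exp (f x)) \<partial>lebesgue) / ennreal (b - a)"
      by (rule nnavg_open_interval[OF ab(4,5,2)])
    also have "\<dots> \<le> ennreal (Cs * (b - a) * exp (avg J \<phi>)) / ennreal (b - a)"
      unfolding avJ by (rule divide_right_mono_ennreal[OF le])
    also have "\<dots> = ennreal Cs * ennreal (exp (avg J \<phi>))"
      using ab Cs by (simp add: divide_ennreal flip: ennreal_mult)
    finally show "nnavg J (\<lambda>x. exp (\<phi> x)) \<le> ennreal Cs * ennreal (exp (avg J \<phi>))" .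
  qed
  then show ?thesis unfolding jn_C_def using Cs by (intro Inf_lower) (simp flip: ennreal_1)
qed

text \<open>Any \<open>C\<close> above the claimed value has \<open>\<xi> = xi_plus C\<close> above
  \<open>s\<close>, hence in the range where the planes support. The plane touching over the mean 0
  has the value \<open>log_moment p\<close> at height \<open>C\<close>; undoing the scaling by
  \<open>\<xi>\<close> gives \<open>B = \<xi> powr p * log_moment p\<close>, which exceeds the
  oscillation allowed by \<open>s\<close>.\<close>

lemma jn_C_power_le:
  assumes p: "1 < p" "p \<le> 2" and s: "2 - p \<le> s" "0 \<le> s" "s < 1"
  shows "jn_C (s * log_moment p powr (1 / p)) p \<le> ennreal (exp (- s) / (1 - s))"
proof (rule jn_C_le)
  define e0 where "e0 = log_moment p powr (1 / p)"
  have lm: "log_moment p > 0" using log_moment_pos[of p] p by simp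
  have e0: "e0 > 0" "e0 powr p = log_moment p" using lm p by (auto simp: e0_def powr_powr)
  show "1 \<le> p" using p by simp
  show "0 \<le> s * log_moment p powr (1 / p)" using s by simp
  show K1: "1 \<le> exp (- s) / (1 - s)"
    using s exp_ge_add_one_self[of "- s"] by (simp add: field_simps)
  fix C assume C: "C > exp (- s) / (1 - s)"
  then have C1: "C > 1" using K1 by linarith
  define \<xi> where "\<xi> = xi_plus C"
  have xi: "0 < \<xi>" "\<xi> < 1" "exp (- \<xi>) = C * (1 - \<xi>)" using xi_plus[of C] xi_plus_pos[of C] C1 by (auto simp: \<xi>_def)
  have CK: "exp (- \<xi>) / (1 - \<xi>) = C" using xi by (simp add: field_simps)
  have "s < \<xi>"
  proof (rule ccontr)
    assume "\<not> s < \<xi>"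
    then have "(1 - s) * exp s \<le> (1 - \<xi>) * exp \<xi>"
      using one_minus_exp_strict_antimono[of \<xi> s] xi by (cases "s = \<xi>") auto
    moreover have "(1 - \<xi>) * exp \<xi> = 1 / C" using xi_equation_iff[of C \<xi>] xi C1 by simp
    moreover have "1 / C < (1 - s) * exp s" using C s C1 by (simp add: exp_minus field_simps)
    ultimately show False by simp
  qed
  then have xi2: "2 - p \<le> \<xi>" using s by simp
  define u where "u = upper_dual p \<xi> (-1)"
  have sp: "support_plane p \<xi> (-1) 0 w = log_moment p + p * u * (w - C)" for w
  proof -
    have "tangent_line \<xi> (-1) 0 = exp (- \<xi>) / (1 - \<xi>)"
      using xi by (simp add: tangent_line_def field_simps)
    moreover have "tangent_slope p (-1) = (Gamma p - integral {0..1} (\<lambda>t. t powr (p - 1) * exp t)) / exp 1"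
    proof -
      have "powg 1 p 1 = integral {0..1} (\<lambda>t. t powr (p - 1) * exp t)" by (simp add: powg_def)
      then show ?thesis by (simp add: tangent_slope_def powg_neg exp_minus divide_inverse mult.commute)
    qed
    ultimately show ?thesis unfolding support_plane_def u_def CK[symmetric]
      by (simp add: log_moment_def)
  qed
  show "\<exists>B \<tau>. (s * log_moment p powr (1 / p)) powr p < B \<and> A_infinity_lower_bound p C B \<tau>"
    unfolding A_infinity_lower_bound_def
  proof (rule exI[of _ "\<xi> powr p * log_moment p"], rule exI[of _ "\<xi> powr p * (p * u)"], intro conjI allI impI)
    have "s powr p < \<xi> powr p" using \<open>s < \<xi>\<close> s p by (intro powr_less_mono2) auto
    then show "(s * log_moment p powr (1 / p)) powr p < \<xi> powr p * log_moment p"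
      using e0 lm s unfolding e0_def[symmetric] by (simp add: powr_mult)
    fix a b M :: real and \<psi> :: "real \<Rightarrow> real"
    assume ab: "a < b" and \<psi>: "\<psi> absolutely_integrable_on {a..b}" and bd: "\<forall>x. \<bar>\<psi> x\<bar> \<le> M"
      and A: "\<forall>c d. a \<le> c \<longrightarrow> c < d \<longrightarrow> d \<le> b \<longrightarrow> integral {c..d} (\<lambda>x. exp (\<psi> x)) \<le> C * (d - c) * exp (integral {c..d} \<psi> / (d - c))"
      and zero: "integral {a..b} \<psi> = 0"
    have bd': "\<And>x. x \<in> {a..b} \<Longrightarrow> \<bar>\<psi> x\<bar> \<le> M" using bd by simp
    have A': "\<And>c d. a \<le> c \<Longrightarrow> c < d \<Longrightarrow> d \<le> b \<Longrightarrow> integral {c..d} (\<lambda>x. exp (\<psi> x)) \<le> C * (d - c) * exp (integral {c..d} \<psi> / (d - c))"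
      using A by blast
    have C1': "C \<ge> 1" using C1 by simp
    obtain I :: "real \<Rightarrow> real" where I: "mono I" "\<And>x. \<bar>I x\<bar> \<le> M"
      and law: "\<And>h :: real \<Rightarrow> real. continuous_on UNIV h \<Longrightarrow> integral {0..1} (\<lambda>t. h (I t)) = integral {a..b} (\<lambda>x. h (\<psi> x)) / (b - a)"
      and top: "\<And>s. 0 \<le> s \<Longrightarrow> s < 1 \<Longrightarrow> integral {s..1} (\<lambda>t. exp (I t)) / (1 - s) \<le> C * exp (integral {s..1} I / (1 - s))"
      using A_infinity_rearrangement[OF ab \<psi> bd' C1' A'] by blast
    define Z where "Z t = I t / \<xi>" for t
    have Ie: "\<xi> * Z t = I t" for t using xi by (simp add: Z_def)
    have Z: "mono Z" "\<And>x. \<bar>Z x\<bar> \<le> M / \<xi>"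
      using I xi by (auto simp: Z_def mono_def divide_right_mono abs_divide)
    have Zint: "integral S Z = integral S I / \<xi>" for S unfolding Z_def by simp
    have "support_plane p \<xi> (-1) 0 (integral {0..1} (\<lambda>x. exp (\<xi> * Z x))) \<le> integral {0..1} (\<lambda>x. \<bar>Z x\<bar> powr p)"
    proof (rule power_mean_bound[OF Z p xi2 xi(1,2)])
      fix s :: real assume "0 \<le> s" "s < 1"
      from top[OF this] show "integral {s..1} (\<lambda>x. exp (\<xi> * Z x)) / (1 - s) \<le> exp (- \<xi>) / (1 - \<xi>) * exp (\<xi> * top_avg Z s)"
        using xi by (simp add: Ie CK top_avg_def[OF Z] Zint)
    next
      show "integral {0..1} Z = 0" using law[of "\<lambda>x. x"] zero by (simp add: Zint)
    qed
    then have le: "log_moment p + p * u * (integral {a..b} (\<lambda>x. exp (\<psi> x)) / (b - a) - C) \<le> integral {0..1} (\<lambda>x. \<bar>Z x\<bar> powr p)"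
      unfolding sp Ie using law[of exp] by (simp add: continuous_on_exp)
    have cp: "continuous_on UNIV (\<lambda>t::real. \<bar>t\<bar> powr p)"
      by (rule continuous_on_powr') (use p in \<open>auto intro!: continuous_intros\<close>)
    have "\<xi> powr p * integral {0..1} (\<lambda>x. \<bar>Z x\<bar> powr p) = integral {0..1} (\<lambda>x. \<xi> powr p * \<bar>Z x\<bar> powr p)" by simp
    also have "\<dots> = integral {0..1} (\<lambda>x. \<bar>I x\<bar> powr p)"
      using xi by (intro Henstock_Kurzweil_Integration.integral_cong) (simp add: Z_def abs_divide powr_divide)
    also have "\<dots> = integral {a..b} (\<lambda>x. \<bar>\<psi> x\<bar> powr p) / (b - a)" by (rule law[OF cp])
    finally have eq: "\<xi> powr p * integral {0..1} (\<lambda>x. \<bar>Z x\<bar> powr p) = integral {a..b} (\<lambda>x. \<bar>\<psi> x\<bar> powr p) / (b - a)" .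
    have "\<xi> powr p * (log_moment p + p * u * (integral {a..b} (\<lambda>x. exp (\<psi> x)) / (b - a) - C)) \<le> \<xi> powr p * integral {0..1} (\<lambda>x. \<bar>Z x\<bar> powr p)"
      by (intro mult_left_mono le) simp
    then show "\<xi> powr p * log_moment p + \<xi> powr p * (p * u) * (integral {a..b} (\<lambda>x. exp (\<psi> x)) / (b - a) - C) \<le> integral {a..b} (\<lambda>x. \<bar>\<psi> x\<bar> powr p) / (b - a)"
      unfolding eq distrib_left mult.assoc .
  qed
qed

text \<open>With \<open>B = jn_k C\<close> and \<open>\<tau> = \<beta>\<close> the affine lower
  bound is \<open>\<beta> * (W - 1)\<close>, where \<open>W\<close> is the average of the
  exponential: the estimate of \<open>mean_abs_bound\<close>. Strict monotonicity of
  \<open>jn_k\<close> puts \<open>B\<close> above \<open>\<epsilon>\<close>.\<close>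

lemma jn_C_one_le:
  assumes \<epsilon>: "0 \<le> \<epsilon>" "\<epsilon> < 2 / exp 1"
  shows "jn_C \<epsilon> 1 \<le> ennreal (inv_into {1..} jn_k \<epsilon>)"
proof (rule jn_C_le)
  note k = jn_k_inverse[OF \<epsilon>]
  show "1 \<le> inv_into {1..} jn_k \<epsilon>" by (rule k)
  show "0 \<le> \<epsilon>" by (rule \<epsilon>)
  fix C assume C: "C > inv_into {1..} jn_k \<epsilon>"
  then have C1: "C > 1" using k by linarith
  have "\<epsilon> < jn_k C" using jn_k_strict_mono[OF k(1) C] k by simp
  define \<beta> where "\<beta> = 2 * ((1 - xi_minus C) * (1 - xi_plus C) / (xi_plus C - xi_minus C))"
  have kC: "jn_k C = \<beta> * (C - 1)" using C1 by (simp add: jn_k_def \<beta>_def)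
  show "\<exists>B \<tau>. \<epsilon> powr 1 < B \<and> A_infinity_lower_bound 1 C B \<tau>"
    unfolding A_infinity_lower_bound_def
  proof (rule exI[of _ "jn_k C"], rule exI[of _ \<beta>], intro conjI allI impI)
    show "\<epsilon> powr 1 < jn_k C" using \<open>\<epsilon> < jn_k C\<close> \<epsilon> by simp
    fix a b M :: real and \<psi> :: "real \<Rightarrow> real"
    assume ab: "a < b" and \<psi>: "\<psi> absolutely_integrable_on {a..b}" and bd: "\<forall>x. \<bar>\<psi> x\<bar> \<le> M"
      and A: "\<forall>c d. a \<le> c \<longrightarrow> c < d \<longrightarrow> d \<le> b \<longrightarrow> integral {c..d} (\<lambda>x. exp (\<psi> x)) \<le> C * (d - c) * exp (integral {c..d} \<psi> / (d - c))"
      and zero: "integral {a..b} \<psi> = 0"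
    have bd': "\<And>x. x \<in> {a..b} \<Longrightarrow> \<bar>\<psi> x\<bar> \<le> M" using bd by simp
    have A': "\<And>c d. a \<le> c \<Longrightarrow> c < d \<Longrightarrow> d \<le> b \<Longrightarrow> integral {c..d} (\<lambda>x. exp (\<psi> x)) \<le> C * (d - c) * exp (integral {c..d} \<psi> / (d - c))"
      using A by blast
    have C1': "C \<ge> 1" using C1 by simp
    obtain I :: "real \<Rightarrow> real" where I: "mono I" "\<And>x. \<bar>I x\<bar> \<le> M"
      and law: "\<And>h :: real \<Rightarrow> real. continuous_on UNIV h \<Longrightarrow> integral {0..1} (\<lambda>t. h (I t)) = integral {a..b} (\<lambda>x. h (\<psi> x)) / (b - a)"
      and top: "\<And>s. 0 \<le> s \<Longrightarrow> s < 1 \<Longrightarrow> integral {s..1} (\<lambda>t. exp (I t)) / (1 - s) \<le> C * exp (integral {s..1} I / (1 - s))"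
      and bot: "\<And>s. 0 < s \<Longrightarrow> s \<le> 1 \<Longrightarrow> integral {0..s} (\<lambda>t. exp (I t)) / s \<le> C * exp (integral {0..s} I / s)"
      using A_infinity_rearrangement[OF ab \<psi> bd' C1' A'] by blast
    have z: "integral {0..1} I = 0" using law[of "\<lambda>x. x"] zero by simp
    have "\<beta> * (integral {0..1} (\<lambda>t. exp (I t)) - 1) \<le> integral {0..1} (\<lambda>t. \<bar>I t\<bar>)"
      unfolding \<beta>_def
      by (rule mean_abs_bound[OF I C1 xi_plus_pos[OF C1] xi_plus(2,3)[OF C1'] xi_minus_neg[OF C1] xi_minus(2)[OF C1'] top bot z])
    also have "integral {0..1} (\<lambda>t. \<bar>I t\<bar>) = integral {a..b} (\<lambda>x. \<bar>\<psi> x\<bar>) / (b - a)"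
      by (rule law) (intro continuous_intros)
    also have "integral {0..1} (\<lambda>t. exp (I t)) = integral {a..b} (\<lambda>x. exp (\<psi> x)) / (b - a)"
      by (rule law) (intro continuous_intros)
    finally have "\<beta> * (integral {a..b} (\<lambda>x. exp (\<psi> x)) / (b - a) - 1) \<le> integral {a..b} (\<lambda>x. \<bar>\<psi> x\<bar>) / (b - a)" .
    then show "jn_k C + \<beta> * (integral {a..b} (\<lambda>x. exp (\<psi> x)) / (b - a) - C) \<le> integral {a..b} (\<lambda>x. \<bar>\<psi> x\<bar> powr 1) / (b - a)"
      unfolding kC distrib_left[symmetric] by (simp add: algebra_simps)
  qed
qed simp

lemma log_moment_1: "log_moment 1 powr (1 / 1) = 2 / exp 1"
proof -
  have "integral {0..1} (\<lambda>t::real. t powr (1 - 1) * exp t) = integral {0..1} (\<lambda>t. exp t)"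
    by (rule integral_spike[of "{0}"]) auto
  also have "\<dots> = exp 1 - exp 0"
    by (intro integral_unique fundamental_theorem_of_calculus)
       (auto intro!: derivative_eq_intros simp flip: has_real_derivative_iff_has_vector_derivative)
  finally have "log_moment 1 = 2 / exp 1" by (simp add: log_moment_def field_simps)
  then show ?thesis by simp
qed

section \<open>The John--Nirenberg constant\<close>

lemma jn_eps0_eq:
  assumes p: "1 \<le> p" "p \<le> 2"
  shows "jn_eps0 p = ereal (log_moment p powr (1 / p))"
proof -
  define e0 where "e0 = log_moment p powr (1 / p)"
  have e0: "e0 > 0" using log_moment_pos[OF p(1)] by (simp add: e0_def)
  have inf: "jn_C e0 p = \<infinity>"
  proof (rule ccontr)
    assume "jn_C e0 p \<noteq> \<infinity>"
    then obtain r where r: "jn_C e0 p = ennreal r" "r \<ge> 0" by (cases "jn_C e0 p") auto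
    \<comment> \<open>With this choice \<open>exp (-1) / (1 - \<xi>) = r + 2\<close>, so the
      logarithmic lower bound already exceeds the supposed finite value \<open>r\<close>.\<close>
    define \<xi> where "\<xi> = 1 - exp (-1) / (r + 2)"
    have q: "0 < exp (-1) / (r + 2)" "exp (-1) / (r + 2) \<le> 1"
      using r by (auto simp: divide_le_eq_1 intro: order_trans[of _ 1])
    have xi: "0 \<le> \<xi>" "\<xi> < 1" using q by (auto simp: \<xi>_def)
    have "ennreal (exp (- \<xi>) / (1 - \<xi>)) \<le> jn_C (\<xi> * e0) p" unfolding e0_def by (rule jn_C_ge_log[OF p(1) xi])
    also have "\<dots> \<le> jn_C e0 p" using xi e0 by (intro jn_C_mono) (simp add: mult_left_le_one_le)
    finally have "exp (- \<xi>) / (1 - \<xi>) \<le> r" using r by simp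
    moreover have "r + 2 \<le> exp (- \<xi>) / (1 - \<xi>)"
    proof -
      have "r + 2 = exp (-1) / (1 - \<xi>)" using r by (simp add: \<xi>_def)
      also have "\<dots> \<le> exp (- \<xi>) / (1 - \<xi>)" using xi by (intro divide_right_mono) auto
      finally show ?thesis .
    qed
    ultimately show False by simp
  qed
  have fin: "jn_C \<epsilon> p < \<infinity>" if \<epsilon>: "0 \<le> \<epsilon>" "\<epsilon> < e0" for \<epsilon>
  \<comment> \<open>For \<open>p = 1\<close> no \<open>s < 1\<close> satisfies
    \<open>2 - p \<le> s\<close>, so finiteness comes from the estimate by the inverse of
    \<open>jn_k\<close>.\<close>
  proof (cases "p = 1")
    case True
    then have "\<epsilon> < 2 / exp 1" using \<epsilon> log_moment_1 by (simp add: e0_def)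
    from jn_C_one_le[OF \<epsilon>(1) this] show ?thesis
      unfolding True infinity_ennreal_def by (rule le_less_trans) simp
  next
    case False
    then have p1: "p > 1" using p by simp
    define s where "s = max (\<epsilon> / e0) (2 - p)"
    have s: "2 - p \<le> s" "0 \<le> s" "s < 1" using \<epsilon> e0 p p1 by (auto simp: s_def)
    have "\<epsilon> = \<epsilon> / e0 * e0" using e0 by simp
    also have "\<dots> \<le> s * e0" using e0 by (intro mult_right_mono) (auto simp: s_def)
    finally have "jn_C \<epsilon> p \<le> jn_C (s * e0) p" by (rule jn_C_mono)
    also have "\<dots> \<le> ennreal (exp (- s) / (1 - s))" unfolding e0_def by (rule jn_C_power_le[OF p1 p(2) s])
    finally show ?thesis unfolding infinity_ennreal_def by (rule le_less_trans) simp
  qed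
  have "jn_eps0 p = ereal e0"
    unfolding jn_eps0_def
  proof (rule antisym)
    show "Sup {d. \<forall>\<epsilon>\<ge>0. ereal \<epsilon> < d \<longrightarrow> jn_C \<epsilon> p < \<infinity>} \<le> ereal e0"
    proof (rule Sup_least, clarify)
      fix d assume d: "\<forall>\<epsilon>\<ge>0. ereal \<epsilon> < d \<longrightarrow> jn_C \<epsilon> p < \<infinity>"
      show "d \<le> ereal e0"
      proof (rule ccontr)
        assume "\<not> d \<le> ereal e0"
        then have "jn_C e0 p < \<infinity>" using d e0 by (simp add: not_le)
        then show False using inf by simp
      qed
    qed
    show "ereal e0 \<le> Sup {d. \<forall>\<epsilon>\<ge>0. ereal \<epsilon> < d \<longrightarrow> jn_C \<epsilon> p < \<infinity>}"
      using fin by (intro Sup_upper) auto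
  qed
  then show ?thesis by (simp add: e0_def)
qed

theorem theorem1p1:
  shows "(\<forall>p::real. 1 \<le> p \<and> p \<le> 2 \<longrightarrow>
            jn_eps0 p =
              ereal ((p / exp 1 * (Gamma p - integral {0..1} (\<lambda>t. t powr (p - 1) * exp t)) + 1)
                       powr (1 / p))) \<and>
         (\<forall>p \<epsilon> :: real. 1 < p \<and> p \<le> 2 \<and>
            ereal (2 - p) * jn_eps0 p \<le> ereal \<epsilon> \<and> ereal \<epsilon> < jn_eps0 p \<longrightarrow>
            jn_C \<epsilon> p =
              ennreal (exp (- (\<epsilon> / real_of_ereal (jn_eps0 p))) /
                       (1 - \<epsilon> / real_of_ereal (jn_eps0 p)))) \<and>
         (\<forall>\<epsilon>::real. 0 \<le> \<epsilon> \<and> \<epsilon> < 2 / exp 1 \<longrightarrow>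
            ennreal (exp (- (exp 1 / 2 * \<epsilon>)) / (1 - exp 1 / 2 * \<epsilon>)) \<le> jn_C \<epsilon> 1 \<and>
            jn_C \<epsilon> 1 \<le> ennreal (inv_into {1..} jn_k \<epsilon>))"
proof (intro conjI allI impI)
  fix p :: real assume "1 \<le> p \<and> p \<le> 2"
  then show "jn_eps0 p = ereal ((p / exp 1 * (Gamma p - integral {0..1} (\<lambda>t. t powr (p - 1) * exp t)) + 1) powr (1 / p))"
    using jn_eps0_eq[of p] by (simp add: log_moment_def)
next
  fix p \<epsilon> :: real
  assume a: "1 < p \<and> p \<le> 2 \<and> ereal (2 - p) * jn_eps0 p \<le> ereal \<epsilon> \<and> ereal \<epsilon> < jn_eps0 p"
  define e0 where "e0 = log_moment p powr (1 / p)"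
  have e: "jn_eps0 p = ereal e0" using jn_eps0_eq[of p] a by (simp add: e0_def)
  have e0: "e0 > 0" using log_moment_pos[of p] a by (simp add: e0_def)
  define s where "s = \<epsilon> / e0"
  have "(2 - p) * e0 \<le> \<epsilon>" "\<epsilon> < e0" using a by (auto simp: e)
  then have s: "2 - p \<le> s" "s < 1" using e0 by (auto simp: s_def field_simps)
  then have s0: "0 \<le> s" using a by linarith
  have es: "\<epsilon> = s * log_moment p powr (1 / p)" using e0 by (simp add: s_def e0_def)
  have "jn_C \<epsilon> p = ennreal (exp (- s) / (1 - s))"
    unfolding es using a s s0 by (intro antisym jn_C_power_le jn_C_ge_log) auto
  then show "jn_C \<epsilon> p = ennreal (exp (- (\<epsilon> / real_of_ereal (jn_eps0 p))) / (1 - \<epsilon> / real_of_ereal (jn_eps0 p)))"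
    by (simp add: e s_def)
next
  fix \<epsilon> :: real assume \<epsilon>: "0 \<le> \<epsilon> \<and> \<epsilon> < 2 / exp 1"
  then show "jn_C \<epsilon> 1 \<le> ennreal (inv_into {1..} jn_k \<epsilon>)" by (intro jn_C_one_le) auto
  define s where "s = exp 1 / 2 * \<epsilon>"
  have "ennreal (exp (- s) / (1 - s)) \<le> jn_C (s * log_moment 1 powr (1 / 1)) 1"
    using \<epsilon> by (intro jn_C_ge_log) (auto simp: s_def field_simps)
  then show "ennreal (exp (- (exp 1 / 2 * \<epsilon>)) / (1 - exp 1 / 2 * \<epsilon>)) \<le> jn_C \<epsilon> 1"
    unfolding log_moment_1 by (simp add: s_def)
qed

end
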